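(* Let $\mathsf{k}$ be a field of characteristic $p>2$, let $n$ be a positive integer divisible by $p$, let $G=\langle g\rangle\cong\mathbb{Z}/n\mathbb{Z}$, and let $\lambda,\mu\in\mathsf{k}$. There is a (filtered) pointed Hopf algebra, generated by $a$, $b$, and $g$, with (defining) relations $$g^n=1,\quad g^{-1}ag=a,\quad g^{-1}bg=a+b,$$ $$a^p=\lambda(1-g^p),\quad b^p=\mu(1-g^p),\quad ba=ab+\tfrac12a^2,$$ with coproduct determined by $$\Delta(g)=g\otimes g,\quad \Delta(a)=a\otimes 1+g\otimes a,\quad \Delta(b)=b\otimes 1+g\otimes b,$$ whose associated graded Hopf algebra is the Hopf algebra $\mathcal{B}(V)\#\mathsf{k}G$, described in the context.
   Context: $V$ is the two-dimensional right $\mathsf{k}G$-module with basis $\{a,b\}$ and action $a\cdot g=a$, $b\cdot g=a+b$, regarded as a Yetter--Drinfeld module concentrated in degree $g$; $\mathcal{B}(V)$ is its Nichols algebra, and $\mathcal{B}(V)\#\mathsf{k}G$ is the Radford biproduct (bosonization). Explicitly, $\mathcal{B}(V)\#\mathsf{k}G$ is the $p^2n$-dimensional graded pointed Hopf algebra generated by $a,b,g$ with defining relations $$g^n=1,\quad g^{-1}ag=a,\quad g^{-1}bg=a+b,\quad a^p=0,\quad b^p=0,\quad ba=ab+\tfrac12a^2,$$ and coproduct determined by $\Delta(g)=g\otimes g$, $\Delta(a)=a\otimes1+g\otimes a$, $\Delta(b)=b\otimes1+g\otimes b$; the grading has $g$ in degree $0$ and $a,b$ in degree $1$. A Hopf algebra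 is pointed if all its simple subcoalgebras are one-dimensional. "Associated graded Hopf algebra" is meant in the sense of the Andruskiewitsch--Schneider lifting method, i.e. with respect to the coradical filtration; the Hopf algebra is then called a lifting of $\mathcal{B}(V)\#\mathsf{k}G$. *)

theory Defs
  imports Complex_Main "HOL-Library.Poly_Mapping" "HOL-Algebra.Module" "HOL-Algebra.Ideal"
begin

section \<open>Vector spaces and algebras over a field\<close>

text \<open>
  The ground field is a type of class \<^class>\<open>field\<close>. Vector spaces and algebras depend on
  parameters, hence are carrier-based: they are \<open>module\<close> records, and a plain vector space is
  such a record whose multiplication and unit are ignored. The locale \<open>algebra\<close> of HOL-Algebra
  is not usable, as it is restricted to commutative algebras.
\<close>

definition ground :: "('k::field, 'k) module" where
  "ground = \<lparr>carrier = UNIV, mult = (*), one = 1, zero = 0, add = (+), smult = (*)\<rparr>"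

definition assoc_algebra :: "('k::field, 'v, 'm) module_scheme \<Rightarrow> bool" where
  "assoc_algebra A \<longleftrightarrow> ring A \<and> module ground A \<and>
     (\<forall>c. \<forall>x\<in>carrier A. \<forall>y\<in>carrier A.
        (c \<odot>\<^bsub>A\<^esub> x) \<otimes>\<^bsub>A\<^esub> y = c \<odot>\<^bsub>A\<^esub> (x \<otimes>\<^bsub>A\<^esub> y) \<and>
        x \<otimes>\<^bsub>A\<^esub> (c \<odot>\<^bsub>A\<^esub> y) = c \<odot>\<^bsub>A\<^esub> (x \<otimes>\<^bsub>A\<^esub> y))"

abbreviation subspace_of :: "'v set \<Rightarrow> ('k::field, 'v, 'm) module_scheme \<Rightarrow> bool" where
  "subspace_of W V \<equiv> submodule W ground V"

definition lin_span :: "('k::field, 'v, 'm) module_scheme \<Rightarrow> 'v set \<Rightarrow> 'v set" where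
  "lin_span V X = \<Inter>{W. subspace_of W V \<and> X \<subseteq> W}"

definition linear_map ::
    "('k::field, 'v, 'm) module_scheme \<Rightarrow> ('k, 'w, 'n) module_scheme \<Rightarrow> ('v \<Rightarrow> 'w) \<Rightarrow> bool" where
  "linear_map V W f \<longleftrightarrow> f \<in> carrier V \<rightarrow> carrier W \<and>
     (\<forall>x\<in>carrier V. \<forall>y\<in>carrier V. f (x \<oplus>\<^bsub>V\<^esub> y) = f x \<oplus>\<^bsub>W\<^esub> f y) \<and>
     (\<forall>c. \<forall>x\<in>carrier V. f (c \<odot>\<^bsub>V\<^esub> x) = c \<odot>\<^bsub>W\<^esub> f x)"

definition algebra_hom ::
    "('k::field, 'v, 'm) module_scheme \<Rightarrow> ('k, 'w, 'n) module_scheme \<Rightarrow> ('v \<Rightarrow> 'w) \<Rightarrow> bool" where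
  "algebra_hom A B f \<longleftrightarrow> f \<in> ring_hom A B \<and> linear_map A B f"

definition has_dim :: "('k::field, 'v, 'm) module_scheme \<Rightarrow> nat \<Rightarrow> bool" where
  "has_dim V d \<longleftrightarrow> (\<exists>e. (\<forall>i<d. e i \<in> carrier V) \<and>
     (\<forall>x\<in>carrier V. \<exists>!c. c \<in> {..<d} \<rightarrow>\<^sub>E UNIV \<and> x = (\<Oplus>\<^bsub>V\<^esub>i\<in>{..<d}. c i \<odot>\<^bsub>V\<^esub> e i)))"

section \<open>Tensor products\<close>

text \<open>
  \<open>V \<otimes> W\<close> is the free vector space on pairs modulo the subspace of bilinearity relations; its
  elements are cosets. Operations on cosets are defined through representatives.
\<close>

definition pm_scale :: "'k \<Rightarrow> ('x \<Rightarrow>\<^sub>0 'k::field) \<Rightarrow> ('x \<Rightarrow>\<^sub>0 'k)" where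
  "pm_scale c = Poly_Mapping.map ((*) c)"

definition rep :: "'x set \<Rightarrow> 'x" where
  "rep X = (SOME x. x \<in> X)"

type_synonym ('k, 'v, 'w) tensor = "(('v \<times> 'w) \<Rightarrow>\<^sub>0 'k) set"

definition tensor_null ::
    "('k::field, 'v, 'm) module_scheme \<Rightarrow> ('k, 'w, 'n) module_scheme \<Rightarrow> ('k, 'v, 'w) tensor" where
  "tensor_null V W = module.span pm_scale
     ({Poly_Mapping.single (x \<oplus>\<^bsub>V\<^esub> x', y) 1 - Poly_Mapping.single (x, y) 1
         - Poly_Mapping.single (x', y) 1 | x x' y.
         x \<in> carrier V \<and> x' \<in> carrier V \<and> y \<in> carrier W} \<union>
      {Poly_Mapping.single (x, y \<oplus>\<^bsub>W\<^esub> y') 1 - Poly_Mapping.single (x, y) 1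
         - Poly_Mapping.single (x, y') 1 | x y y'.
         x \<in> carrier V \<and> y \<in> carrier W \<and> y' \<in> carrier W} \<union>
      {Poly_Mapping.single (c \<odot>\<^bsub>V\<^esub> x, y) 1 - Poly_Mapping.single (x, y) c | c x y.
         x \<in> carrier V \<and> y \<in> carrier W} \<union>
      {Poly_Mapping.single (x, c \<odot>\<^bsub>W\<^esub> y) 1 - Poly_Mapping.single (x, y) c | c x y.
         x \<in> carrier V \<and> y \<in> carrier W})"

definition tensor_class ::
    "('k::field, 'v, 'm) module_scheme \<Rightarrow> ('k, 'w, 'n) module_scheme \<Rightarrow>
     (('v \<times> 'w) \<Rightarrow>\<^sub>0 'k) \<Rightarrow> ('k, 'v, 'w) tensor" where
  "tensor_class V W r = {r + s | s. s \<in> tensor_null V W}"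

definition tensor ::
    "('k::field, 'v, 'm) module_scheme \<Rightarrow> ('k, 'w, 'n) module_scheme \<Rightarrow>
     'v \<Rightarrow> 'w \<Rightarrow> ('k, 'v, 'w) tensor" where
  "tensor V W x y = tensor_class V W (Poly_Mapping.single (x, y) 1)"

text \<open>The product is \<open>(x \<otimes> y) (x' \<otimes> y') = x x' \<otimes> y y'\<close>.\<close>

definition tensor_product ::
    "('k::field, 'v, 'm) module_scheme \<Rightarrow> ('k, 'w, 'n) module_scheme \<Rightarrow>
     ('k, ('k, 'v, 'w) tensor) module" where
  "tensor_product A B =
     \<lparr>carrier = tensor_class A B ` {r. Poly_Mapping.keys r \<subseteq> carrier A \<times> carrier B},
      mult = (\<lambda>T U. tensor_class A B
        (\<Sum>(x, y)\<in>Poly_Mapping.keys (rep T). \<Sum>(x', y')\<in>Poly_Mapping.keys (rep U).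
          Poly_Mapping.single (x \<otimes>\<^bsub>A\<^esub> x', y \<otimes>\<^bsub>B\<^esub> y')
            (Poly_Mapping.lookup (rep T) (x, y) * Poly_Mapping.lookup (rep U) (x', y')))),
      one = tensor A B \<one>\<^bsub>A\<^esub> \<one>\<^bsub>B\<^esub>,
      zero = tensor_class A B 0,
      add = (\<lambda>T U. tensor_class A B (rep T + rep U)),
      smult = (\<lambda>c T. tensor_class A B (pm_scale c (rep T)))\<rparr>"

text \<open>The linear map \<open>V \<otimes> W \<rightarrow> U\<close>, \<open>x \<otimes> y \<mapsto> \<beta> x y\<close> induced by a bilinear map \<open>\<beta>\<close>.\<close>

definition tensor_lift ::
    "('k::field, 'u, 'm) module_scheme \<Rightarrow> ('v \<Rightarrow> 'w \<Rightarrow> 'u) \<Rightarrow> ('k, 'v, 'w) tensor \<Rightarrow> 'u" where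
  "tensor_lift U \<beta> T =
     (\<Oplus>\<^bsub>U\<^esub>q\<in>Poly_Mapping.keys (rep T). Poly_Mapping.lookup (rep T) q \<odot>\<^bsub>U\<^esub> \<beta> (fst q) (snd q))"

section \<open>Hopf algebras\<close>

record (overloaded) ('k::field, 'h) hopf = "('k, 'h) module" +
  comult :: "'h \<Rightarrow> ('k, 'h, 'h) tensor"
  counit :: "'h \<Rightarrow> 'k"

text \<open>Coassociativity identifies \<open>(H \<otimes> H) \<otimes> H\<close> with \<open>H \<otimes> (H \<otimes> H)\<close>.\<close>

definition bialgebra :: "('k::field, 'h) hopf \<Rightarrow> bool" where
  "bialgebra H \<longleftrightarrow> assoc_algebra H \<and>
     algebra_hom H (tensor_product H H) (comult H) \<and>
     algebra_hom H ground (counit H) \<and>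
     (\<forall>h\<in>carrier H.
        (let H2 = tensor_product H H; H3 = tensor_product H H2 in
          tensor_lift H3 (\<lambda>x y. tensor_lift H3 (\<lambda>u v. tensor H H2 u (tensor H H v y)) (comult H x))
            (comult H h) =
          tensor_lift H3 (\<lambda>x y. tensor H H2 x (comult H y)) (comult H h)) \<and>
        tensor_lift H (\<lambda>x y. counit H x \<odot>\<^bsub>H\<^esub> y) (comult H h) = h \<and>
        tensor_lift H (\<lambda>x y. counit H y \<odot>\<^bsub>H\<^esub> x) (comult H h) = h)"

definition is_antipode :: "('k::field, 'h) hopf \<Rightarrow> ('h \<Rightarrow> 'h) \<Rightarrow> bool" where
  "is_antipode H S \<longleftrightarrow> linear_map H H S \<and>
     (\<forall>h\<in>carrier H.
        tensor_lift H (\<lambda>x y. S x \<otimes>\<^bsub>H\<^esub> y) (comult H h) = counit H h \<odot>\<^bsub>H\<^esub> \<one>\<^bsub>H\<^esub> \<and>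
        tensor_lift H (\<lambda>x y. x \<otimes>\<^bsub>H\<^esub> S y) (comult H h) = counit H h \<odot>\<^bsub>H\<^esub> \<one>\<^bsub>H\<^esub>)"

text \<open>The antipode is unique and preserved by bialgebra maps, so it need not be part of the data.\<close>

definition hopf_algebra :: "('k::field, 'h) hopf \<Rightarrow> bool" where
  "hopf_algebra H \<longleftrightarrow> bialgebra H \<and> (\<exists>S. is_antipode H S)"

definition hopf_iso :: "('k::field, 'h) hopf \<Rightarrow> ('k, 'l) hopf \<Rightarrow> ('h \<Rightarrow> 'l) \<Rightarrow> bool" where
  "hopf_iso H L f \<longleftrightarrow> algebra_hom H L f \<and> bij_betw f (carrier H) (carrier L) \<and>
     (\<forall>x\<in>carrier H.
        comult L (f x) =
          tensor_lift (tensor_product L L) (\<lambda>u v. tensor L L (f u) (f v)) (comult H x) \<and>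
        counit L (f x) = counit H x)"

section \<open>Pointedness and the coradical filtration\<close>

text \<open>The image of \<open>D \<otimes> E\<close> in \<open>H \<otimes> H\<close>.\<close>

definition tensor_sub :: "('k::field, 'h) hopf \<Rightarrow> 'h set \<Rightarrow> 'h set \<Rightarrow> ('k, 'h, 'h) tensor set" where
  "tensor_sub H D E = lin_span (tensor_product H H) {tensor H H x y | x y. x \<in> D \<and> y \<in> E}"

definition subcoalgebra :: "('k::field, 'h) hopf \<Rightarrow> 'h set \<Rightarrow> bool" where
  "subcoalgebra H D \<longleftrightarrow> subspace_of D H \<and> (\<forall>x\<in>D. comult H x \<in> tensor_sub H D D)"

definition simple_subcoalgebra :: "('k::field, 'h) hopf \<Rightarrow> 'h set \<Rightarrow> bool" where
  "simple_subcoalgebra H D \<longleftrightarrow> subcoalgebra H D \<and> D \<noteq> {\<zero>\<^bsub>H\<^esub>} \<and>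
     (\<forall>E. subcoalgebra H E \<and> E \<subseteq> D \<longrightarrow> E = {\<zero>\<^bsub>H\<^esub>} \<or> E = D)"

definition pointed :: "('k::field, 'h) hopf \<Rightarrow> bool" where
  "pointed H \<longleftrightarrow> (\<forall>D. simple_subcoalgebra H D \<longrightarrow> has_dim (H\<lparr>carrier := D\<rparr>) 1)"

definition coradical :: "('k::field, 'h) hopf \<Rightarrow> 'h set" where
  "coradical H = lin_span H (\<Union>{D. simple_subcoalgebra H D})"

text \<open>\<open>H\<^sub>m\<^sub>+\<^sub>1 = \<Delta>\<^sup>-\<^sup>1(H \<otimes> H\<^sub>m + H\<^sub>0 \<otimes> H)\<close>.\<close>

primrec coradical_filtration :: "('k::field, 'h) hopf \<Rightarrow> nat \<Rightarrow> 'h set" where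
  "coradical_filtration H 0 = coradical H"
| "coradical_filtration H (Suc m) =
     {x \<in> carrier H. comult H x \<in> lin_span (tensor_product H H)
        (tensor_sub H (carrier H) (coradical_filtration H m) \<union>
         tensor_sub H (coradical H) (carrier H))}"

section \<open>Filtered and graded Hopf algebras\<close>

definition filtered_hopf_algebra :: "('k::field, 'h) hopf \<Rightarrow> (nat \<Rightarrow> 'h set) \<Rightarrow> bool" where
  "filtered_hopf_algebra H F \<longleftrightarrow> hopf_algebra H \<and>
     (\<forall>m. subspace_of (F m) H \<and> F m \<subseteq> F (Suc m)) \<and> (\<Union>m. F m) = carrier H \<and>
     \<one>\<^bsub>H\<^esub> \<in> F 0 \<and>
     (\<forall>i j. \<forall>x\<in>F i. \<forall>y\<in>F j. x \<otimes>\<^bsub>H\<^esub> y \<in> F (i + j)) \<and>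
     (\<forall>m. \<forall>x\<in>F m. comult H x \<in>
        lin_span (tensor_product H H) (\<Union>i\<le>m. tensor_sub H (F i) (F (m - i)))) \<and>
     (\<exists>S. is_antipode H S \<and> (\<forall>m. S ` F m \<subseteq> F m))"

definition graded_hopf_algebra :: "('k::field, 'h) hopf \<Rightarrow> (nat \<Rightarrow> 'h set) \<Rightarrow> bool" where
  "graded_hopf_algebra H A \<longleftrightarrow> hopf_algebra H \<and>
     (\<forall>m. subspace_of (A m) H) \<and>
     (\<forall>x\<in>carrier H. \<exists>!f. (\<forall>m. f m \<in> A m) \<and> finite {m. f m \<noteq> \<zero>\<^bsub>H\<^esub>} \<and>
        x = (\<Oplus>\<^bsub>H\<^esub>m\<in>{m. f m \<noteq> \<zero>\<^bsub>H\<^esub>}. f m)) \<and>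
     \<one>\<^bsub>H\<^esub> \<in> A 0 \<and>
     (\<forall>i j. \<forall>x\<in>A i. \<forall>y\<in>A j. x \<otimes>\<^bsub>H\<^esub> y \<in> A (i + j)) \<and>
     (\<forall>m. \<forall>x\<in>A m. comult H x \<in>
        lin_span (tensor_product H H) (\<Union>i\<le>m. tensor_sub H (A i) (A (m - i)))) \<and>
     (\<forall>m>0. \<forall>x\<in>A m. counit H x = 0) \<and>
     (\<exists>S. is_antipode H S \<and> (\<forall>m. S ` A m \<subseteq> A m))"

definition graded_hopf_isomorphic ::
    "('k::field, 'h) hopf \<Rightarrow> (nat \<Rightarrow> 'h set) \<Rightarrow> ('k, 'l) hopf \<Rightarrow> (nat \<Rightarrow> 'l set) \<Rightarrow> bool" where
  "graded_hopf_isomorphic H A L B \<longleftrightarrow> (\<exists>f. hopf_iso H L f \<and> (\<forall>m. f ` A m = B m))"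

section \<open>The associated graded Hopf algebra of a filtration\<close>

text \<open>
  The underlying space is \<open>\<Oplus>\<^sub>m F m / F (m - 1)\<close> with \<open>F (-1) = 0\<close>; an element is the family of
  its components, almost all of them zero.
\<close>

definition gr_below :: "('k::field, 'h) hopf \<Rightarrow> (nat \<Rightarrow> 'h set) \<Rightarrow> nat \<Rightarrow> 'h set" where
  "gr_below H F m = (case m of 0 \<Rightarrow> {\<zero>\<^bsub>H\<^esub>} | Suc i \<Rightarrow> F i)"

definition gr_class :: "('k::field, 'h) hopf \<Rightarrow> (nat \<Rightarrow> 'h set) \<Rightarrow> nat \<Rightarrow> 'h \<Rightarrow> 'h set" where
  "gr_class H F m x = gr_below H F m +>\<^bsub>H\<^esub> x"

text \<open>The class of \<open>x \<in> F m\<close>, placed in degree \<open>m\<close>.\<close>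

definition gr_elem :: "('k::field, 'h) hopf \<Rightarrow> (nat \<Rightarrow> 'h set) \<Rightarrow> nat \<Rightarrow> 'h \<Rightarrow> nat \<Rightarrow> 'h set" where
  "gr_elem H F m x = (\<lambda>j. gr_class H F j (if j = m then x else \<zero>\<^bsub>H\<^esub>))"

definition gr_algebra ::
    "('k::field, 'h) hopf \<Rightarrow> (nat \<Rightarrow> 'h set) \<Rightarrow> ('k, nat \<Rightarrow> 'h set) module" where
  "gr_algebra H F =
     \<lparr>carrier = {f. (\<forall>m. f m \<in> gr_class H F m ` F m) \<and>
                    finite {m. f m \<noteq> gr_class H F m \<zero>\<^bsub>H\<^esub>}},
      mult = (\<lambda>f h m. gr_class H F m (\<Oplus>\<^bsub>H\<^esub>i\<in>{..m}. rep (f i) \<otimes>\<^bsub>H\<^esub> rep (h (m - i)))),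
      one = gr_elem H F 0 \<one>\<^bsub>H\<^esub>,
      zero = gr_elem H F 0 \<zero>\<^bsub>H\<^esub>,
      add = (\<lambda>f h m. gr_class H F m (rep (f m) \<oplus>\<^bsub>H\<^esub> rep (h m))),
      smult = (\<lambda>c f m. gr_class H F m (c \<odot>\<^bsub>H\<^esub> rep (f m)))\<rparr>"

text \<open>
  For \<open>x \<in> F m\<close>, write \<open>\<Delta> x = \<Sum>i\<le>m. r i\<close> with \<open>r i \<in> F i \<otimes> F (m - i)\<close>; the coproduct of the
  class of \<open>x\<close> is the sum of the classes of \<open>r i\<close> in \<open>F i / F (i - 1) \<otimes> F (m - i) / F (m - i - 1)\<close>.
\<close>

definition gr_comult_hom ::
    "('k::field, 'h) hopf \<Rightarrow> (nat \<Rightarrow> 'h set) \<Rightarrow> nat \<Rightarrow> 'h \<Rightarrow>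
     ('k, nat \<Rightarrow> 'h set, nat \<Rightarrow> 'h set) tensor" where
  "gr_comult_hom H F m x =
     (let G = gr_algebra H F; G2 = tensor_product G G;
          r = (SOME r. (\<forall>i\<le>m. Poly_Mapping.keys (r i) \<subseteq> F i \<times> F (m - i)) \<and>
                 comult H x = tensor_class H H (\<Sum>i\<le>m. r i))
      in \<Oplus>\<^bsub>G2\<^esub>i\<in>{..m}. \<Oplus>\<^bsub>G2\<^esub>q\<in>Poly_Mapping.keys (r i).
           Poly_Mapping.lookup (r i) q \<odot>\<^bsub>G2\<^esub>
             tensor G G (gr_elem H F i (fst q)) (gr_elem H F (m - i) (snd q)))"

definition gr_hopf ::
    "('k::field, 'h) hopf \<Rightarrow> (nat \<Rightarrow> 'h set) \<Rightarrow> ('k, nat \<Rightarrow> 'h set) hopf" where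
  "gr_hopf H F = module.extend (gr_algebra H F) (hopf.fields
     (\<lambda>f. \<Oplus>\<^bsub>tensor_product (gr_algebra H F) (gr_algebra H F)\<^esub>
        m\<in>{m. f m \<noteq> gr_class H F m \<zero>\<^bsub>H\<^esub>}. gr_comult_hom H F m (rep (f m)))
     (\<lambda>f. counit H (rep (f 0))))"

definition gr_degree ::
    "('k::field, 'h) hopf \<Rightarrow> (nat \<Rightarrow> 'h set) \<Rightarrow> nat \<Rightarrow> (nat \<Rightarrow> 'h set) set" where
  "gr_degree H F m =
     {f \<in> carrier (gr_hopf H F). \<forall>j. j \<noteq> m \<longrightarrow> f j = gr_class H F j \<zero>\<^bsub>H\<^esub>}"

section \<open>Presentations by generators and relations\<close>

datatype 'x fmon = Word "'x list"

instantiation fmon :: (type) monoid_add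
begin

definition "0 = Word []"

fun plus_fmon where "Word u + Word v = Word (u @ v)"

instance
proof
  fix a b c :: "'a fmon"
  show "a + b + c = a + (b + c)" by (cases a; cases b; cases c) simp
  show "0 + a = a" by (cases a) (simp add: zero_fmon_def)
  show "a + 0 = a" by (cases a) (simp add: zero_fmon_def)
qed

end

text \<open>The monoid algebra of the free monoid on \<open>'x\<close>, i.e. noncommutative polynomials.\<close>

type_synonym ('k, 'x) free = "'x fmon \<Rightarrow>\<^sub>0 'k"

definition var :: "'x \<Rightarrow> ('k::field, 'x) free" where
  "var x = Poly_Mapping.single (Word [x]) 1"

definition free_algebra :: "('k::field, ('k, 'x) free) module" where
  "free_algebra = \<lparr>carrier = UNIV, mult = (*), one = 1, zero = 0, add = (+),
     smult = pm_scale\<rparr>"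

text \<open>\<open>A\<close> is generated by the elements \<open>e x\<close> with defining relations \<open>r = 0\<close> for \<open>r \<in> R\<close>.\<close>

definition presented_by ::
    "('k::field, 'h, 'm) module_scheme \<Rightarrow> ('x \<Rightarrow> 'h) \<Rightarrow> ('k, 'x) free set \<Rightarrow> bool" where
  "presented_by A e R \<longleftrightarrow> (\<exists>\<pi>. algebra_hom free_algebra A \<pi> \<and> (\<forall>x. \<pi> (var x) = e x) \<and>
     range \<pi> = carrier A \<and> a_kernel free_algebra A \<pi> = Idl\<^bsub>free_algebra\<^esub> R)"

section \<open>The Hopf algebras of the theorem\<close>

datatype gens = GenA | GenB | GenG

text \<open>The element \<open>g\<^sup>-\<^sup>1\<close> is \<open>g\<^sup>n\<^sup>-\<^sup>1\<close>, because of \<open>g\<^sup>n = 1\<close> and \<open>n > 0\<close>.\<close>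

definition relators :: "nat \<Rightarrow> nat \<Rightarrow> 'k::field \<Rightarrow> 'k \<Rightarrow> ('k, gens) free set" where
  "relators p n lam mu =
     (let a = var GenA; b = var GenB; g = var GenG; ginv = g ^ (n - 1) in
       {g ^ n - 1,
        ginv * a * g - a,
        ginv * b * g - (a + b),
        a ^ p - pm_scale lam (1 - g ^ p),
        b ^ p - pm_scale mu (1 - g ^ p),
        b * a - (a * b + pm_scale (1 / 2) (a ^ 2))})"

definition hopf_with_relations ::
    "nat \<Rightarrow> nat \<Rightarrow> 'k::field \<Rightarrow> 'k \<Rightarrow> ('k, 'h) hopf \<Rightarrow> 'h \<Rightarrow> 'h \<Rightarrow> 'h \<Rightarrow> bool" where
  "hopf_with_relations p n lam mu H a b g \<longleftrightarrow> hopf_algebra H \<and>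
     presented_by H (case_gens a b g) (relators p n lam mu) \<and>
     comult H g = tensor H H g g \<and>
     comult H a = tensor H H a \<one>\<^bsub>H\<^esub> \<oplus>\<^bsub>tensor_product H H\<^esub> tensor H H g a \<and>
     comult H b = tensor H H b \<one>\<^bsub>H\<^esub> \<oplus>\<^bsub>tensor_product H H\<^esub> tensor H H g b"

text \<open>
  \<open>B\<close> with the grading \<open>A\<close> is the bosonization \<open>\<B>(V) # kG\<close> of the Nichols algebra of the
  two-dimensional Yetter-Drinfeld module \<open>V\<close> over \<open>G = \<langle>g\<rangle> \<cong> \<int>/n\<int>\<close>, in its explicit description:
  \<open>V\<close> has basis \<open>a, b\<close>, degree \<open>g\<close> and action \<open>a \<cdot> g = a\<close>, \<open>b \<cdot> g = a + b\<close>. With both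
  parameters zero the relations on the \<open>p\<close>-th powers become \<open>a\<^sup>p = 0\<close> and \<open>b\<^sup>p = 0\<close>.
\<close>

definition is_bosonization ::
    "nat \<Rightarrow> nat \<Rightarrow> ('k::field, 'h) hopf \<Rightarrow> (nat \<Rightarrow> 'h set) \<Rightarrow> bool" where
  "is_bosonization p n B A \<longleftrightarrow> (\<exists>a b g. hopf_with_relations p n 0 0 B a b g \<and>
     graded_hopf_algebra B A \<and> g \<in> A 0 \<and> a \<in> A 1 \<and> b \<in> A 1 \<and>
     pointed B \<and> has_dim B (p\<^sup>2 * n))"

end

(*
  Via an action on quasi-periodic functions, the monomials b^j a^i g^k with i, j < p and k < n form
  a basis of the presented algebra. The powers of b have coproduct
    Delta(b)^j = sum_t (j choose t) g^t (b + (t/2) a)^(j-t) (x) b^t,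
  and similarly for a. The middle terms vanish for j = p, so that Delta, the counit and the antipode respect the
  relations. All right factors in the coproduct of a basis element are basis elements. Reading off
  coefficients by right factors shows that every nonzero subcoalgebra contains a power of g, and that
  the coradical filtration is the filtration by the degree j + i. Finally, the operations of the
  algebra for (lam, mu) agree, up to terms of lower degree, with those of the algebra for (0, 0) on
  the same monomials, which is therefore the associated graded Hopf algebra.
*)

theory Submission
  imports Defs "HOL-Algebra.RingHom" "HOL-Computational_Algebra.Primes"
begin

section \<open>Vector spaces over the ground field\<close>

text \<open>A presentation makes spanning and homomorphisms easy but says nothing about linear
  independence, which needs a model where the relations hold for all \<open>lam\<close> and
  \<open>mu\<close>. The computations rest on the family \<open>slope c\<close>, that is
  \<open>b + c a\<close>: conjugation by \<open>g\<close> and commutation with \<open>a\<close> only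
  move \<open>c\<close>, and \<open>slope_power_shift\<close> turns a product of different slopes
  into one with equal slopes. This produces the half-integers in the coproduct of the powers of
  \<open>b\<close> and the \<open>p\<close>-th power of its antipode. The hypotheses enter through
  the field: \<open>n = 0\<close> there, since \<open>p dvd n\<close>, so that conjugation by
  \<open>g ^ n\<close> can be trivial; \<open>p > 2\<close> makes \<open>1 / 2\<close> available;
  and the integers between 0 and \<open>p\<close> are invertible, which keeps the coradical
  filtration from growing faster than the degree. Equalities between homomorphisms are decided on
  generators. The lifting, the case of zero parameters and the associated graded algebra itself are
  instances of one locale, \<open>hopf_lifting\<close>, so each fact is proved once.\<close>

lemma ground_simps [simp]:
  "carrier ground = UNIV" "monoid.mult ground = (*)" "one ground = 1" "zero ground = 0"
  "add ground = (+)" "smult ground = (*)"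
  by (simp_all add: ground_def)

lemma cring_ground: "cring (ground :: ('k::field, 'k) module)"
  by (rule cringI; (rule abelian_groupI comm_monoidI)?)
    (auto simp: algebra_simps intro: exI[of _ "- x" for x])

locale vspace = module ground V for V :: "('k::field, 'v, 'm) module_scheme" (structure)
begin

lemma scale_closed [simp, intro]: "x \<in> carrier V \<Longrightarrow> c \<odot> x \<in> carrier V"
  by (rule smult_closed) simp_all

lemma scale_0 [simp]: "x \<in> carrier V \<Longrightarrow> 0 \<odot> x = \<zero>"
  using smult_l_null by simp

lemma scale_zero [simp]: "c \<odot> \<zero> = \<zero>"
  using smult_r_null by simp

lemma scale_1 [simp]: "x \<in> carrier V \<Longrightarrow> 1 \<odot> x = x"
  using smult_one by simp

lemma scale_scale [simp]: "x \<in> carrier V \<Longrightarrow> c \<odot> (d \<odot> x) = (c * d) \<odot> x"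
  using smult_assoc1[of c d x] by simp

lemma scale_add_left: "x \<in> carrier V \<Longrightarrow> (c + d) \<odot> x = c \<odot> x \<oplus> d \<odot> x"
  using smult_l_distr[of c d x] by simp

lemma scale_add_right: "x \<in> carrier V \<Longrightarrow> y \<in> carrier V \<Longrightarrow> c \<odot> (x \<oplus> y) = c \<odot> x \<oplus> c \<odot> y"
  using smult_r_distr[of c x y] by simp

lemma minus_eq_scale: "x \<in> carrier V \<Longrightarrow> \<ominus> x = (- 1) \<odot> x"
  by (rule minus_equality) (use scale_add_left[of x "- 1" 1] in simp_all)

lemma scale_sum: "finite A \<Longrightarrow> f \<in> A \<rightarrow> carrier V \<Longrightarrow> c \<odot> (\<Oplus>i\<in>A. f i) = (\<Oplus>i\<in>A. c \<odot> f i)"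
  by (rule finsum_smult_ldistr) simp_all

lemma subspaceI:
  assumes "W \<subseteq> carrier V" "\<zero> \<in> W" "\<And>x y. x \<in> W \<Longrightarrow> y \<in> W \<Longrightarrow> x \<oplus> y \<in> W"
    "\<And>c x. x \<in> W \<Longrightarrow> c \<odot> x \<in> W"
  shows "subspace_of W V"
proof (rule submoduleI)
  show "\<ominus> x \<in> W" if "x \<in> W" for x
    using assms that by (metis minus_eq_scale subsetD)
qed (use assms in auto)

lemma subspaceD:
  assumes "subspace_of W V"
  shows "W \<subseteq> carrier V" "\<zero> \<in> W" "\<And>x y. x \<in> W \<Longrightarrow> y \<in> W \<Longrightarrow> x \<oplus> y \<in> W"
    "\<And>c x. x \<in> W \<Longrightarrow> c \<odot> x \<in> W"
proof -
  note E = submoduleE[OF assms]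
  show 1: "W \<subseteq> carrier V" "\<And>x y. x \<in> W \<Longrightarrow> y \<in> W \<Longrightarrow> x \<oplus> y \<in> W"
    "\<And>c x. x \<in> W \<Longrightarrow> c \<odot> x \<in> W"
    using E by auto
  obtain x where "x \<in> W" using E(2) by auto
  with 1(1) 1(3)[of x 0] show "\<zero> \<in> W" by auto
qed

lemma subspace_sum:
  assumes "subspace_of W V" "\<And>i. i \<in> A \<Longrightarrow> f i \<in> W"
  shows "(\<Oplus>i\<in>A. f i) \<in> W"
proof (cases "finite A")
  case True
  then show ?thesis using assms(2)
  proof (induction A)
    case (insert i A)
    have "f \<in> A \<rightarrow> carrier V" "f i \<in> carrier V" using insert.prems subspaceD(1)[OF assms(1)] by auto
    then show ?case using insert subspaceD(3)[OF assms(1)] by simp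
  qed (simp add: subspaceD[OF assms(1)])
qed (simp add: subspaceD[OF assms(1)] finsum_infinite)

lemma span_subspace: "X \<subseteq> carrier V \<Longrightarrow> subspace_of (lin_span V X) V"
  by (rule subspaceI) (auto simp: lin_span_def dest: subspaceD intro: carrier_is_submodule)

lemma span_superset: "X \<subseteq> lin_span V X"
  by (auto simp: lin_span_def)

lemma span_minimal: "subspace_of W V \<Longrightarrow> X \<subseteq> W \<Longrightarrow> lin_span V X \<subseteq> W"
  by (auto simp: lin_span_def)

lemma sum_single:
  assumes "finite A" "i \<in> A" "\<And>j. j \<in> A \<Longrightarrow> j \<noteq> i \<Longrightarrow> f j = \<zero>" "f i \<in> carrier V"
  shows "(\<Oplus>j\<in>A. f j) = f i"
proof -
  have f: "f \<in> A \<rightarrow> carrier V" using assms by (metis Pi_I zero_closed)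
  have "(\<Oplus>j\<in>A. f j) = (\<Oplus>j\<in>A. if i = j then f j else \<zero>)"
    by (rule finsum_cong') (use assms f in auto)
  also have "\<dots> = f i"
    by (rule finsum_singleton[OF assms(2,1) f])
  finally show ?thesis .
qed

end

lemma vspace_ground: "vspace (ground :: ('k::field, 'k) module)"
proof -
  have 1: "cring (ground :: ('k::field, 'k) module)" by (rule cring_ground)
  have 2: "abelian_group (ground :: ('k::field, 'k) module)"
    using 1 by (simp add: cring_def ring_def)
  show ?thesis unfolding vspace_def by (rule moduleI[OF 1 2]) (auto simp: algebra_simps)
qed

lemma finsum_ground: "(\<Oplus>\<^bsub>ground\<^esub>i\<in>A. f i) = sum f A" for f :: "'i \<Rightarrow> 'k::field"
proof -
  interpret vspace "ground :: ('k, 'k) module" by (rule vspace_ground)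
  show ?thesis
    by (induction A rule: infinite_finite_induct) (simp_all add: finsum_infinite)
qed

section \<open>Linear maps\<close>

lemma linear_mapI:
  assumes "\<And>x. x \<in> carrier V \<Longrightarrow> f x \<in> carrier W"
    "\<And>x y. x \<in> carrier V \<Longrightarrow> y \<in> carrier V \<Longrightarrow> f (x \<oplus>\<^bsub>V\<^esub> y) = f x \<oplus>\<^bsub>W\<^esub> f y"
    "\<And>c x. x \<in> carrier V \<Longrightarrow> f (c \<odot>\<^bsub>V\<^esub> x) = c \<odot>\<^bsub>W\<^esub> f x"
  shows "linear_map V W f"
  using assms by (auto simp: linear_map_def)

lemma linear_mapD:
  assumes "linear_map V W f"
  shows "x \<in> carrier V \<Longrightarrow> f x \<in> carrier W"
    "x \<in> carrier V \<Longrightarrow> y \<in> carrier V \<Longrightarrow> f (x \<oplus>\<^bsub>V\<^esub> y) = f x \<oplus>\<^bsub>W\<^esub> f y"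
    "x \<in> carrier V \<Longrightarrow> f (c \<odot>\<^bsub>V\<^esub> x) = c \<odot>\<^bsub>W\<^esub> f x"
  using assms by (auto simp: linear_map_def)

lemma linear_map_zero:
  assumes "vspace V" "vspace W" "linear_map V W f"
  shows "f \<zero>\<^bsub>V\<^esub> = \<zero>\<^bsub>W\<^esub>"
proof -
  interpret V: vspace V by fact
  interpret W: vspace W by fact
  have "f (0 \<odot>\<^bsub>V\<^esub> \<zero>\<^bsub>V\<^esub>) = 0 \<odot>\<^bsub>W\<^esub> f \<zero>\<^bsub>V\<^esub>"
    by (rule linear_mapD(3)[OF assms(3)]) simp
  then show ?thesis using linear_mapD(1)[OF assms(3), of "\<zero>\<^bsub>V\<^esub>"] by simp
qed

lemma linear_map_sum:
  assumes "vspace V" "vspace W" "linear_map V W f" "\<And>i. i \<in> A \<Longrightarrow> h i \<in> carrier V"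
  shows "f (\<Oplus>\<^bsub>V\<^esub>i\<in>A. h i) = (\<Oplus>\<^bsub>W\<^esub>i\<in>A. f (h i))"
proof -
  interpret V: vspace V by fact
  interpret W: vspace W by fact
  note [simp] = linear_map_zero[OF assms(1-3)] linear_mapD[OF assms(3)]
  show ?thesis
  proof (cases "finite A")
    case True
    then show ?thesis using assms(4)
    proof (induction A)
      case (insert i A)
      have "h \<in> A \<rightarrow> carrier V" "(\<lambda>i. f (h i)) \<in> A \<rightarrow> carrier W" using insert.prems by auto
      with insert show ?case by simp
    qed simp
  qed (simp add: V.finsum_infinite W.finsum_infinite)
qed

lemma linear_map_comp:
  assumes "linear_map V W f" "linear_map W U h"
  shows "linear_map V U (\<lambda>x. h (f x))"
  by (rule linear_mapI) (simp_all add: linear_mapD[OF assms(1)] linear_mapD[OF assms(2)])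

lemma linear_map_preimage:
  assumes "vspace V" "vspace W" "linear_map V W f" "subspace_of S W"
  shows "subspace_of {x \<in> carrier V. f x \<in> S} V"
proof -
  interpret V: vspace V by fact
  interpret W: vspace W by fact
  show ?thesis
    by (rule V.subspaceI)
      (auto simp: linear_mapD[OF assms(3)] linear_map_zero[OF assms(1-3)] W.subspaceD[OF assms(4)])
qed

section \<open>Associative algebras and their homomorphisms\<close>

locale assoc_alg = vspace A + ring A for A :: "('k::field, 'v, 'm) module_scheme" (structure) +
  assumes scale_mult_left: "x \<in> carrier A \<Longrightarrow> y \<in> carrier A \<Longrightarrow> (c \<odot> x) \<otimes> y = c \<odot> (x \<otimes> y)"
    and scale_mult_right: "x \<in> carrier A \<Longrightarrow> y \<in> carrier A \<Longrightarrow> x \<otimes> (c \<odot> y) = c \<odot> (x \<otimes> y)"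

lemma assoc_algebra_iff: "assoc_algebra A \<longleftrightarrow> assoc_alg A"
  by (auto simp: assoc_algebra_def assoc_alg_def assoc_alg_axioms_def vspace_def)

lemma (in assoc_alg) scale_power: "x \<in> carrier A \<Longrightarrow> (c \<odot> x) [^] (m::nat) = c ^ m \<odot> (x [^] m)"
  by (induction m) (simp_all add: scale_mult_left scale_mult_right mult.commute)

lemma assoc_alg_ground: "assoc_alg (ground :: ('k::field, 'k) module)"
  using cring_ground vspace_ground
  by (auto simp: assoc_alg_def assoc_alg_axioms_def cring_def algebra_simps)

lemma ground_power: "x [^]\<^bsub>ground\<^esub> (m::nat) = x ^ m" for x :: "'k::field"
proof -
  interpret assoc_alg "ground :: ('k, 'k) module" by (rule assoc_alg_ground)
  show ?thesis by (induction m) simp_all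
qed

lemma algebra_homI:
  assumes "\<And>x. x \<in> carrier A \<Longrightarrow> f x \<in> carrier B"
    "\<And>x y. x \<in> carrier A \<Longrightarrow> y \<in> carrier A \<Longrightarrow> f (x \<oplus>\<^bsub>A\<^esub> y) = f x \<oplus>\<^bsub>B\<^esub> f y"
    "\<And>x y. x \<in> carrier A \<Longrightarrow> y \<in> carrier A \<Longrightarrow> f (x \<otimes>\<^bsub>A\<^esub> y) = f x \<otimes>\<^bsub>B\<^esub> f y"
    "\<And>c x. x \<in> carrier A \<Longrightarrow> f (c \<odot>\<^bsub>A\<^esub> x) = c \<odot>\<^bsub>B\<^esub> f x"
    "f \<one>\<^bsub>A\<^esub> = \<one>\<^bsub>B\<^esub>"
  shows "algebra_hom A B f"
  using assms by (auto simp: algebra_hom_def linear_map_def ring_hom_def)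

lemma algebra_homD:
  assumes "algebra_hom A B f"
  shows "linear_map A B f"
    "x \<in> carrier A \<Longrightarrow> f x \<in> carrier B"
    "x \<in> carrier A \<Longrightarrow> y \<in> carrier A \<Longrightarrow> f (x \<oplus>\<^bsub>A\<^esub> y) = f x \<oplus>\<^bsub>B\<^esub> f y"
    "x \<in> carrier A \<Longrightarrow> y \<in> carrier A \<Longrightarrow> f (x \<otimes>\<^bsub>A\<^esub> y) = f x \<otimes>\<^bsub>B\<^esub> f y"
    "x \<in> carrier A \<Longrightarrow> f (c \<odot>\<^bsub>A\<^esub> x) = c \<odot>\<^bsub>B\<^esub> f x"
    "f \<one>\<^bsub>A\<^esub> = \<one>\<^bsub>B\<^esub>"
  using assms by (auto simp: algebra_hom_def linear_map_def ring_hom_def)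

lemma algebra_hom_comp:
  assumes "algebra_hom A B f" "algebra_hom B C h"
  shows "algebra_hom A C (\<lambda>x. h (f x))"
  by (rule algebra_homI) (simp_all add: algebra_homD[OF assms(1)] algebra_homD[OF assms(2)])

lemma algebra_hom_power:
  assumes "assoc_alg A" "assoc_alg B" "algebra_hom A B f" "x \<in> carrier A"
  shows "f (x [^]\<^bsub>A\<^esub> (m::nat)) = f x [^]\<^bsub>B\<^esub> m"
proof -
  interpret A: assoc_alg A by fact
  interpret B: assoc_alg B by fact
  show ?thesis by (induction m) (simp_all add: algebra_homD[OF assms(3)] assms(4))
qed

lemma algebra_hom_minus:
  assumes "assoc_alg A" "assoc_alg B" "algebra_hom A B f" "x \<in> carrier A" "y \<in> carrier A"
  shows "f (x \<ominus>\<^bsub>A\<^esub> y) = f x \<ominus>\<^bsub>B\<^esub> f y"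
proof -
  interpret A: assoc_alg A by fact
  interpret B: assoc_alg B by fact
  show ?thesis using assms(4,5)
    by (simp add: a_minus_def A.minus_eq_scale B.minus_eq_scale algebra_homD[OF assms(3)])
qed

text \<open>Every equational axiom passes to a quotient, and in particular along an isomorphism.\<close>

lemma assoc_alg_image:
  fixes A :: "('k::field, 'v, 'm) module_scheme" and B :: "('k, 'w, 'n) module_scheme"
  assumes "assoc_alg A" "algebra_hom A B f" "f ` carrier A = carrier B" "f \<zero>\<^bsub>A\<^esub> = \<zero>\<^bsub>B\<^esub>"
  shows "assoc_alg B"
proof -
  interpret A: assoc_alg A by fact
  note f = algebra_homD[OF assms(2)]
  have ex: "\<exists>x\<in>carrier A. y = f x" if "y \<in> carrier B" for y using assms(3) that by auto
  note simps = f(2) f(3-5)[symmetric] f(6)[symmetric] assms(4)[symmetric]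
  have ag: "abelian_group B"
  proof (rule abelian_groupI)
    fix x assume "x \<in> carrier B"
    then obtain u where "u \<in> carrier A" "x = f u" using ex by auto
    then show "\<exists>y\<in>carrier B. y \<oplus>\<^bsub>B\<^esub> x = \<zero>\<^bsub>B\<^esub>"
      by (intro bexI[of _ "f (\<ominus>\<^bsub>A\<^esub> u)"]) (simp_all add: simps A.l_neg)
  qed (auto dest!: ex simp: simps A.a_ac)
  have "ring B"
    by (rule ringI[OF ag])
      ((rule monoidI)?; auto dest!: ex simp: simps A.m_assoc A.l_distr A.r_distr)+
  moreover have "vspace B" unfolding vspace_def
    by (rule moduleI[OF cring_ground ag])
      (auto dest!: ex simp: simps A.scale_add_left A.scale_add_right)
  ultimately show ?thesis
    unfolding assoc_alg_def assoc_alg_axioms_def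
    by (auto dest!: ex simp: simps A.scale_mult_left A.scale_mult_right)
qed

section \<open>Tensor products\<close>

text \<open>The linear extension of \<open>\<phi>\<close> to the free vector space on its domain.
  Both \<open>tensor_lift\<close> and the evaluation of noncommutative polynomials are of this form,
  so linearity is proved once, here.\<close>

definition pm_eval :: "('k::field, 'u, 'm) module_scheme \<Rightarrow> ('x \<Rightarrow> 'u) \<Rightarrow> ('x \<Rightarrow>\<^sub>0 'k) \<Rightarrow> 'u" where
  "pm_eval U \<phi> r = (\<Oplus>\<^bsub>U\<^esub>q\<in>Poly_Mapping.keys r. Poly_Mapping.lookup r q \<odot>\<^bsub>U\<^esub> \<phi> q)"

lemma lookup_pm_scale [simp]: "Poly_Mapping.lookup (pm_scale c r) q = c * Poly_Mapping.lookup r q"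
  by (simp add: pm_scale_def map.rep_eq when_def)

lemma pm_scale_single [simp]: "pm_scale c (Poly_Mapping.single q d) = Poly_Mapping.single q (c * d)"
  by (rule poly_mapping_eqI) (simp add: lookup_single when_def)

interpretation pm: vector_space pm_scale
  by standard (auto intro!: poly_mapping_eqI simp: lookup_add algebra_simps)

lemma keys_pm_scale: "Poly_Mapping.keys (pm_scale c r) \<subseteq> Poly_Mapping.keys r"
  by (auto simp: in_keys_iff)

text \<open>Induction on the finite support, splitting off one coefficient at a time. The set
  \<open>K\<close> keeps the intermediate formal sums supported in the carrier, as carrier-based
  evaluation requires.\<close>

lemma pm_induct [consumes 1, case_names zero single add]:
  fixes P :: "('x \<Rightarrow>\<^sub>0 'k::field) \<Rightarrow> bool"
  assumes "Poly_Mapping.keys r \<subseteq> K" "P 0" "\<And>q c. q \<in> K \<Longrightarrow> P (Poly_Mapping.single q c)"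
    "\<And>r s. Poly_Mapping.keys r \<subseteq> K \<Longrightarrow> Poly_Mapping.keys s \<subseteq> K \<Longrightarrow> P r \<Longrightarrow> P s \<Longrightarrow> P (r + s)"
  shows "P r"
proof -
  have "finite L \<Longrightarrow> L \<subseteq> K \<Longrightarrow> Poly_Mapping.keys r \<subseteq> L \<Longrightarrow> P r" for L
  proof (induction L arbitrary: r rule: finite_induct)
    case empty
    then have "r = 0" by (intro poly_mapping_eqI) (auto simp: in_keys_iff)
    with assms(2) show ?case by simp
  next
    case (insert q L)
    let ?s = "Poly_Mapping.single q (Poly_Mapping.lookup r q)"
    have s: "Poly_Mapping.keys (r - ?s) \<subseteq> L"
      using insert.prems by (auto simp: in_keys_iff lookup_minus lookup_single when_def split: if_splits)
    have "P ((r - ?s) + ?s)"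
      by (rule assms(4)) (use insert s assms(3) in \<open>auto split: if_splits\<close>)
    then show ?case by simp
  qed
  from this[of "Poly_Mapping.keys r"] assms(1) show ?thesis by simp
qed

context vspace
begin

text \<open>The added coefficients are zero. This lets two formal sums be compared over the union of
  their supports.\<close>

lemma pm_eval_superset:
  assumes "finite S" "Poly_Mapping.keys r \<subseteq> S" "\<And>q. q \<in> S \<Longrightarrow> \<phi> q \<in> carrier V"
  shows "pm_eval V \<phi> r = (\<Oplus>q\<in>S. Poly_Mapping.lookup r q \<odot> \<phi> q)"
  unfolding pm_eval_def
  by (rule add.finprod_mono_neutral_cong_left) (use assms in \<open>auto simp: in_keys_iff\<close>)

lemma pm_eval_closed:
  assumes "\<And>q. q \<in> K \<Longrightarrow> \<phi> q \<in> carrier V" "Poly_Mapping.keys r \<subseteq> K"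
  shows "pm_eval V \<phi> r \<in> carrier V"
  unfolding pm_eval_def using assms by (intro finsum_closed) auto

lemma pm_eval_add:
  assumes "\<And>q. q \<in> K \<Longrightarrow> \<phi> q \<in> carrier V" "Poly_Mapping.keys r \<subseteq> K" "Poly_Mapping.keys s \<subseteq> K"
  shows "pm_eval V \<phi> (r + s) = pm_eval V \<phi> r \<oplus> pm_eval V \<phi> s"
proof -
  let ?S = "Poly_Mapping.keys r \<union> Poly_Mapping.keys s"
  have "(\<Oplus>q\<in>?S. Poly_Mapping.lookup (r + s) q \<odot> \<phi> q) =
      (\<Oplus>q\<in>?S. Poly_Mapping.lookup r q \<odot> \<phi> q \<oplus> Poly_Mapping.lookup s q \<odot> \<phi> q)"
    by (rule finsum_cong') (use assms in \<open>auto simp: lookup_add scale_add_left\<close>)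
  also have "\<dots> = (\<Oplus>q\<in>?S. Poly_Mapping.lookup r q \<odot> \<phi> q) \<oplus> (\<Oplus>q\<in>?S. Poly_Mapping.lookup s q \<odot> \<phi> q)"
    by (rule finsum_addf) (use assms in auto)
  finally show ?thesis
    by (subst (1 2 3) pm_eval_superset[of ?S]) (use assms keys_add[of r s] in auto)
qed

lemma pm_eval_scale:
  assumes "\<And>q. q \<in> K \<Longrightarrow> \<phi> q \<in> carrier V" "Poly_Mapping.keys r \<subseteq> K"
  shows "pm_eval V \<phi> (pm_scale c r) = c \<odot> pm_eval V \<phi> r"
proof -
  let ?S = "Poly_Mapping.keys r"
  have "c \<odot> (\<Oplus>q\<in>?S. Poly_Mapping.lookup r q \<odot> \<phi> q) = (\<Oplus>q\<in>?S. c \<odot> (Poly_Mapping.lookup r q \<odot> \<phi> q))"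
    by (rule scale_sum) (use assms in auto)
  also have "\<dots> = (\<Oplus>q\<in>?S. Poly_Mapping.lookup (pm_scale c r) q \<odot> \<phi> q)"
    by (rule finsum_cong') (use assms in \<open>auto\<close>)
  finally show ?thesis
    by (subst (1 2) pm_eval_superset[of ?S]) (use assms keys_pm_scale[of c r] in auto)
qed

lemma pm_eval_0 [simp]: "pm_eval V \<phi> 0 = \<zero>"
  by (simp add: pm_eval_def)

lemma pm_eval_single [simp]:
  "\<phi> q \<in> carrier V \<Longrightarrow> pm_eval V \<phi> (Poly_Mapping.single q c) = c \<odot> \<phi> q"
  by (cases "c = 0") (simp_all add: pm_eval_def)

lemma pm_eval_diff:
  assumes "\<And>q. q \<in> K \<Longrightarrow> \<phi> q \<in> carrier V" "Poly_Mapping.keys r \<subseteq> K" "Poly_Mapping.keys s \<subseteq> K"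
  shows "pm_eval V \<phi> (r - s) = pm_eval V \<phi> r \<ominus> pm_eval V \<phi> s"
proof -
  have "pm_eval V \<phi> (r + pm_scale (- 1) s) = pm_eval V \<phi> r \<oplus> pm_eval V \<phi> (pm_scale (- 1) s)"
    by (rule pm_eval_add[OF assms(1,2) order_trans[OF keys_pm_scale assms(3)]])
  moreover have "pm_eval V \<phi> (pm_scale (- 1) s) = (- 1) \<odot> pm_eval V \<phi> s"
    by (rule pm_eval_scale[OF assms(1,3)])
  moreover have "pm_eval V \<phi> s \<in> carrier V" by (rule pm_eval_closed[OF assms(1,3)])
  ultimately show ?thesis
    by (simp add: a_minus_def minus_eq_scale)
qed

end

section \<open>Bilinear maps and the universal property of the tensor product\<close>

definition bilinear where
  "bilinear V W U \<beta> \<longleftrightarrow> (\<forall>y\<in>carrier W. linear_map V U (\<lambda>x. \<beta> x y)) \<and>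
     (\<forall>x\<in>carrier V. linear_map W U (\<beta> x))"

lemma bilinearI:
  "(\<And>y. y \<in> carrier W \<Longrightarrow> linear_map V U (\<lambda>x. \<beta> x y)) \<Longrightarrow>
   (\<And>x. x \<in> carrier V \<Longrightarrow> linear_map W U (\<beta> x)) \<Longrightarrow> bilinear V W U \<beta>"
  by (simp add: bilinear_def)

lemma bilinear_closed: "bilinear V W U \<beta> \<Longrightarrow> x \<in> carrier V \<Longrightarrow> y \<in> carrier W \<Longrightarrow> \<beta> x y \<in> carrier U"
  by (auto simp: bilinear_def dest: linear_mapD(1))

lemma bilinear_comp2:
  assumes "bilinear V W U \<beta>" "linear_map V' V f" "linear_map W' W h"
  shows "bilinear V' W' U (\<lambda>x y. \<beta> (f x) (h y))"
proof (rule bilinearI)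
  fix y assume "y \<in> carrier W'"
  then have "linear_map V U (\<lambda>x. \<beta> x (h y))"
    using assms by (auto simp: bilinear_def dest: linear_mapD(1))
  from linear_map_comp[OF assms(2) this] show "linear_map V' U (\<lambda>x. \<beta> (f x) (h y))" .
next
  fix x assume "x \<in> carrier V'"
  then have "linear_map W U (\<beta> (f x))"
    using assms by (auto simp: bilinear_def dest: linear_mapD(1))
  from linear_map_comp[OF assms(3) this] show "linear_map W' U (\<lambda>y. \<beta> (f x) (h y))" .
qed

abbreviation cross_keys where
  "cross_keys V W \<equiv> {r. Poly_Mapping.keys r \<subseteq> carrier V \<times> carrier W}"

locale tensor_pair = V: vspace V + W: vspace W
  for V :: "('k::field, 'v, 'm) module_scheme" and W :: "('k, 'w, 'n) module_scheme"
begin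

abbreviation "null \<equiv> tensor_null V W"
abbreviation "cls \<equiv> tensor_class V W"
abbreviation "T \<equiv> tensor_product V W"

lemma null_subspace: "pm.subspace null"
  unfolding tensor_null_def by (rule pm.subspace_span)

text \<open>The generating relations are supported on the product of the carriers, and such formal
  sums form a subspace. Hence the representatives picked by \<open>rep\<close> never leave the
  carriers.\<close>

lemma null_keys: "r \<in> null \<Longrightarrow> Poly_Mapping.keys r \<subseteq> carrier V \<times> carrier W"
proof -
  have "pm.subspace (cross_keys V W)"
    by (auto simp: pm.subspace_def dest!: subsetD[OF keys_add] subsetD[OF keys_pm_scale])
  then have "null \<subseteq> cross_keys V W"
    unfolding tensor_null_def
    by (intro pm.span_minimal) (auto dest!: subsetD[OF keys_diff] split: if_splits)
  then show "r \<in> null \<Longrightarrow> Poly_Mapping.keys r \<subseteq> carrier V \<times> carrier W" by auto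
qed

text \<open>Bilinearity kills the four kinds of generating relations, and what the linear extension
  kills is a subspace. This is the well-definedness of \<open>tensor_lift\<close>.\<close>

lemma null_eval:
  assumes "vspace U" "bilinear V W U \<beta>" "r \<in> null"
  shows "pm_eval U (\<lambda>q. \<beta> (fst q) (snd q)) r = \<zero>\<^bsub>U\<^esub>"
proof -
  interpret U: vspace U by fact
  let ?\<phi> = "\<lambda>q. \<beta> (fst q) (snd q)"
  let ?E = "pm_eval U ?\<phi>"
  have cl: "?\<phi> q \<in> carrier U" if "q \<in> carrier V \<times> carrier W" for q
    using that bilinear_closed[OF assms(2)] by auto
  note ev = U.pm_eval_add[of "carrier V \<times> carrier W" ?\<phi>, OF cl]
    U.pm_eval_scale[of "carrier V \<times> carrier W" ?\<phi>, OF cl]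
    U.pm_eval_diff[of "carrier V \<times> carrier W" ?\<phi>, OF cl]
  \<comment> \<open>The condition on the support is part of the set because the evaluation is
    additive only on formal sums supported in the carriers.\<close>
  let ?Z = "{r. Poly_Mapping.keys r \<subseteq> carrier V \<times> carrier W \<and> ?E r = \<zero>\<^bsub>U\<^esub>}"
  have sub: "pm.subspace ?Z"
    by (auto simp: pm.subspace_def ev dest!: subsetD[OF keys_add] subsetD[OF keys_pm_scale])
  have lin: "linear_map V U (\<lambda>x. \<beta> x y)" if "y \<in> carrier W" for y
    using assms(2) that by (simp add: bilinear_def)
  have lin': "linear_map W U (\<beta> x)" if "x \<in> carrier V" for x
    using assms(2) that by (simp add: bilinear_def)
  note b = linear_mapD(2,3)[OF lin] linear_mapD(2,3)[OF lin'] bilinear_closed[OF assms(2)]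
  have canc: "u \<oplus>\<^bsub>U\<^esub> v \<ominus>\<^bsub>U\<^esub> u \<ominus>\<^bsub>U\<^esub> v = \<zero>\<^bsub>U\<^esub>" if "u \<in> carrier U" "v \<in> carrier U" for u v
    using that U.a_lcomm[of v "\<ominus>\<^bsub>U\<^esub> u" "\<ominus>\<^bsub>U\<^esub> v"]
    by (simp add: a_minus_def U.a_assoc U.r_neg)
  have canc': "u \<ominus>\<^bsub>U\<^esub> u = \<zero>\<^bsub>U\<^esub>" if "u \<in> carrier U" for u
    using that by (simp add: a_minus_def U.r_neg)
  have sk: "Poly_Mapping.keys (Poly_Mapping.single q c) \<subseteq> carrier V \<times> carrier W"
    if "q \<in> carrier V \<times> carrier W" for q and c :: 'k using that by auto
  have dk: "Poly_Mapping.keys (r - s) \<subseteq> carrier V \<times> carrier W"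
    if "Poly_Mapping.keys r \<subseteq> carrier V \<times> carrier W" "Poly_Mapping.keys s \<subseteq> carrier V \<times> carrier W"
    for r s :: "('v \<times> 'w) \<Rightarrow>\<^sub>0 'k" using that keys_diff[of r s] by auto
  have "null \<subseteq> ?Z"
    unfolding tensor_null_def
    by (intro pm.span_minimal sub Un_least subsetI)
      (clarsimp simp: dk sk ev b canc canc' simp del: keys_single)+
  with assms(3) show ?thesis by auto
qed

lemma class_eq_iff: "cls r = cls s \<longleftrightarrow> r - s \<in> null"
proof
  assume "cls r = cls s"
  moreover have "r \<in> cls r"
    using pm.subspace_0[OF null_subspace] by (auto simp: tensor_class_def intro: exI[of _ 0])
  ultimately obtain t where "t \<in> null" "r = s + t" by (auto simp: tensor_class_def)
  then show "r - s \<in> null" by simp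
next
  assume rs: "r - s \<in> null"
  have "\<exists>t'\<in>null. r + t = s + t'" if "t \<in> null" for t
    using pm.subspace_add[OF null_subspace rs that] by (intro bexI[of _ "(r - s) + t"]) auto
  moreover have "\<exists>t'\<in>null. s + t = r + t'" if "t \<in> null" for t
    using pm.subspace_diff[OF null_subspace that rs] by (intro bexI[of _ "t - (r - s)"]) auto
  ultimately show "cls r = cls s" unfolding tensor_class_def by blast
qed

lemma rep_class: "rep (cls r) - r \<in> null"
proof -
  have "r \<in> cls r"
    using pm.subspace_0[OF null_subspace] by (auto simp: tensor_class_def intro: exI[of _ 0])
  then have "rep (cls r) \<in> cls r" unfolding rep_def by (rule someI)
  then show ?thesis by (auto simp: tensor_class_def)
qed

lemma rep_class_keys:
  assumes "r \<in> cross_keys V W"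
  shows "rep (cls r) \<in> cross_keys V W"
proof -
  have "Poly_Mapping.keys (r + (rep (cls r) - r)) \<subseteq> carrier V \<times> carrier W"
    using keys_add[of r "rep (cls r) - r"] null_keys[OF rep_class[of r]] assms by auto
  then show ?thesis by simp
qed

lemma carrier_T: "carrier T = cls ` cross_keys V W"
  by (simp add: tensor_product_def)

lemma class_closed: "Poly_Mapping.keys r \<subseteq> carrier V \<times> carrier W \<Longrightarrow> cls r \<in> carrier T"
  by (auto simp: carrier_T)

lemma class_add: "cls r \<oplus>\<^bsub>T\<^esub> cls s = cls (r + s)"
proof -
  have "(rep (cls r) - r) + (rep (cls s) - s) \<in> null"
    by (rule pm.subspace_add[OF null_subspace rep_class rep_class])
  then show ?thesis by (simp add: tensor_product_def class_eq_iff algebra_simps)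
qed

lemma class_scale: "c \<odot>\<^bsub>T\<^esub> cls r = cls (pm_scale c r)"
  using pm.subspace_scale[OF null_subspace rep_class[of r], of c]
  by (simp add: tensor_product_def class_eq_iff pm.scale_right_diff_distrib)

lemma class_zero: "\<zero>\<^bsub>T\<^esub> = cls 0"
  by (simp add: tensor_product_def)

lemma vspace_T: "vspace T"
proof -
  have kp: "Poly_Mapping.keys (r + s) \<subseteq> carrier V \<times> carrier W"
    if "Poly_Mapping.keys r \<subseteq> carrier V \<times> carrier W" "Poly_Mapping.keys s \<subseteq> carrier V \<times> carrier W"
    for r s :: "('v \<times> 'w) \<Rightarrow>\<^sub>0 'k" using that keys_add[of r s] by auto
  have ks: "Poly_Mapping.keys (pm_scale c r) \<subseteq> carrier V \<times> carrier W"
    if "Poly_Mapping.keys r \<subseteq> carrier V \<times> carrier W" for r and c :: 'k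
    using that keys_pm_scale[of c r] by auto
  have ag: "abelian_group T"
  proof (rule abelian_groupI)
    fix x assume "x \<in> carrier T"
    then obtain r where r: "r \<in> cross_keys V W" "x = cls r" by (auto simp: carrier_T)
    have "pm_scale (- 1) r + r = 0" by simp
    with r show "\<exists>y\<in>carrier T. y \<oplus>\<^bsub>T\<^esub> x = \<zero>\<^bsub>T\<^esub>"
      by (intro bexI[of _ "cls (pm_scale (- 1) r)"])
        (simp_all add: class_add class_zero class_closed ks del: pm.scale_minus_left)
  qed (auto simp: carrier_T class_add class_zero kp algebra_simps)
  show ?thesis unfolding vspace_def
    by (rule moduleI[OF cring_ground ag])
      (auto simp: carrier_T class_add class_scale ks pm.scale_left_distrib pm.scale_right_distrib)
qed

sublocale T: vspace "tensor_product V W" by (rule vspace_T)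

lemma tensor_closed [simp]: "x \<in> carrier V \<Longrightarrow> y \<in> carrier W \<Longrightarrow> tensor V W x y \<in> carrier T"
  unfolding tensor_def by (rule class_closed) auto

lemma bilinear_tensor: "bilinear V W T (tensor V W)"
proof -
  have 1: "tensor V W (x \<oplus>\<^bsub>V\<^esub> x') y = tensor V W x y \<oplus>\<^bsub>T\<^esub> tensor V W x' y"
    if "x \<in> carrier V" "x' \<in> carrier V" "y \<in> carrier W" for x x' y
    unfolding tensor_def class_add class_eq_iff diff_diff_eq[symmetric]
    unfolding tensor_null_def by (rule pm.span_base) (use that in blast)
  have 2: "tensor V W x (y \<oplus>\<^bsub>W\<^esub> y') = tensor V W x y \<oplus>\<^bsub>T\<^esub> tensor V W x y'"
    if "x \<in> carrier V" "y \<in> carrier W" "y' \<in> carrier W" for x y y'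
    unfolding tensor_def class_add class_eq_iff diff_diff_eq[symmetric]
    unfolding tensor_null_def by (rule pm.span_base) (use that in blast)
  have 3: "tensor V W (c \<odot>\<^bsub>V\<^esub> x) y = c \<odot>\<^bsub>T\<^esub> tensor V W x y"
    if "x \<in> carrier V" "y \<in> carrier W" for c x y
    unfolding tensor_def class_scale class_eq_iff pm_scale_single mult_1_right
    unfolding tensor_null_def by (rule pm.span_base) (use that in blast)
  have 4: "tensor V W x (c \<odot>\<^bsub>W\<^esub> y) = c \<odot>\<^bsub>T\<^esub> tensor V W x y"
    if "x \<in> carrier V" "y \<in> carrier W" for c x y
    unfolding tensor_def class_scale class_eq_iff pm_scale_single mult_1_right
    unfolding tensor_null_def by (rule pm.span_base) (use that in blast)
  show ?thesis by (intro bilinearI linear_mapI) (simp_all add: 1 2 3 4)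
qed

lemma linear_tensor_left: "y \<in> carrier W \<Longrightarrow> linear_map V T (\<lambda>x. tensor V W x y)"
  and linear_tensor_right: "x \<in> carrier V \<Longrightarrow> linear_map W T (tensor V W x)"
  using bilinear_tensor by (simp_all add: bilinear_def)

lemmas tensor_simps = linear_mapD(2,3)[OF linear_tensor_left] linear_mapD(2,3)[OF linear_tensor_right]

lemma tensor_zero_left [simp]: "y \<in> carrier W \<Longrightarrow> tensor V W \<zero>\<^bsub>V\<^esub> y = \<zero>\<^bsub>T\<^esub>"
  by (rule linear_map_zero[OF V.vspace_axioms vspace_T linear_tensor_left])

lemma tensor_zero_right [simp]: "x \<in> carrier V \<Longrightarrow> tensor V W x \<zero>\<^bsub>W\<^esub> = \<zero>\<^bsub>T\<^esub>"
  by (rule linear_map_zero[OF W.vspace_axioms vspace_T linear_tensor_right])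

text \<open>A scalar can be absorbed into the left factor and zero is itself a pure tensor, so every
  element is a sum of pure tensors and two cases suffice.\<close>

lemma tensor_induct [consumes 1, case_names tensor add]:
  assumes "t \<in> carrier T" "\<And>x y. x \<in> carrier V \<Longrightarrow> y \<in> carrier W \<Longrightarrow> P (tensor V W x y)"
    "\<And>s t. s \<in> carrier T \<Longrightarrow> t \<in> carrier T \<Longrightarrow> P s \<Longrightarrow> P t \<Longrightarrow> P (s \<oplus>\<^bsub>T\<^esub> t)"
  shows "P t"
proof -
  obtain r where r: "Poly_Mapping.keys r \<subseteq> carrier V \<times> carrier W" "t = cls r"
    using assms(1) by (auto simp: carrier_T)
  have "P (cls r)" using r(1)
  proof (induction r rule: pm_induct)
    case zero
    show ?case using assms(2)[of "\<zero>\<^bsub>V\<^esub>" "\<zero>\<^bsub>W\<^esub>"] by (simp add: class_zero)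
  next
    case (single q c)
    then have q: "fst q \<in> carrier V" "snd q \<in> carrier W" by auto
    then have "tensor V W (c \<odot>\<^bsub>V\<^esub> fst q) (snd q) = cls (Poly_Mapping.single q c)"
      by (simp add: tensor_simps) (simp add: tensor_def class_scale)
    with q assms(2)[of "c \<odot>\<^bsub>V\<^esub> fst q" "snd q"] show ?case by simp
  next
    case (add r s)
    then show ?case using assms(3)[of "cls r" "cls s"] by (simp add: class_closed class_add)
  qed
  with r show ?thesis by simp
qed

lemma linear_map_tensor_eqI:
  assumes "linear_map T U f" "linear_map T U h" "t \<in> carrier T"
    "\<And>x y. x \<in> carrier V \<Longrightarrow> y \<in> carrier W \<Longrightarrow> f (tensor V W x y) = h (tensor V W x y)"
  shows "f t = h t"
  using assms(3)
  by (induction t rule: tensor_induct) (simp_all add: assms(4) linear_mapD[OF assms(1)] linear_mapD[OF assms(2)])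

context
  fixes U :: "('k, 'u, 'o) module_scheme" and \<beta>
  assumes U: "vspace U" and b: "bilinear V W U \<beta>"
begin

interpretation U: vspace U by (rule U)

text \<open>The chosen representative differs from \<open>r\<close> by an element of
  \<open>null\<close>, on which the evaluation vanishes by \<open>null_eval\<close>.\<close>

lemma lift_class:
  assumes "r \<in> cross_keys V W"
  shows "tensor_lift U \<beta> (cls r) = pm_eval U (\<lambda>q. \<beta> (fst q) (snd q)) r"
proof -
  let ?\<phi> = "\<lambda>q. \<beta> (fst q) (snd q)"
  have cl: "?\<phi> q \<in> carrier U" if "q \<in> carrier V \<times> carrier W" for q
    using that bilinear_closed[OF b] by auto
  have "pm_eval U ?\<phi> ((rep (cls r) - r) + r) = pm_eval U ?\<phi> (rep (cls r) - r) \<oplus>\<^bsub>U\<^esub> pm_eval U ?\<phi> r"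
    by (rule U.pm_eval_add[of "carrier V \<times> carrier W"]) (use cl null_keys[OF rep_class] assms in auto)
  also have "\<dots> = pm_eval U ?\<phi> r"
    using U.pm_eval_closed[of "carrier V \<times> carrier W" ?\<phi>, OF cl] assms
    by (simp add: null_eval[OF U b rep_class])
  finally show ?thesis by (simp add: tensor_lift_def pm_eval_def)
qed

lemma linear_lift: "linear_map T U (tensor_lift U \<beta>)"
proof -
  let ?K = "carrier V \<times> carrier W" and ?\<phi> = "\<lambda>q. \<beta> (fst q) (snd q)"
  have cl: "?\<phi> q \<in> carrier U" if "q \<in> ?K" for q
    using that bilinear_closed[OF b] by auto
  note ev = U.pm_eval_add[of ?K ?\<phi>, OF cl] U.pm_eval_scale[of ?K ?\<phi>, OF cl] U.pm_eval_closed[of ?K ?\<phi>, OF cl]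
  have "Poly_Mapping.keys (r + s) \<subseteq> ?K"
    if "Poly_Mapping.keys r \<subseteq> ?K" "Poly_Mapping.keys s \<subseteq> ?K"
    for r s :: "('v \<times> 'w) \<Rightarrow>\<^sub>0 'k" using that keys_add[of r s] by auto
  moreover have "Poly_Mapping.keys (pm_scale c r) \<subseteq> ?K"
    if "Poly_Mapping.keys r \<subseteq> ?K" for r and c :: 'k
    using that keys_pm_scale[of c r] by auto
  ultimately show ?thesis
    by (intro linear_mapI) (auto simp: carrier_T class_add class_scale lift_class ev)
qed

lemma lift_tensor [simp]:
  assumes "x \<in> carrier V" "y \<in> carrier W"
  shows "tensor_lift U \<beta> (tensor V W x y) = \<beta> x y"
  using assms bilinear_closed[OF b assms] by (simp add: tensor_def lift_class)

end

lemma lift_cong: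
  assumes "vspace U" "bilinear V W U \<beta>" "bilinear V W U \<gamma>" "t \<in> carrier T"
    "\<And>x y. x \<in> carrier V \<Longrightarrow> y \<in> carrier W \<Longrightarrow> \<beta> x y = \<gamma> x y"
  shows "tensor_lift U \<beta> t = tensor_lift U \<gamma> t"
  by (rule linear_map_tensor_eqI[OF linear_lift[OF assms(1,2)] linear_lift[OF assms(1,3)] assms(4)])
    (simp add: lift_tensor assms)

text \<open>Slicing \<open>t\<close> with the functional \<open>\<kappa> j\<close> in the right
  factor yields the coefficient, an element of \<open>V\<close>, that stands at \<open>e j\<close>.
  For a coproduct this becomes the expansion along basis monomials in the right factor.\<close>

lemma tensor_expand_right:
  assumes "finite J" "\<And>j. j \<in> J \<Longrightarrow> e j \<in> carrier W" "\<And>j. j \<in> J \<Longrightarrow> linear_map W ground (\<kappa> j)"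
    "\<And>y. y \<in> carrier W \<Longrightarrow> y = (\<Oplus>\<^bsub>W\<^esub>j\<in>J. \<kappa> j y \<odot>\<^bsub>W\<^esub> e j)" "t \<in> carrier T"
  shows "t = (\<Oplus>\<^bsub>T\<^esub>j\<in>J. tensor V W (tensor_lift V (\<lambda>x y. \<kappa> j y \<odot>\<^bsub>V\<^esub> x) t) (e j))"
proof -
  have b: "bilinear V W V (\<lambda>x y. \<kappa> j y \<odot>\<^bsub>V\<^esub> x)" if "j \<in> J" for j
    by (intro bilinearI linear_mapI)
      (simp_all add: V.scale_add_right V.scale_add_left linear_mapD[OF assms(3)[OF that]] mult.commute)
  note L = linear_lift[OF V.vspace_axioms b]
  from assms(5) show ?thesis
  proof (induction t rule: tensor_induct)
    case (tensor x y)
    have "tensor V W x y = tensor V W x (\<Oplus>\<^bsub>W\<^esub>j\<in>J. \<kappa> j y \<odot>\<^bsub>W\<^esub> e j)"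
      using assms(4)[OF tensor(2)] by simp
    also have "\<dots> = (\<Oplus>\<^bsub>T\<^esub>j\<in>J. tensor V W x (\<kappa> j y \<odot>\<^bsub>W\<^esub> e j))"
      by (rule linear_map_sum[OF W.vspace_axioms vspace_T linear_tensor_right]) (use tensor assms in auto)
    also have "\<dots> = (\<Oplus>\<^bsub>T\<^esub>j\<in>J. tensor V W (tensor_lift V (\<lambda>x y. \<kappa> j y \<odot>\<^bsub>V\<^esub> x) (tensor V W x y)) (e j))"
      by (rule T.finsum_cong')
        (use tensor assms b in \<open>simp_all add: lift_tensor[OF V.vspace_axioms] tensor_simps\<close>)
    finally show ?case .
  next
    case (add s t)
    let ?h = "\<lambda>t j. tensor V W (tensor_lift V (\<lambda>x y. \<kappa> j y \<odot>\<^bsub>V\<^esub> x) t) (e j)"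
    have "(\<Oplus>\<^bsub>T\<^esub>j\<in>J. ?h (s \<oplus>\<^bsub>T\<^esub> t) j) = (\<Oplus>\<^bsub>T\<^esub>j\<in>J. ?h s j \<oplus>\<^bsub>T\<^esub> ?h t j)"
      by (rule T.finsum_cong')
        (use add assms linear_mapD(1)[OF L] in \<open>simp_all add: linear_mapD[OF L] tensor_simps\<close>)
    also have "\<dots> = (\<Oplus>\<^bsub>T\<^esub>j\<in>J. ?h s j) \<oplus>\<^bsub>T\<^esub> (\<Oplus>\<^bsub>T\<^esub>j\<in>J. ?h t j)"
      by (rule T.finsum_addf) (use add assms linear_mapD(1)[OF L] in simp_all)
    finally show ?case using add by simp
  qed
qed

end

section \<open>Tensor products of algebras\<close>

locale tensor_alg = A: assoc_alg A + B: assoc_alg B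
  for A :: "('k::field, 'v, 'm) module_scheme" and B :: "('k, 'w, 'n) module_scheme"
begin

sublocale tensor_pair A B ..

lemma linear_mult_left: "x \<in> carrier A \<Longrightarrow> linear_map A A (\<lambda>y. x \<otimes>\<^bsub>A\<^esub> y)"
  "y \<in> carrier B \<Longrightarrow> linear_map B B (\<lambda>x. y \<otimes>\<^bsub>B\<^esub> x)"
  by (intro linear_mapI; simp add: A.r_distr A.scale_mult_right B.r_distr B.scale_mult_right)+

text \<open>Left multiplication by a pure tensor, expressed as a lift and hence independent of
  representatives.\<close>

abbreviation lmult where
  "lmult x y \<equiv> tensor_lift T (\<lambda>x' y'. tensor A B (x \<otimes>\<^bsub>A\<^esub> x') (y \<otimes>\<^bsub>B\<^esub> y'))"

lemma lmult_bilinear: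
  "x \<in> carrier A \<Longrightarrow> y \<in> carrier B \<Longrightarrow>
    bilinear A B T (\<lambda>x' y'. tensor A B (x \<otimes>\<^bsub>A\<^esub> x') (y \<otimes>\<^bsub>B\<^esub> y'))"
  by (rule bilinear_comp2[OF bilinear_tensor]) (auto intro: linear_mult_left)

lemmas lmult_tensor = lift_tensor[OF vspace_T lmult_bilinear]
lemmas lmult_linear = linear_lift[OF vspace_T lmult_bilinear]

lemma lmult_bilinear2: "s \<in> carrier T \<Longrightarrow> bilinear A B T (\<lambda>x y. lmult x y s)"
proof (intro bilinearI linear_mapI)
  fix x x' y assume [simp]: "s \<in> carrier T" "x \<in> carrier A" "x' \<in> carrier A" "y \<in> carrier B"
  show "lmult x y s \<in> carrier T" using linear_mapD(1)[OF lmult_linear] by simp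
  show "lmult x y s \<in> carrier T" by fact
  have "s \<in> carrier T" by simp
  then show "lmult (x \<oplus>\<^bsub>A\<^esub> x') y s = lmult x y s \<oplus>\<^bsub>T\<^esub> lmult x' y s"
    by (induction s rule: tensor_induct)
      (simp_all add: lmult_tensor linear_mapD[OF lmult_linear] tensor_simps A.l_distr T.a_ac)
next
  fix c x y assume [simp]: "s \<in> carrier T" "x \<in> carrier A" "y \<in> carrier B"
  have "s \<in> carrier T" by simp
  then show "lmult (c \<odot>\<^bsub>A\<^esub> x) y s = c \<odot>\<^bsub>T\<^esub> lmult x y s"
    by (induction s rule: tensor_induct)
      (simp_all add: lmult_tensor linear_mapD[OF lmult_linear] tensor_simps A.scale_mult_left T.scale_add_right)
  have "s \<in> carrier T" by simp
  then show "lmult x (c \<odot>\<^bsub>B\<^esub> y) s = c \<odot>\<^bsub>T\<^esub> lmult x y s"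
    by (induction s rule: tensor_induct)
      (simp_all add: lmult_tensor linear_mapD[OF lmult_linear] tensor_simps B.scale_mult_left T.scale_add_right)
next
  fix x y y' assume [simp]: "s \<in> carrier T" "x \<in> carrier A" "y \<in> carrier B" "y' \<in> carrier B"
  have "s \<in> carrier T" by simp
  then show "lmult x (y \<oplus>\<^bsub>B\<^esub> y') s = lmult x y s \<oplus>\<^bsub>T\<^esub> lmult x y' s"
    by (induction s rule: tensor_induct)
      (simp_all add: lmult_tensor linear_mapD[OF lmult_linear] tensor_simps B.l_distr T.a_ac)
qed

lemma class_sum:
  assumes "finite I" "\<And>i. i \<in> I \<Longrightarrow> f i \<in> cross_keys A B"
  shows "cls (sum f I) = (\<Oplus>\<^bsub>T\<^esub>i\<in>I. cls (f i))"
  using assms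
proof (induction I)
  case (insert i I)
  have "(\<lambda>i. cls (f i)) \<in> I \<rightarrow> carrier T" using insert.prems by (auto intro: class_closed)
  with insert show ?case by (simp add: class_add[symmetric] class_closed)
qed (simp add: class_zero)

lemma class_single:
  "x \<in> carrier A \<Longrightarrow> y \<in> carrier B \<Longrightarrow>
    cls (Poly_Mapping.single (x, y) c) = c \<odot>\<^bsub>T\<^esub> tensor A B x y"
  by (simp add: tensor_def class_scale)

text \<open>The product of \<open>tensor_product\<close> is a double sum over chosen
  representatives. Moving the class through both sums turns it into two nested lifts, from which
  bilinearity of the product follows.\<close>

lemma mult_eq_lift:
  assumes "s \<in> carrier T" "t \<in> carrier T"
  shows "s \<otimes>\<^bsub>T\<^esub> t = tensor_lift T (\<lambda>x y. lmult x y t) s"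
proof -
  let ?K = "carrier A \<times> carrier B"
  have ks: "Poly_Mapping.keys (rep s) \<subseteq> ?K" and kt: "Poly_Mapping.keys (rep t) \<subseteq> ?K"
    using assms rep_class_keys by (auto simp: carrier_T)
  let ?w = "\<lambda>q q'. Poly_Mapping.single (fst q \<otimes>\<^bsub>A\<^esub> fst q', snd q \<otimes>\<^bsub>B\<^esub> snd q')
      (Poly_Mapping.lookup (rep s) q * Poly_Mapping.lookup (rep t) q')"
  have w: "?w q q' \<in> cross_keys A B" if "q \<in> ?K" "q' \<in> ?K" for q q'
    using that by auto
  have w2: "(\<Sum>q'\<in>Poly_Mapping.keys (rep t). ?w q q') \<in> cross_keys A B" if "q \<in> ?K" for q
  proof -
    have "Poly_Mapping.keys (?w q q') \<subseteq> ?K" if "q' \<in> Poly_Mapping.keys (rep t)" for q'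
      using w[OF \<open>q \<in> ?K\<close>, of q'] that kt by blast
    then show ?thesis
      using order_trans[OF keys_sum[of "?w q" "Poly_Mapping.keys (rep t)"] UN_least] by simp
  qed
  have "s \<otimes>\<^bsub>T\<^esub> t = cls (\<Sum>q\<in>Poly_Mapping.keys (rep s). \<Sum>q'\<in>Poly_Mapping.keys (rep t). ?w q q')"
    by (simp add: tensor_product_def case_prod_unfold)
  also have "\<dots> = (\<Oplus>\<^bsub>T\<^esub>q\<in>Poly_Mapping.keys (rep s). cls (\<Sum>q'\<in>Poly_Mapping.keys (rep t). ?w q q'))"
    by (rule class_sum) (use w2 ks in auto)
  also have "\<dots> = (\<Oplus>\<^bsub>T\<^esub>q\<in>Poly_Mapping.keys (rep s). Poly_Mapping.lookup (rep s) q \<odot>\<^bsub>T\<^esub> lmult (fst q) (snd q) t)"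
  proof (rule T.finsum_cong')
    fix q assume "q \<in> Poly_Mapping.keys (rep s)"
    then have q: "fst q \<in> carrier A" "snd q \<in> carrier B" "q \<in> ?K" using ks by auto
    have "cls (\<Sum>q'\<in>Poly_Mapping.keys (rep t). ?w q q') = (\<Oplus>\<^bsub>T\<^esub>q'\<in>Poly_Mapping.keys (rep t). cls (?w q q'))"
      by (rule class_sum) (use q kt w in auto)
    also have "\<dots> = (\<Oplus>\<^bsub>T\<^esub>q'\<in>Poly_Mapping.keys (rep t). Poly_Mapping.lookup (rep s) q \<odot>\<^bsub>T\<^esub>
        (Poly_Mapping.lookup (rep t) q' \<odot>\<^bsub>T\<^esub> tensor A B (fst q \<otimes>\<^bsub>A\<^esub> fst q') (snd q \<otimes>\<^bsub>B\<^esub> snd q')))"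
      by (rule T.finsum_cong') (use q kt in \<open>auto simp: class_single\<close>)
    also have "\<dots> = Poly_Mapping.lookup (rep s) q \<odot>\<^bsub>T\<^esub> lmult (fst q) (snd q) t"
      unfolding tensor_lift_def by (rule T.scale_sum[symmetric]) (use q kt in auto)
    finally show "cls (\<Sum>q'\<in>Poly_Mapping.keys (rep t). ?w q q') = \<dots>" .
  qed (use ks linear_mapD(1)[OF lmult_linear] assms in auto)
  finally show ?thesis by (simp add: tensor_lift_def)
qed

lemma mult_tensor_left:
  "x \<in> carrier A \<Longrightarrow> y \<in> carrier B \<Longrightarrow> t \<in> carrier T \<Longrightarrow> tensor A B x y \<otimes>\<^bsub>T\<^esub> t = lmult x y t"
  by (simp add: mult_eq_lift lift_tensor[OF vspace_T lmult_bilinear2])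

lemma tensor_mult_tensor [simp]:
  "x \<in> carrier A \<Longrightarrow> y \<in> carrier B \<Longrightarrow> x' \<in> carrier A \<Longrightarrow> y' \<in> carrier B \<Longrightarrow>
    tensor A B x y \<otimes>\<^bsub>T\<^esub> tensor A B x' y' = tensor A B (x \<otimes>\<^bsub>A\<^esub> x') (y \<otimes>\<^bsub>B\<^esub> y')"
  by (simp add: mult_tensor_left lmult_tensor)

lemma tensor_mult_linear_left: "t \<in> carrier T \<Longrightarrow> linear_map T T (\<lambda>s. s \<otimes>\<^bsub>T\<^esub> t)"
  using linear_mapD[OF linear_lift[OF vspace_T lmult_bilinear2]]
  by (intro linear_mapI) (simp_all add: mult_eq_lift)

lemmas tensor_mult_left = linear_mapD[OF tensor_mult_linear_left]

lemma tensor_mult_linear_right: "s \<in> carrier T \<Longrightarrow> linear_map T T (\<lambda>t. s \<otimes>\<^bsub>T\<^esub> t)"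
proof (intro linear_mapI)
  fix t t' assume t: "t \<in> carrier T" "t' \<in> carrier T"
  assume s: "s \<in> carrier T"
  then show "s \<otimes>\<^bsub>T\<^esub> (t \<oplus>\<^bsub>T\<^esub> t') = s \<otimes>\<^bsub>T\<^esub> t \<oplus>\<^bsub>T\<^esub> s \<otimes>\<^bsub>T\<^esub> t'"
    by (induction s rule: tensor_induct)
      (use t in \<open>simp_all add: mult_tensor_left linear_mapD[OF lmult_linear] tensor_mult_left T.a_ac\<close>)
  show "s \<otimes>\<^bsub>T\<^esub> t \<in> carrier T" using s t tensor_mult_left(1) by simp
next
  fix c t assume t: "t \<in> carrier T"
  assume "s \<in> carrier T"
  then show "s \<otimes>\<^bsub>T\<^esub> (c \<odot>\<^bsub>T\<^esub> t) = c \<odot>\<^bsub>T\<^esub> (s \<otimes>\<^bsub>T\<^esub> t)"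
    by (induction s rule: tensor_induct)
      (use t in \<open>simp_all add: mult_tensor_left linear_mapD[OF lmult_linear] tensor_mult_left T.scale_add_right\<close>)
qed

lemmas tensor_mult_right = linear_mapD(2,3)[OF tensor_mult_linear_right]

lemma one_T: "\<one>\<^bsub>T\<^esub> = tensor A B \<one>\<^bsub>A\<^esub> \<one>\<^bsub>B\<^esub>"
  by (simp add: tensor_product_def)

text \<open>Associativity is trilinear, so pure tensors decide it; \<open>a1\<close>,
  \<open>a2\<close> and \<open>a3\<close> release one argument after the other from being
  pure.\<close>

lemma assoc_alg_T: "assoc_alg T"
proof -
  note lin = tensor_mult_left tensor_mult_right
  have a1: "tensor A B x y \<otimes>\<^bsub>T\<^esub> tensor A B x' y' \<otimes>\<^bsub>T\<^esub> u = tensor A B x y \<otimes>\<^bsub>T\<^esub> (tensor A B x' y' \<otimes>\<^bsub>T\<^esub> u)"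
    if xy: "x \<in> carrier A" "y \<in> carrier B" "x' \<in> carrier A" "y' \<in> carrier B" and u: "u \<in> carrier T"
    for x y x' y' u
    using u
  proof (induction u rule: tensor_induct)
    case (tensor p q)
    with xy show ?case by (simp add: A.m_assoc B.m_assoc)
  next
    case (add u v)
    with xy show ?case by (simp add: lin del: tensor_mult_tensor)
  qed
  have a2: "tensor A B x y \<otimes>\<^bsub>T\<^esub> t \<otimes>\<^bsub>T\<^esub> u = tensor A B x y \<otimes>\<^bsub>T\<^esub> (t \<otimes>\<^bsub>T\<^esub> u)"
    if xy: "x \<in> carrier A" "y \<in> carrier B" and u: "u \<in> carrier T" and t: "t \<in> carrier T" for x y t u
    using t by (induction t rule: tensor_induct) (use xy u a1 in \<open>simp_all add: lin del: tensor_mult_tensor\<close>)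
  have a3: "s \<otimes>\<^bsub>T\<^esub> t \<otimes>\<^bsub>T\<^esub> u = s \<otimes>\<^bsub>T\<^esub> (t \<otimes>\<^bsub>T\<^esub> u)"
    if tu: "t \<in> carrier T" "u \<in> carrier T" and s: "s \<in> carrier T" for s t u
    using s by (induction s rule: tensor_induct) (use tu a2 in \<open>simp_all add: lin\<close>)
  have o: "\<one>\<^bsub>T\<^esub> \<otimes>\<^bsub>T\<^esub> s = s" "s \<otimes>\<^bsub>T\<^esub> \<one>\<^bsub>T\<^esub> = s" if "s \<in> carrier T" for s
    unfolding one_T using that by (induction s rule: tensor_induct) (simp_all add: lin)
  have "\<one>\<^bsub>T\<^esub> \<in> carrier T" by (simp add: one_T)
  then have "ring T"
    by (intro ringI[OF T.abelian_group_axioms] monoidI) (simp_all add: lin a3 o)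
  then show ?thesis
    unfolding assoc_alg_def assoc_alg_axioms_def using vspace_T by (simp add: lin)
qed

lemma tensor_power:
  assumes "x \<in> carrier A" "y \<in> carrier B"
  shows "tensor A B x y [^]\<^bsub>T\<^esub> (m::nat) = tensor A B (x [^]\<^bsub>A\<^esub> m) (y [^]\<^bsub>B\<^esub> m)"
proof -
  interpret TA: assoc_alg T by (rule assoc_alg_T)
  show ?thesis by (induction m) (simp_all add: assms one_T)
qed

lemma hom_left: "algebra_hom A T (\<lambda>x. tensor A B x \<one>\<^bsub>B\<^esub>)"
  by (rule algebra_homI) (simp_all add: tensor_simps one_T)

lemma hom_right: "algebra_hom B T (\<lambda>y. tensor A B \<one>\<^bsub>A\<^esub> y)"
  by (rule algebra_homI) (simp_all add: tensor_simps one_T)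

text \<open>The universal property among algebras: homomorphisms with commuting images combine to
  one on the tensor product, since \<open>h y\<close> may pass \<open>f x'\<close> in a product of
  pure tensors. Coassociativity, the counit laws and the comparison with the associated graded
  algebra obtain their homomorphisms in this way.\<close>

lemma lift_hom:
  assumes C: "assoc_alg C" and f: "algebra_hom A C f" and h: "algebra_hom B C h"
    and comm: "\<And>x y. x \<in> carrier A \<Longrightarrow> y \<in> carrier B \<Longrightarrow> h y \<otimes>\<^bsub>C\<^esub> f x = f x \<otimes>\<^bsub>C\<^esub> h y"
  shows "bilinear A B C (\<lambda>x y. f x \<otimes>\<^bsub>C\<^esub> h y)" (is ?b)
    and "algebra_hom T C (tensor_lift C (\<lambda>x y. f x \<otimes>\<^bsub>C\<^esub> h y))" (is ?h)
proof -
  interpret C: assoc_alg C by (rule C)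
  note fh = algebra_homD[OF f] algebra_homD[OF h]
  show b: ?b
    by (intro bilinearI linear_mapI)
      (simp_all add: fh C.l_distr C.r_distr C.scale_mult_left C.scale_mult_right)
  let ?L = "tensor_lift C (\<lambda>x y. f x \<otimes>\<^bsub>C\<^esub> h y)"
  note L = linear_mapD[OF linear_lift[OF C.vspace_axioms b]] and Lt = lift_tensor[OF C.vspace_axioms b]
  have 1: "?L (tensor A B x y \<otimes>\<^bsub>T\<^esub> t) = ?L (tensor A B x y) \<otimes>\<^bsub>C\<^esub> ?L t"
    if x: "x \<in> carrier A" and y: "y \<in> carrier B" and t: "t \<in> carrier T" for x y t
    using t
  proof (induction t rule: tensor_induct)
    case (tensor x' y')
    have "f x \<otimes>\<^bsub>C\<^esub> f x' \<otimes>\<^bsub>C\<^esub> (h y \<otimes>\<^bsub>C\<^esub> h y') = f x \<otimes>\<^bsub>C\<^esub> (f x' \<otimes>\<^bsub>C\<^esub> h y) \<otimes>\<^bsub>C\<^esub> h y'"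
      using tensor x y by (simp add: fh C.m_assoc)
    also have "f x' \<otimes>\<^bsub>C\<^esub> h y = h y \<otimes>\<^bsub>C\<^esub> f x'" using comm tensor y by simp
    finally show ?case using tensor x y by (simp add: Lt fh C.m_assoc)
  next
    case (add s t)
    with x y show ?case by (simp add: L C.r_distr tensor_mult_right tensor_mult_left(1))
  qed
  have 2: "?L (s \<otimes>\<^bsub>T\<^esub> t) = ?L s \<otimes>\<^bsub>C\<^esub> ?L t" if t: "t \<in> carrier T" and s: "s \<in> carrier T" for s t
    using s by (induction s rule: tensor_induct) (use t 1 in \<open>simp_all add: L C.l_distr tensor_mult_left\<close>)
  show ?h by (rule algebra_homI) (simp_all add: L 2 one_T Lt fh)
qed

end

lemma tensor_algI: "assoc_alg A \<Longrightarrow> assoc_alg B \<Longrightarrow> tensor_alg A B"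
  by (simp add: tensor_alg_def)

section \<open>Free algebras and presentations\<close>

fun word_prod :: "('v, 'm) ring_scheme \<Rightarrow> ('x \<Rightarrow> 'v) \<Rightarrow> 'x fmon \<Rightarrow> 'v" where
  "word_prod A e (Word ws) = foldr (\<lambda>x y. e x \<otimes>\<^bsub>A\<^esub> y) ws \<one>\<^bsub>A\<^esub>"

abbreviation free_eval :: "('k::field, 'v, 'm) module_scheme \<Rightarrow> ('x \<Rightarrow> 'v) \<Rightarrow> ('k, 'x) free \<Rightarrow> 'v" where
  "free_eval A e \<equiv> pm_eval A (word_prod A e)"

lemma free_simps [simp]:
  "carrier free_algebra = UNIV" "monoid.mult free_algebra = (*)" "one free_algebra = 1"
  "zero free_algebra = 0" "add free_algebra = (+)" "smult free_algebra = pm_scale"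
  by (simp_all add: free_algebra_def)

lemma pm_scale_eq_mult: "pm_scale c f = Poly_Mapping.single 0 c * f"
  for f :: "'a::monoid_add \<Rightarrow>\<^sub>0 'k::field"
  unfolding pm_scale_def by (rule mult_map_scale_conv_mult)

lemma pm_scale_mult_left: "pm_scale c f * h = pm_scale c (f * h)"
  for f :: "'a::monoid_add \<Rightarrow>\<^sub>0 'k::field"
  by (simp add: pm_scale_eq_mult mult.assoc)

lemma pm_scale_mult_right: "f * pm_scale c h = pm_scale c (f * h)"
  for f :: "'a::monoid_add \<Rightarrow>\<^sub>0 'k::field"
proof -
  have "Poly_Mapping.keys f \<subseteq> UNIV" by simp
  then have "f * Poly_Mapping.single 0 c = Poly_Mapping.single 0 c * f"
    by (induction f rule: pm_induct) (simp_all add: mult_single mult.commute distrib_left distrib_right)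
  then show ?thesis by (simp add: pm_scale_eq_mult mult.assoc[symmetric])
qed

lemma assoc_alg_free: "assoc_alg (free_algebra :: ('k::field, ('k, 'x) free) module)"
proof -
  have ag: "abelian_group (free_algebra :: ('k::field, ('k, 'x) free) module)"
    by (rule abelian_groupI) (auto simp: algebra_simps intro: exI[of _ "- x" for x])
  have "ring (free_algebra :: ('k::field, ('k, 'x) free) module)"
    by (rule ringI[OF ag]) ((rule monoidI)?; simp add: algebra_simps)+
  moreover have "vspace (free_algebra :: ('k::field, ('k, 'x) free) module)" unfolding vspace_def
    by (rule moduleI[OF cring_ground ag]) (auto simp: pm.scale_left_distrib pm.scale_right_distrib)
  ultimately show ?thesis
    by (simp add: assoc_alg_def assoc_alg_axioms_def pm_scale_mult_left pm_scale_mult_right)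
qed

interpretation free: assoc_alg "free_algebra :: ('k::field, ('k, 'x) free) module"
  by (rule assoc_alg_free)

lemma free_power [simp]: "f [^]\<^bsub>free_algebra\<^esub> (m::nat) = f ^ m" for f :: "('k::field, 'x) free"
  by (induction m) (simp_all add: power_commutes)

lemma free_minus [simp]: "f \<ominus>\<^bsub>free_algebra\<^esub> h = f - h" for f :: "('k::field, 'x) free"
  by (simp add: a_minus_def free.minus_eq_scale)

context assoc_alg
begin

context
  fixes e :: "'x \<Rightarrow> 'v"
  assumes e: "\<And>x. e x \<in> carrier A"
begin

lemma word_prod_closed [simp]: "word_prod A e w \<in> carrier A"
proof (cases w)
  case (Word ws)
  have "foldr (\<lambda>x y. e x \<otimes> y) ws \<one> \<in> carrier A" by (induction ws) (simp_all add: e)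
  with Word show ?thesis by simp
qed

lemma word_prod_add: "word_prod A e (v + w) = word_prod A e v \<otimes> word_prod A e w"
proof (cases v; cases w)
  fix us vs assume w: "w = Word vs" and v: "v = Word us"
  have "foldr (\<lambda>x y. e x \<otimes> y) vs \<one> \<in> carrier A" using word_prod_closed[of "Word vs"] by simp
  moreover have "foldr (\<lambda>x y. e x \<otimes> y) us \<one> \<in> carrier A" for us
    using word_prod_closed[of "Word us"] by simp
  ultimately have "foldr (\<lambda>x y. e x \<otimes> y) us (foldr (\<lambda>x y. e x \<otimes> y) vs \<one>)
      = foldr (\<lambda>x y. e x \<otimes> y) us \<one> \<otimes> foldr (\<lambda>x y. e x \<otimes> y) vs \<one>"
    by (induction us) (simp_all add: e m_assoc)
  with v w show ?thesis by simp
qed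

lemma free_eval_closed [simp]: "free_eval A e f \<in> carrier A"
  by (rule pm_eval_closed[of UNIV]) simp_all

lemma free_eval_add: "free_eval A e (f + h) = free_eval A e f \<oplus> free_eval A e h"
  by (rule pm_eval_add[of UNIV]) simp_all

lemma free_eval_scale: "free_eval A e (pm_scale c f) = c \<odot> free_eval A e f"
  by (rule pm_eval_scale[of UNIV]) simp_all

lemma free_eval_var [simp]: "free_eval A e (var x) = e x"
  using e by (simp add: var_def)

lemma free_eval_mult: "free_eval A e (f * h) = free_eval A e f \<otimes> free_eval A e h"
proof -
  have 1: "free_eval A e (Poly_Mapping.single w c * h) = free_eval A e (Poly_Mapping.single w c) \<otimes> free_eval A e h"
    for w c h
  proof -
    have "Poly_Mapping.keys h \<subseteq> UNIV" by simp
    then show ?thesis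
      by (induction h rule: pm_induct)
        (simp_all add: mult_single word_prod_add scale_mult_left scale_mult_right mult.commute
          distrib_left r_distr free_eval_add del: word_prod.simps)
  qed
  have "Poly_Mapping.keys f \<subseteq> UNIV" by simp
  then show ?thesis
    by (induction f rule: pm_induct) (simp_all add: 1 distrib_right l_distr free_eval_add del: pm_eval_single)
qed

lemma free_eval_hom: "algebra_hom free_algebra A (free_eval A e)"
proof (rule algebra_homI)
  have "free_eval A e (Poly_Mapping.single (Word []) 1) = \<one>" by simp
  then show "free_eval A e \<one>\<^bsub>free_algebra\<^esub> = \<one>" by (simp add: zero_fmon_def flip: single_one)
qed (simp_all add: free_eval_add free_eval_mult free_eval_scale)

end

end

section \<open>Induction over presented algebras and maps out of them\<close>

lemma free_induct [case_names one var add scale mult]: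
  fixes f :: "('k::field, 'x) free"
  assumes "P 1" "\<And>x. P (var x)" "\<And>f h. P f \<Longrightarrow> P h \<Longrightarrow> P (f + h)" "\<And>c f. P f \<Longrightarrow> P (pm_scale c f)"
    "\<And>f h. P f \<Longrightarrow> P h \<Longrightarrow> P (f * h)"
  shows "P f"
proof -
  have w: "P (Poly_Mapping.single (Word ws) 1)" for ws
  proof (induction ws)
    case Nil
    show ?case using assms(1) by (simp add: zero_fmon_def flip: single_one)
  next
    case (Cons x ws)
    have "Poly_Mapping.single (Word (x # ws)) 1 = var x * Poly_Mapping.single (Word ws) (1::'k)"
      by (simp add: var_def mult_single)
    then show ?case using Cons assms by simp
  qed
  have "Poly_Mapping.keys f \<subseteq> UNIV" by simp
  then show ?thesis
  proof (induction f rule: pm_induct)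
    case zero
    show ?case using assms(4)[OF assms(1), of 0] by simp
  next
    case (single q c)
    show ?case using assms(4)[OF w, of c] by (cases q) simp
  qed (use assms(3) in auto)
qed

lemma presented_induct [consumes 2, case_names one gen add scale mult]:
  assumes "presented_by H e R" "x \<in> carrier H"
    "P \<one>\<^bsub>H\<^esub>" "\<And>y. P (e y)"
    "\<And>x y. x \<in> carrier H \<Longrightarrow> y \<in> carrier H \<Longrightarrow> P x \<Longrightarrow> P y \<Longrightarrow> P (x \<oplus>\<^bsub>H\<^esub> y)"
    "\<And>c x. x \<in> carrier H \<Longrightarrow> P x \<Longrightarrow> P (c \<odot>\<^bsub>H\<^esub> x)"
    "\<And>x y. x \<in> carrier H \<Longrightarrow> y \<in> carrier H \<Longrightarrow> P x \<Longrightarrow> P y \<Longrightarrow> P (x \<otimes>\<^bsub>H\<^esub> y)"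
  shows "P x"
proof -
  obtain \<pi> where \<pi>: "algebra_hom free_algebra H \<pi>" "\<forall>x. \<pi> (var x) = e x" "range \<pi> = carrier H"
    using assms(1) by (auto simp: presented_by_def)
  note h = algebra_homD[OF \<pi>(1), simplified]
  have "P (\<pi> f)" for f
    by (induction f rule: free_induct) (simp_all add: h \<pi>(2) assms(3-7))
  with \<pi>(3) assms(2) show ?thesis by (metis rangeE)
qed

lemma presented_gen_closed: "presented_by H e R \<Longrightarrow> e x \<in> carrier H"
  unfolding presented_by_def by (metis rangeI)

lemma presented_hom_unique:
  assumes "presented_by H e R" "assoc_alg A" "algebra_hom H A f" "algebra_hom H A h"
    "\<And>y. f (e y) = h (e y)" "x \<in> carrier H"
  shows "f x = h x"
  using assms(1,6)
  by (induction x rule: presented_induct)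
    (simp_all add: assms(5) algebra_homD[OF assms(3)] algebra_homD[OF assms(4)])

text \<open>The kernel of the evaluation at \<open>e'\<close> is an ideal that contains
  \<open>R\<close>, hence contains the kernel of the presentation map; so the evaluation factors
  through \<open>H\<close>.\<close>

lemma presented_hom_exists:
  assumes "presented_by H e R" "assoc_alg H" "assoc_alg A" "\<And>x. e' x \<in> carrier A"
    "\<And>r. r \<in> R \<Longrightarrow> free_eval A e' r = \<zero>\<^bsub>A\<^esub>"
  obtains \<phi> where "algebra_hom H A \<phi>" "\<And>x. \<phi> (e x) = e' x"
proof -
  interpret H: assoc_alg H by fact
  interpret A: assoc_alg A by fact
  obtain \<pi> where \<pi>: "algebra_hom free_algebra H \<pi>" "\<forall>x. \<pi> (var x) = e x" "range \<pi> = carrier H"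
    "a_kernel free_algebra H \<pi> = Idl\<^bsub>free_algebra\<^esub> R"
    using assms(1) by (auto simp: presented_by_def)
  note h = algebra_homD[OF \<pi>(1), simplified]
  note E = A.free_eval_hom[of e', OF assms(4)]
  have E1: "free_eval A e' 1 = \<one>\<^bsub>A\<^esub>" using algebra_homD(6)[OF E] by simp
  note Eh = A.free_eval_closed[of e', OF assms(4)] A.free_eval_add[of e', OF assms(4)]
    A.free_eval_mult[of e', OF assms(4)] A.free_eval_scale[of e', OF assms(4)] E1
  have E2: "free_eval A e' \<in> ring_hom free_algebra A"
    using E unfolding algebra_hom_def by (rule conjunct1)
  have E3: "ring_hom_ring free_algebra A (free_eval A e')"
    by (rule ring_hom_ringI2[OF free.ring_axioms A.ring_axioms E2])
  note kernel_ideal = ring_hom_ring.kernel_is_ideal[OF E3]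
  have "Idl\<^bsub>free_algebra\<^esub> R \<subseteq> a_kernel free_algebra A (free_eval A e')"
    by (rule free.genideal_minimal[OF kernel_ideal])
      (auto simp: a_kernel_def' assms(5))
  then have ker: "free_eval A e' f = \<zero>\<^bsub>A\<^esub>" if "\<pi> f = \<zero>\<^bsub>H\<^esub>" for f
    using that \<pi>(4) by (auto simp: a_kernel_def')
  have wd: "free_eval A e' f = free_eval A e' f'" if "\<pi> f = \<pi> f'" for f f'
  proof -
    have "\<pi> (f - f') = \<zero>\<^bsub>H\<^esub>"
      using that algebra_hom_minus[OF assoc_alg_free assms(2) \<pi>(1), of f f'] h(2)[of f']
      by (simp only: free_minus free_simps UNIV_I simp_thms) (simp add: a_minus_def H.r_neg)
    then have "free_eval A e' ((f - f') + f') = free_eval A e' f'"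
      by (simp only: Eh(2)) (simp add: ker Eh(1))
    then show ?thesis by simp
  qed
  \<comment> \<open>A preimage under \<open>\<pi>\<close> is chosen; by \<open>wd\<close> the value
    does not depend on the choice.\<close>
  define \<phi> where "\<phi> x = free_eval A e' (SOME f. \<pi> f = x)" for x
  have \<phi>: "\<phi> (\<pi> f) = free_eval A e' f" for f
    unfolding \<phi>_def by (rule wd, rule someI[of _ f]) simp
  have ex: "\<exists>f. x = \<pi> f" if "x \<in> carrier H" for x
    using that \<pi>(3) by (metis rangeE)
  have "algebra_hom H A \<phi>"
    by (rule algebra_homI)
      (auto dest!: ex simp: \<phi> Eh h(3-6)[symmetric] assms(4))
  moreover have "\<phi> (e x) = e' x" for x
    using \<phi>[of "var x"] A.free_eval_var[of e' x] assms(4) by (simp add: \<pi>(2))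
  ultimately show ?thesis using that by blast
qed

section \<open>The quotient of the free algebra by the ideal of the relations\<close>

definition quot_class :: "('k::field, 'x) free set \<Rightarrow> ('k, 'x) free \<Rightarrow> ('k, 'x) free set" where
  "quot_class I f = {f + i | i. i \<in> I}"

definition presented_algebra :: "('k::field, 'x) free set \<Rightarrow> ('k, ('k, 'x) free set) module" where
  "presented_algebra R = (let cl = quot_class (Idl\<^bsub>free_algebra\<^esub> R) in
     \<lparr>carrier = range cl, monoid.mult = \<lambda>X Y. cl (rep X * rep Y), one = cl 1, zero = cl 0,
      add = \<lambda>X Y. cl (rep X + rep Y), smult = \<lambda>c X. cl (pm_scale c (rep X))\<rparr>)"

text \<open>The operations act on representatives; \<open>rm\<close>, \<open>ra\<close> and
  \<open>rs\<close> show that they respect the ideal. The class map is then a surjective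
  homomorphism from the free algebra, and \<open>assoc_alg_image\<close> transports the
  axioms.\<close>

lemma presented_algebra:
  fixes R :: "('k::field, 'x) free set"
  defines "cl \<equiv> quot_class (Idl\<^bsub>free_algebra\<^esub> R)"
  shows "assoc_alg (presented_algebra R)"
    and "presented_by (presented_algebra R) (\<lambda>x. cl (var x)) R"
proof -
  let ?I = "Idl\<^bsub>free_algebra\<^esub> R" and ?Q = "presented_algebra R"
  interpret I: ideal ?I "free_algebra :: ('k, ('k, 'x) free) module"
    by (rule free.genideal_ideal) simp
  have I0: "0 \<in> ?I"
    using additive_subgroup.zero_closed[OF I.additive_subgroup_axioms] by simp
  have Iadd: "f + h \<in> ?I" if "f \<in> ?I" "h \<in> ?I" for f h
    using additive_subgroup.a_closed[OF I.additive_subgroup_axioms] that by simp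
  have Imult: "u * f \<in> ?I" "f * u \<in> ?I" if "f \<in> ?I" for f u
    using I.I_l_closed[of f u] I.I_r_closed[of f u] that by simp_all
  have Iscale: "pm_scale c f \<in> ?I" if "f \<in> ?I" for c f
    using Imult(1)[OF that] by (simp add: pm_scale_eq_mult)
  have Iminus: "f - h \<in> ?I" if "f \<in> ?I" "h \<in> ?I" for f h
    using Iadd[OF that(1) Iscale[OF that(2), of "- 1"]] by simp
  have eq: "cl f = cl h \<longleftrightarrow> f - h \<in> ?I" for f h
  proof
    assume "cl f = cl h"
    moreover have "f \<in> cl f" using I0 by (auto simp: cl_def quot_class_def intro: exI[of _ 0])
    ultimately obtain i where "i \<in> ?I" "f = h + i" by (auto simp: cl_def quot_class_def)
    then show "f - h \<in> ?I" by simp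
  next
    assume fh: "f - h \<in> ?I"
    have "\<exists>i'\<in>?I. f + i = h + i'" if "i \<in> ?I" for i
      using Iadd[OF fh that] by (intro bexI[of _ "(f - h) + i"]) auto
    moreover have "\<exists>i'\<in>?I. h + i = f + i'" if "i \<in> ?I" for i
      using Iminus[OF that fh] by (intro bexI[of _ "i - (f - h)"]) auto
    ultimately show "cl f = cl h" unfolding cl_def quot_class_def by blast
  qed
  have r: "rep (cl f) - f \<in> ?I" for f
  proof -
    have "f \<in> cl f" using I0 by (auto simp: cl_def quot_class_def intro: exI[of _ 0])
    then have "rep (cl f) \<in> cl f" unfolding rep_def by (rule someI)
    then show ?thesis by (auto simp: cl_def quot_class_def)
  qed
  have rm: "rep (cl f) * rep (cl h) - f * h \<in> ?I" for f h
  proof -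
    \<comment> \<open>Telescoping: with \<open>f'\<close> and \<open>h'\<close> the representatives,
      \<open>f' h' - f h = (f' - f) h' + f (h' - h)\<close>, which uses the ideal from both
      sides.\<close>
    have "(rep (cl f) - f) * rep (cl h) + f * (rep (cl h) - h) \<in> ?I"
      by (intro Iadd Imult r)
    then show ?thesis by (simp add: algebra_simps)
  qed
  have ra: "rep (cl f) + rep (cl h) - (f + h) \<in> ?I" for f h
    using Iadd[OF r[of f] r[of h]] by (simp add: algebra_simps)
  have rs: "pm_scale c (rep (cl f)) - pm_scale c f \<in> ?I" for c f
    using Iscale[OF r[of f], of c] by (simp add: pm.scale_right_diff_distrib)
  have Q: "carrier ?Q = range cl" "cl f \<otimes>\<^bsub>?Q\<^esub> cl h = cl (f * h)" "cl f \<oplus>\<^bsub>?Q\<^esub> cl h = cl (f + h)"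
    "c \<odot>\<^bsub>?Q\<^esub> cl f = cl (pm_scale c f)" "\<one>\<^bsub>?Q\<^esub> = cl 1" "\<zero>\<^bsub>?Q\<^esub> = cl 0" for f h c
    by (simp_all add: presented_algebra_def Let_def flip: cl_def) (simp_all add: eq rm ra rs)
  have hom: "algebra_hom free_algebra ?Q cl"
    by (rule algebra_homI) (simp_all add: Q)
  show "assoc_alg ?Q"
    by (rule assoc_alg_image[OF assoc_alg_free hom]) (simp_all add: Q)
  have "a_kernel free_algebra ?Q cl = ?I"
    using eq[of _ 0] by (simp add: a_kernel_def' Q)
  with hom show "presented_by ?Q (\<lambda>x. cl (var x)) R"
    unfolding presented_by_def using Q(1) by blast
qed

section \<open>The defining relations\<close>

locale parameters =
  fixes p n :: nat and lam mu :: "'k::field"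
  assumes char_p: "CHAR('k) = p" and p_gt_2: "p > 2" and n_pos: "n > 0" and p_dvd_n: "p dvd n"
begin

lemma prime_p: "prime p"
  using char_p p_gt_2 prime_CHAR_semidom[where 'a = 'k] by simp

lemma p_zero: "(of_nat p :: 'k) = 0"
  using of_nat_CHAR[where 'a = 'k] char_p by simp

text \<open>Conjugation by \<open>g\<close> adds \<open>a\<close> to \<open>b\<close>, so
  \<open>g ^ n = 1\<close> forces \<open>n a = 0\<close>. This is where \<open>p dvd n\<close>
  enters.\<close>

lemma n_zero: "(of_nat n :: 'k) = 0"
proof -
  obtain q where "n = p * q" using p_dvd_n by auto
  then show ?thesis using p_zero by (simp only: of_nat_mult) simp
qed

lemma of_nat_nonzero: "0 < m \<Longrightarrow> m < p \<Longrightarrow> (of_nat m :: 'k) \<noteq> 0"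
  using char_p by (auto simp: of_nat_eq_0_iff_char_dvd dest: dvd_imp_le)

lemma two_nonzero [simp]: "(2 :: 'k) \<noteq> 0"
  using of_nat_nonzero[of 2] p_gt_2 by simp

lemma odd_p: "odd p"
  using prime_p p_gt_2 by (simp add: prime_odd_nat)

lemma choose_zero: "0 < s \<Longrightarrow> s < p \<Longrightarrow> (of_nat (p choose s) :: 'k) = 0"
  using dvd_choose_prime[OF _ _ _ prime_p, of s] p_gt_2 char_p by (simp add: of_nat_eq_0_iff_char_dvd)

end

text \<open>Any algebra with three elements that satisfy the relations, whether or not these define
  it. Beside the presented algebra, instances are the operators on quasi-periodic functions, the
  tensor square, the ground field and the opposite algebra; each of these yields a homomorphism out
  of the presented algebra.\<close>

locale rel_alg = assoc_alg A + parameters p n lam mu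
  for A :: "('k::field, 'v, 'm) module_scheme" (structure) and p n lam mu +
  fixes a b g :: 'v
  assumes gens_closed [simp, intro]: "a \<in> carrier A" "b \<in> carrier A" "g \<in> carrier A"
    and g_pow_n: "g [^] n = \<one>"
    and a_g: "a \<otimes> g = g \<otimes> a"
    and b_g: "b \<otimes> g = g \<otimes> (a \<oplus> b)"
    and a_pow_p: "a [^] p = lam \<odot> (\<one> \<ominus> g [^] p)"
    and b_pow_p: "b [^] p = mu \<odot> (\<one> \<ominus> g [^] p)"
    and b_a: "b \<otimes> a = a \<otimes> b \<oplus> (1 / 2) \<odot> (a \<otimes> a)"
begin

text \<open>Conjugating \<open>b + c a\<close> by \<open>g\<close> or commuting it past \<open>a\<close> only shifts \<open>c\<close>.\<close>

definition slope :: "'k \<Rightarrow> 'v" where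
  "slope c = b \<oplus> c \<odot> a"

lemma slope_closed [simp, intro]: "slope c \<in> carrier A"
  by (simp add: slope_def)

lemma slope_0: "slope 0 = b"
  by (simp add: slope_def)

lemma scale_collect: "x \<in> carrier A \<Longrightarrow> c \<odot> x \<oplus> d \<odot> x = (c + d) \<odot> x"
  "x \<in> carrier A \<Longrightarrow> y \<in> carrier A \<Longrightarrow> c \<odot> x \<oplus> (d \<odot> x \<oplus> y) = (c + d) \<odot> x \<oplus> y"
  "x \<in> carrier A \<Longrightarrow> x \<oplus> d \<odot> x = (1 + d) \<odot> x"
  "x \<in> carrier A \<Longrightarrow> y \<in> carrier A \<Longrightarrow> x \<oplus> (d \<odot> x \<oplus> y) = (1 + d) \<odot> x \<oplus> y"
  using scale_add_left[of x c d] scale_add_left[of x 1 d]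
  by (simp_all add: a_assoc[symmetric])

lemma slope_mult_slope: "slope x \<otimes> slope y =
   b \<otimes> b \<oplus> ((x + y) \<odot> (a \<otimes> b) \<oplus> (y / 2 + x * y) \<odot> (a \<otimes> a))"
proof -
  have "slope x \<otimes> slope y = b \<otimes> b \<oplus> y \<odot> (b \<otimes> a) \<oplus> (x \<odot> (a \<otimes> b) \<oplus> (x * y) \<odot> (a \<otimes> a))"
    by (simp add: slope_def l_distr r_distr scale_mult_left scale_mult_right scale_add_right mult.commute a_ac)
  also have "y \<odot> (b \<otimes> a) = y \<odot> (a \<otimes> b) \<oplus> (y / 2) \<odot> (a \<otimes> a)"
    by (simp add: b_a scale_add_right)
  finally show ?thesis
    by (simp add: a_ac scale_collect add.commute)
qed

text \<open>With these arguments the coefficient of \<open>a \<otimes> a\<close> in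
  \<open>slope_mult_slope\<close> becomes \<open>x * y\<close> and that of
  \<open>a \<otimes> b\<close> becomes \<open>x + y - 1 / 2\<close>; both are symmetric in
  \<open>x\<close> and \<open>y\<close>.\<close>

lemma slope_swap: "slope (x - 1 / 2) \<otimes> slope y = slope (y - 1 / 2) \<otimes> slope x"
proof -
  have "y / 2 + (x - 1 / 2) * y = x / 2 + (y - 1 / 2) * x"
    by (simp add: field_simps)
  then show ?thesis by (simp add: slope_mult_slope algebra_simps)
qed

text \<open>Iteration of \<open>slope_swap\<close>: each swap turns one factor
  \<open>slope (c - 1 / 2)\<close> into \<open>slope c\<close> and lowers the slope of the leading
  factor by \<open>1 / 2\<close>.\<close>

lemma slope_power_shift:
  "slope (c - 1 / 2) [^] Suc m = slope (c - of_nat (Suc m) / 2) \<otimes> slope c [^] m"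
proof (induction m)
  case (Suc m)
  have "slope (c - 1 / 2) [^] Suc (Suc m) = slope (c - 1 / 2) \<otimes> slope (c - 1 / 2) [^] Suc m"
    by (subst nat_pow_Suc2) simp_all
  also have "\<dots> = slope (c - 1 / 2) \<otimes> slope (c - of_nat (Suc m) / 2) \<otimes> slope c [^] m"
    unfolding Suc.IH by (simp add: m_assoc del: nat_pow_Suc)
  also have "slope (c - 1 / 2) \<otimes> slope (c - of_nat (Suc m) / 2) = slope (c - of_nat (Suc (Suc m)) / 2) \<otimes> slope c"
    by (subst slope_swap) (simp add: diff_diff_eq add_divide_distrib add_ac)
  finally show ?case by (simp add: m_assoc nat_pow_Suc2[symmetric] del: nat_pow_Suc)
qed simp

text \<open>For exponent \<open>p\<close> the offset in \<open>slope_power_shift\<close> is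
  \<open>p / 2 = 0\<close>, so moving the slope by \<open>1 / 2\<close> leaves the
  \<open>p\<close>-th power unchanged. It is used for the \<open>p\<close>-th power of the antipode
  of \<open>b\<close>.\<close>

lemma slope_power_p: "slope (of_nat m / 2) [^] p = b [^] p"
proof (induction m)
  case (Suc m)
  obtain q where q: "p = Suc q" using p_gt_2 by (cases p) auto
  have "slope (of_nat m / 2) [^] p = slope (of_nat (Suc m) / 2 - 1 / 2) [^] Suc q"
    by (simp add: q field_simps)
  also have "\<dots> = slope (of_nat (Suc m) / 2 - of_nat p / 2) \<otimes> slope (of_nat (Suc m) / 2) [^] q"
    unfolding slope_power_shift q ..
  also have "\<dots> = slope (of_nat (Suc m) / 2) [^] p"
    using p_zero[unfolded q] by (simp add: q nat_pow_Suc2[symmetric] del: nat_pow_Suc of_nat_Suc)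
  finally show ?case using Suc by simp
qed (simp add: slope_0)

lemma slope_a: "slope c \<otimes> a = a \<otimes> slope (c + 1 / 2)"
  by (simp add: slope_def l_distr r_distr b_a scale_mult_left scale_mult_right scale_add_left a_ac)

lemma slope_a_power: "slope c \<otimes> a [^] i = a [^] i \<otimes> slope (c + of_nat i / 2)"
proof (induction i)
  case (Suc i)
  have "slope c \<otimes> a [^] Suc i = a [^] i \<otimes> (slope (c + of_nat i / 2) \<otimes> a)"
    using Suc by (simp add: m_assoc[symmetric])
  then show ?case by (simp add: slope_a m_assoc[symmetric] field_simps)
qed simp

lemma slope_g: "slope c \<otimes> g = g \<otimes> slope (c + 1)"
  by (simp add: slope_def l_distr r_distr b_g a_g scale_mult_left scale_mult_right scale_add_left a_ac)

lemma slope_g_power: "slope c \<otimes> g [^] k = g [^] k \<otimes> slope (c + of_nat k)" for k :: nat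
proof (induction k)
  case (Suc k)
  have "slope c \<otimes> g [^] Suc k = g [^] k \<otimes> (slope (c + of_nat k) \<otimes> g)"
    using Suc by (simp add: m_assoc[symmetric])
  then show ?case by (simp add: slope_g m_assoc[symmetric] field_simps)
qed simp

lemma a_power_g_power: "a [^] i \<otimes> g [^] k = g [^] k \<otimes> a [^] i" for i k :: nat
proof -
  have 1: "a \<otimes> g [^] k = g [^] k \<otimes> a"
    by (induction k) (simp_all add: m_assoc[symmetric], simp add: m_assoc a_g)
  show ?thesis
    by (induction i) (simp_all add: m_assoc 1, simp add: m_assoc[symmetric])
qed

lemma g_mod: "g [^] (k mod n) = g [^] k" for k :: nat
proof -
  have "g [^] k = g [^] (n * (k div n) + k mod n)" by simp
  also have "\<dots> = g [^] (k mod n)"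
    by (simp only: nat_pow_mult[symmetric] nat_pow_pow[symmetric] gens_closed g_pow_n) simp
  finally show ?thesis ..
qed

end

text \<open>Once \<open>g [^] n = \<one>\<close>, the power \<open>g [^] (n - 1)\<close> is a
  two-sided inverse of \<open>g\<close>, and the conjugation relations become commutation rules. The
  homomorphism is arbitrary because both the presentation map and the evaluation in another algebra
  are needed.\<close>

lemma relators_hom_iff:
  fixes A :: "('k::field, 'v, 'm) module_scheme" (structure) and a b g :: 'v
  assumes A: "assoc_alg A" and \<phi>: "algebra_hom free_algebra A \<phi>" and "n > 0"
    and gens: "\<phi> (var GenA) = a" "\<phi> (var GenB) = b" "\<phi> (var GenG) = g"
  shows "(\<forall>r\<in>relators p n lam mu. \<phi> r = \<zero>) \<longleftrightarrow>
    g [^] n = \<one> \<and> a \<otimes> g = g \<otimes> a \<and> b \<otimes> g = g \<otimes> (a \<oplus> b) \<and>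
    a [^] p = lam \<odot> (\<one> \<ominus> g [^] p) \<and> b [^] p = mu \<odot> (\<one> \<ominus> g [^] p) \<and>
    b \<otimes> a = a \<otimes> b \<oplus> (1 / 2) \<odot> (a \<otimes> a)"
proof -
  interpret assoc_alg A by (rule A)
  note h = algebra_homD(2,5)[OF \<phi>, unfolded free_simps, OF UNIV_I] algebra_homD(6)[OF \<phi>, unfolded free_simps]
    algebra_homD(3,4)[OF \<phi>, unfolded free_simps, OF UNIV_I UNIV_I]
  have [simp]: "a \<in> carrier A" "b \<in> carrier A" "g \<in> carrier A" using h(1) gens by auto
  have h2: "\<phi> (f ^ m) = \<phi> f [^] m" "\<phi> (f - f') = \<phi> f \<ominus> \<phi> f'" for f f' and m :: nat
    using algebra_hom_power[OF assoc_alg_free A \<phi>, of f m] algebra_hom_minus[OF assoc_alg_free A \<phi>, of f f']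
    by simp_all
  have conj: "g [^] (n - 1) \<otimes> x \<otimes> g = y \<longleftrightarrow> x \<otimes> g = g \<otimes> y"
    if "g [^] n = \<one>" "x \<in> carrier A" "y \<in> carrier A" for x y
  proof -
    obtain m where m: "n = Suc m" using \<open>n > 0\<close> by (cases n) auto
    have 1: "g \<otimes> g [^] m = \<one>" "g [^] m \<otimes> g = \<one>"
      using that(1) by (simp_all only: m nat_pow_Suc2[OF \<open>g \<in> carrier A\<close>, symmetric] nat_pow_Suc)
    have "g \<otimes> (g [^] m \<otimes> x \<otimes> g) = x \<otimes> g" "g [^] m \<otimes> (g \<otimes> y) = y"
      using that 1 by (simp_all add: m_assoc[symmetric])
    then show ?thesis using that(2,3) m by (auto simp: m_assoc)
  qed
  have diff0: "x \<ominus> y = \<zero> \<longleftrightarrow> x = y" if "x \<in> carrier A" "y \<in> carrier A" for x y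
    using that minus_equality[of x "\<ominus> y"] by (auto simp: a_minus_def r_neg)
  have sq: "a [^] (2::nat) = a \<otimes> a" by (simp add: numeral_2_eq_2)
  show ?thesis
    unfolding relators_def Let_def
    by (simp add: h h2 gens diff0 sq cong: conj_cong) (auto simp: conj[unfolded One_nat_def])
qed

section \<open>A module on which the monomials act independently\<close>

text \<open>
  In the commutative algebra \<open>k[z, x, y]\<close> modulo \<open>z\<^sup>n = 1\<close>, \<open>x\<^sup>p = lam (1 - z\<^sup>p)\<close>, \<open>y\<^sup>p = mu (1 - z\<^sup>p)\<close>
  the defining relations hold for \<open>g = z\<close>, \<open>a = x\<close> and \<open>b = y + x D\<close>, where \<open>D\<close> is the derivation with
  \<open>D z = z\<close>, \<open>D x = x / 2\<close>, \<open>D y = 0\<close>. Below, the same works on the dual space, whose elements are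
  the quasi-periodic functions of the exponents \<open>(k, i, j)\<close> of \<open>z\<^sup>k x\<^sup>i y\<^sup>j\<close>, so that \<open>x\<close>, \<open>y\<close>, \<open>z\<close> act
  by shifts.
\<close>

definition end_algebra :: "('i \<Rightarrow> 'k::field) set \<Rightarrow> ('k, ('i \<Rightarrow> 'k) \<Rightarrow> ('i \<Rightarrow> 'k)) module" where
  "end_algebra M =
     \<lparr>carrier = {T. (\<forall>m\<in>M. T m \<in> M) \<and> (\<forall>m. m \<notin> M \<longrightarrow> T m = (\<lambda>_. 0)) \<and>
        (\<forall>m\<in>M. \<forall>m'\<in>M. T (\<lambda>x. m x + m' x) = (\<lambda>x. T m x + T m' x)) \<and>
        (\<forall>c. \<forall>m\<in>M. T (\<lambda>x. c * m x) = (\<lambda>x. c * T m x))},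
      monoid.mult = \<lambda>S T m. if m \<in> M then S (T m) else (\<lambda>_. 0),
      one = \<lambda>m. if m \<in> M then m else (\<lambda>_. 0), zero = \<lambda>m _. 0,
      add = \<lambda>S T m x. S m x + T m x, smult = \<lambda>c T m x. c * T m x\<rparr>"

section \<open>Operators on a space of functions\<close>

locale function_space =
  fixes M :: "('i \<Rightarrow> 'k::field) set"
  assumes M_add: "m \<in> M \<Longrightarrow> m' \<in> M \<Longrightarrow> (\<lambda>x. m x + m' x) \<in> M"
    and M_scale: "m \<in> M \<Longrightarrow> (\<lambda>x. c * m x) \<in> M"
    and M_zero: "(\<lambda>_. 0) \<in> M"
begin

lemma end_simps [simp]:
  "S \<otimes>\<^bsub>end_algebra M\<^esub> T = (\<lambda>m. if m \<in> M then S (T m) else (\<lambda>_. 0))"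
  "\<one>\<^bsub>end_algebra M\<^esub> = (\<lambda>m. if m \<in> M then m else (\<lambda>_. 0))"
  "\<zero>\<^bsub>end_algebra M\<^esub> = (\<lambda>m _. 0)"
  "S \<oplus>\<^bsub>end_algebra M\<^esub> T = (\<lambda>m x. S m x + T m x)"
  "c \<odot>\<^bsub>end_algebra M\<^esub> T = (\<lambda>m x. c * T m x)"
  by (simp_all add: end_algebra_def)

lemma end_carrier:
  "T \<in> carrier (end_algebra M) \<longleftrightarrow> (\<forall>m\<in>M. T m \<in> M) \<and> (\<forall>m. m \<notin> M \<longrightarrow> T m = (\<lambda>_. 0)) \<and>
        (\<forall>m\<in>M. \<forall>m'\<in>M. T (\<lambda>x. m x + m' x) = (\<lambda>x. T m x + T m' x)) \<and>
        (\<forall>c. \<forall>m\<in>M. T (\<lambda>x. c * m x) = (\<lambda>x. c * T m x))"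
  by (simp add: end_algebra_def)

text \<open>Outside \<open>M\<close> every operator takes the value zero, and \<open>one\<close> and
  the product are adjusted to this, so operators that agree on \<open>M\<close> are equal.\<close>

lemma assoc_alg_end: "assoc_alg (end_algebra M)"
proof -
  let ?E = "end_algebra M"
  have ag: "abelian_group ?E"
  proof (rule abelian_groupI)
    fix T assume T: "T \<in> carrier ?E"
    have "(\<lambda>x. - m x) \<in> M" if "m \<in> M" for m using M_scale[OF that, of "- 1"] by simp
    then have "(\<lambda>m x. - 1 * T m x) \<in> carrier ?E"
      using T unfolding end_carrier by (auto simp: algebra_simps fun_eq_iff)
    then show "\<exists>S\<in>carrier ?E. S \<oplus>\<^bsub>?E\<^esub> T = \<zero>\<^bsub>?E\<^esub>"
      by (intro bexI[of _ "\<lambda>m x. - 1 * T m x"]) (simp_all add: fun_eq_iff)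
  qed (auto simp: end_carrier fun_eq_iff M_zero intro!: M_add simp: algebra_simps)
  have "ring ?E"
  proof (rule ringI[OF ag])
    show "Group.monoid ?E"
      by (rule monoidI) (auto simp: end_carrier M_add M_scale fun_eq_iff[of "\<lambda>m. if m \<in> M then _ m else _ m"])
  qed (rule ext, auto simp: end_carrier)+
  moreover have "vspace ?E" unfolding vspace_def
    by (rule moduleI[OF cring_ground ag])
      (auto simp: end_carrier fun_eq_iff algebra_simps intro!: M_scale)
  ultimately show ?thesis
    unfolding assoc_alg_def assoc_alg_axioms_def by (auto simp: end_carrier fun_eq_iff)
qed

lemma end_power:
  assumes "T \<in> carrier (end_algebra M)" "m \<in> M"
  shows "(T [^]\<^bsub>end_algebra M\<^esub> (r::nat)) m = (T ^^ r) m" "(T ^^ r) m \<in> M"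
proof -
  interpret assoc_alg "end_algebra M" by (rule assoc_alg_end)
  have 1: "(T ^^ r) m \<in> M" if "m \<in> M" for m r
    using that assms(1) by (induction r) (auto simp: end_carrier)
  show "(T ^^ r) m \<in> M" by (rule 1) fact
  show "(T [^]\<^bsub>end_algebra M\<^esub> r) m = (T ^^ r) m" using assms(2)
  proof (induction r arbitrary: m)
    case (Suc r)
    moreover have "T m \<in> M" using Suc.prems assms(1) by (auto simp: end_carrier)
    ultimately show ?case by (simp add: funpow_swap1)
  qed simp
qed

lemma end_minus:
  assumes "S \<in> carrier (end_algebra M)" "T \<in> carrier (end_algebra M)"
  shows "S \<ominus>\<^bsub>end_algebra M\<^esub> T = (\<lambda>m x. S m x - T m x)"
proof -
  interpret assoc_alg "end_algebra M" by (rule assoc_alg_end)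
  show ?thesis using assms by (simp add: a_minus_def minus_eq_scale)
qed

end

section \<open>Quasi-periodic functions and the action of the generators\<close>

locale quasi_periodic_functions = parameters p n lam mu for p n and lam mu :: "'k::field"
begin

text \<open>Think of \<open>m (k, i, j)\<close> as the value of a linear functional at
  \<open>z^k x^i y^j\<close>. The three conditions say that it vanishes on the ideal generated by
  \<open>z^n - 1\<close>, \<open>x^p - lam (1 - z^p)\<close> and
  \<open>y^p - mu (1 - z^p)\<close>.\<close>

definition quasi_periodic :: "(nat \<times> nat \<times> nat \<Rightarrow> 'k) set" where
  "quasi_periodic = {m. \<forall>k i j. m (k + n, i, j) = m (k, i, j) \<and>
     m (k, i + p, j) = lam * (m (k, i, j) - m (k + p, i, j)) \<and>
     m (k, i, j + p) = mu * (m (k, i, j) - m (k + p, i, j))}"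

abbreviation "QP \<equiv> quasi_periodic"

sublocale function_space QP
  by standard (auto simp: quasi_periodic_def; simp add: algebra_simps)+

text \<open>Minus the eigenvalue of \<open>D\<close> at \<open>z^k x^i\<close>. Passing to the dual
  space reverses products, so \<open>b\<close> has to act as the transpose of the formal adjoint
  \<open>y - D x\<close> of \<open>y + x D\<close>; this explains the sign, and the index
  \<open>Suc i\<close> in \<open>act_b\<close>.\<close>

definition weight :: "nat \<Rightarrow> nat \<Rightarrow> 'k" where
  "weight k i = - (of_nat k + of_nat i / 2)"

lemma weight_shift [simp]: "weight (k + n) i = weight k i" "weight (k + p) i = weight k i"
  "weight k (i + p) = weight k i" "weight k (Suc (i + p)) = weight k (Suc i)"
  by (simp_all add: weight_def n_zero p_zero add_divide_distrib)

lemma weight_Suc: "weight (Suc k) i = weight k i - 1" "weight k (Suc i) = weight k i - 1 / 2"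
  by (simp_all add: weight_def add_divide_distrib)

lemma two_weight: "2 * weight k i = - of_nat (2 * k + i)"
  by (simp add: weight_def distrib_left)

text \<open>Up to the factor 2 the weights are the negatives of \<open>p\<close> consecutive
  integers, one of which is divisible by \<open>p\<close>.\<close>

lemma weight_prod_zero: "(\<Prod>t\<in>{1..p}. weight k (i + t)) = 0"
proof -
  define r where "r = (2 * k + i) mod p"
  have r: "r < p" using p_gt_2 by (simp add: r_def)
  have "(2 * k + i) + (p - r) = p * Suc ((2 * k + i) div p)"
    using r mult_div_mod_eq[of p "2 * k + i"] unfolding r_def[symmetric] by simp
  then have "(of_nat (2 * k + i + (p - r)) :: 'k) = 0" by (simp only: of_nat_mult p_zero mult_zero_left)
  then have "2 * weight k (i + (p - r)) = 0"
    by (simp only: two_weight add.assoc) simp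
  then have "weight k (i + (p - r)) = 0" using two_nonzero mult_eq_0_iff by blast
  moreover have "p - r \<in> {1..p}" using r by auto
  ultimately show ?thesis by (intro prod_zero bexI[of _ "p - r"]) simp_all
qed

definition "on_QP f = (\<lambda>m. if m \<in> QP then f m else (\<lambda>_. 0))"
definition "act_g = on_QP (\<lambda>m (k, i, j). m (Suc k, i, j))"
definition "act_a = on_QP (\<lambda>m (k, i, j). m (k, Suc i, j))"
definition "act_b = on_QP (\<lambda>m (k, i, j). m (k, i, Suc j) + weight k (Suc i) * m (k, Suc i, j))"

lemma QP_simps:
  assumes "m \<in> QP"
  shows "m (k + n, i, j) = m (k, i, j)"
    "m (k, i + p, j) = lam * (m (k, i, j) - m (k + p, i, j))"
    "m (k, i, j + p) = mu * (m (k, i, j) - m (k + p, i, j))"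
    "m (Suc (k + n), i, j) = m (Suc k, i, j)"
    "m (k, Suc (i + p), j) = lam * (m (k, Suc i, j) - m (k + p, Suc i, j))"
    "m (k, i, Suc (j + p)) = mu * (m (k, i, Suc j) - m (k + p, i, Suc j))"
  using assms unfolding quasi_periodic_def mem_Collect_eq by (metis add_Suc)+

lemma act_closed [simp]:
  "act_g \<in> carrier (end_algebra QP)" "act_a \<in> carrier (end_algebra QP)" "act_b \<in> carrier (end_algebra QP)"
proof -
  have 1: "(\<lambda>(k, i, j). m (Suc k, i, j)) \<in> QP" "(\<lambda>(k, i, j). m (k, Suc i, j)) \<in> QP"
    "(\<lambda>(k, i, j). m (k, i, Suc j) + weight k (Suc i) * m (k, Suc i, j)) \<in> QP" if m: "m \<in> QP" for m
    unfolding quasi_periodic_def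
    by (auto simp: QP_simps[OF m] QP_simps(2,3)[OF m, of "Suc _"]; simp add: algebra_simps)+
  show "act_g \<in> carrier (end_algebra QP)" "act_a \<in> carrier (end_algebra QP)" "act_b \<in> carrier (end_algebra QP)"
    unfolding end_carrier act_g_def act_a_def act_b_def on_QP_def
    by (auto simp: 1 M_add M_scale fun_eq_iff algebra_simps)
qed

lemma act_simps [simp]:
  assumes "m \<in> QP"
  shows "act_g m (k, i, j) = m (Suc k, i, j)" "act_a m (k, i, j) = m (k, Suc i, j)"
    "act_b m (k, i, j) = m (k, i, Suc j) + weight k (Suc i) * m (k, Suc i, j)"
    "act_g m \<in> QP" "act_a m \<in> QP" "act_b m \<in> QP"
  using assms act_closed by (auto simp: act_g_def act_a_def act_b_def on_QP_def end_carrier)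

lemmas power_QP [simp] = end_power(2)[OF act_closed(1)] end_power(2)[OF act_closed(2)] end_power(2)[OF act_closed(3)]

lemma act_g_power: "m \<in> QP \<Longrightarrow> (act_g ^^ r) m (k, i, j) = m (k + r, i, j)"
  by (induction r arbitrary: k) simp_all

lemma act_a_power: "m \<in> QP \<Longrightarrow> (act_a ^^ r) m (k, i, j) = m (k, i + r, j)"
  by (induction r arbitrary: i) simp_all

text \<open>The shift in \<open>j\<close> and the weighted shift in \<open>i\<close> commute, so the
  powers of their sum obey the binomial theorem; the product collects the weights met along
  \<open>s\<close> shifts in \<open>i\<close>.\<close>

lemma act_b_power:
  "m \<in> QP \<Longrightarrow> (act_b ^^ r) m (k, i, j) =
    (\<Sum>s\<le>r. of_nat (r choose s) * (\<Prod>t\<in>{1..s}. weight k (i + t)) * m (k, i + s, j + r - s))"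
proof (induction r arbitrary: i j)
  case (Suc r)
  let ?W = "\<lambda>i s. \<Prod>t\<in>{1..s}. weight k (i + t)"
  have W: "weight k (Suc i) * ?W (Suc i) s = ?W i (Suc s)" for s
    by (simp add: prod.atLeast_Suc_atMost prod.shift_bounds_cl_Suc_ivl del: prod.cl_ivl_Suc)
  have 2: "weight k (Suc i) * (\<Sum>s\<le>r. of_nat (r choose s) * ?W (Suc i) s * m (k, Suc i + s, j + r - s))
     = (\<Sum>s\<le>r. of_nat (r choose s) * ?W i (Suc s) * m (k, i + Suc s, j + Suc r - Suc s))"
    unfolding sum_distrib_left W[symmetric] by (rule sum.cong) (simp_all add: mult_ac)
  have 1: "(\<Sum>s\<le>r. of_nat (r choose s) * ?W i s * m (k, i + s, Suc j + r - s))
     = (\<Sum>s\<le>Suc r. of_nat (r choose s) * ?W i s * m (k, i + s, j + Suc r - s))"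
    by (simp add: binomial_eq_0)
  have "(act_b ^^ Suc r) m (k, i, j) =
     (\<Sum>s\<le>Suc r. of_nat (r choose s) * ?W i s * m (k, i + s, j + Suc r - s)) +
     (\<Sum>s\<le>r. of_nat (r choose s) * ?W i (Suc s) * m (k, i + Suc s, j + Suc r - Suc s))"
    using Suc 1 2 by simp
  also have "\<dots> = (\<Sum>s\<le>Suc r. of_nat (Suc r choose s) * ?W i s * m (k, i + s, j + Suc r - s))"
    by (simp only: sum.atMost_Suc_shift binomial_Suc_Suc of_nat_add distrib_right sum.distrib) simp
  finally show ?case .
qed simp

text \<open>The binomial coefficients leave only \<open>s = 0\<close> and \<open>s = p\<close>, and
  the weights at \<open>s = p\<close> multiply to zero. So the correction term in \<open>b\<close>
  disappears in its \<open>p\<close>-th power.\<close>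

lemma act_b_power_p:
  assumes "m \<in> QP"
  shows "(act_b ^^ p) m (k, i, j) = m (k, i, j + p)"
proof -
  have "(\<Sum>s\<le>p. of_nat (p choose s) * (\<Prod>t\<in>{1..s}. weight k (i + t)) * m (k, i + s, j + p - s))
     = (\<Sum>s\<in>{0}. of_nat (p choose s) * (\<Prod>t\<in>{1..s}. weight k (i + t)) * m (k, i + s, j + p - s))"
  proof (rule sum.mono_neutral_right)
    show "\<forall>s\<in>{..p} - {0}. of_nat (p choose s) * (\<Prod>t\<in>{1..s}. weight k (i + t)) * m (k, i + s, j + p - s) = 0"
    proof
      fix s assume "s \<in> {..p} - {0}"
      then consider "s = p" | "0 < s" "s < p" by fastforce
      then show "of_nat (p choose s) * (\<Prod>t\<in>{1..s}. weight k (i + t)) * m (k, i + s, j + p - s) = 0"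
        using weight_prod_zero[of k i] by cases (simp_all add: choose_zero del: prod.cl_ivl_Suc)
    qed
  qed auto
  then show ?thesis using assms by (simp add: act_b_power)
qed

abbreviation "E \<equiv> end_algebra QP"

lemma act_relations:
  "act_g [^]\<^bsub>E\<^esub> n = \<one>\<^bsub>E\<^esub>" "act_a \<otimes>\<^bsub>E\<^esub> act_g = act_g \<otimes>\<^bsub>E\<^esub> act_a"
  "act_b \<otimes>\<^bsub>E\<^esub> act_g = act_g \<otimes>\<^bsub>E\<^esub> (act_a \<oplus>\<^bsub>E\<^esub> act_b)"
  "act_a [^]\<^bsub>E\<^esub> p = lam \<odot>\<^bsub>E\<^esub> (\<one>\<^bsub>E\<^esub> \<ominus>\<^bsub>E\<^esub> act_g [^]\<^bsub>E\<^esub> p)"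
  "act_b [^]\<^bsub>E\<^esub> p = mu \<odot>\<^bsub>E\<^esub> (\<one>\<^bsub>E\<^esub> \<ominus>\<^bsub>E\<^esub> act_g [^]\<^bsub>E\<^esub> p)"
  "act_b \<otimes>\<^bsub>E\<^esub> act_a = act_a \<otimes>\<^bsub>E\<^esub> act_b \<oplus>\<^bsub>E\<^esub> (1 / 2) \<odot>\<^bsub>E\<^esub> (act_a \<otimes>\<^bsub>E\<^esub> act_a)"
proof -
  interpret End: assoc_alg E by (rule assoc_alg_end)
  have eqI: "S = T" if "S \<in> carrier E" "T \<in> carrier E" "\<And>m k i j. m \<in> QP \<Longrightarrow> S m (k, i, j) = T m (k, i, j)" for S T
  proof
    fix m show "S m = T m"
      using that by (cases "m \<in> QP") (auto simp: end_carrier)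
  qed
  have pw: "(T [^]\<^bsub>E\<^esub> (r::nat)) m = (T ^^ r) m" if "T \<in> carrier E" "m \<in> QP" for T m r
    using end_power that by blast
  note c = End.m_closed End.a_closed End.nat_pow_closed End.minus_closed End.scale_closed End.one_closed act_closed
  have sum: "(\<lambda>x. act_a m x + act_b m x) \<in> QP" if "m \<in> QP" for m using that by (simp add: M_add)
  show "act_g [^]\<^bsub>E\<^esub> n = \<one>\<^bsub>E\<^esub>"
    by (rule eqI; (intro c)?) (simp add: pw act_g_power QP_simps)
  show "act_a \<otimes>\<^bsub>E\<^esub> act_g = act_g \<otimes>\<^bsub>E\<^esub> act_a"
    by (rule eqI; (intro c)?) simp
  show "act_b \<otimes>\<^bsub>E\<^esub> act_g = act_g \<otimes>\<^bsub>E\<^esub> (act_a \<oplus>\<^bsub>E\<^esub> act_b)"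
    by (rule eqI; (intro c)?) (simp add: sum weight_Suc algebra_simps)
  show "act_a [^]\<^bsub>E\<^esub> p = lam \<odot>\<^bsub>E\<^esub> (\<one>\<^bsub>E\<^esub> \<ominus>\<^bsub>E\<^esub> act_g [^]\<^bsub>E\<^esub> p)"
    by (rule eqI; (intro c)?) (simp add: pw end_minus act_g_power act_a_power QP_simps c del: end_simps(2), simp)
  show "act_b [^]\<^bsub>E\<^esub> p = mu \<odot>\<^bsub>E\<^esub> (\<one>\<^bsub>E\<^esub> \<ominus>\<^bsub>E\<^esub> act_g [^]\<^bsub>E\<^esub> p)"
    by (rule eqI; (intro c)?) (simp add: pw end_minus act_g_power act_b_power_p QP_simps c del: end_simps(2), simp)
  show "act_b \<otimes>\<^bsub>E\<^esub> act_a = act_a \<otimes>\<^bsub>E\<^esub> act_b \<oplus>\<^bsub>E\<^esub> (1 / 2) \<odot>\<^bsub>E\<^esub> (act_a \<otimes>\<^bsub>E\<^esub> act_a)"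
    by (rule eqI; (intro c)?) (simp add: weight_Suc algebra_simps)
qed

text \<open>The \<open>k\<close> with \<open>weight k 1 = 0\<close>, so that powers of \<open>b\<close> act as pure shifts at \<open>(k, 0, j)\<close>.\<close>

definition "midpoint = (p - 1) div 2"

lemma weight_midpoint: "weight midpoint (Suc 0) = 0"
proof -
  have "2 * midpoint + 1 = p" unfolding midpoint_def using odd_p by presburger
  then have "2 * weight midpoint (Suc 0) = 0" using p_zero by (simp only: two_weight Suc_eq_plus1 add_0) simp
  then show ?thesis by simp
qed

lemma act_b_power_midpoint: "m \<in> QP \<Longrightarrow> (act_b ^^ r) m (midpoint, 0, j) = m (midpoint, 0, j + r)"
  by (induction r arbitrary: j) (simp_all add: weight_midpoint)

text \<open>The factor \<open>b [^] j\<close> stands leftmost, hence acts last, at a point with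
  \<open>i = 0\<close> and first entry \<open>midpoint\<close>, where it is a pure shift. So a
  single evaluation point recovers all three exponents of the monomial.\<close>

lemma act_monomial:
  fixes i j k :: nat
  assumes "m \<in> QP"
  shows "(act_b [^]\<^bsub>E\<^esub> j \<otimes>\<^bsub>E\<^esub> act_a [^]\<^bsub>E\<^esub> i \<otimes>\<^bsub>E\<^esub> act_g [^]\<^bsub>E\<^esub> k) m (midpoint, 0, 0) = m (midpoint + k, i, j)"
  using assms by (simp add: end_power(1) act_b_power_midpoint act_a_power act_g_power)

section \<open>Dual functions of the reduced monomials\<close>

definition "step c h = (\<lambda>k. c * (h k - h (k + p)))" for c :: 'k and h :: "nat \<Rightarrow> 'k"

text \<open>Extends values on the reduced exponents to a quasi-periodic function. The quotients
  \<open>i div p\<close> and \<open>j div p\<close> count the replacements of \<open>x^p\<close> and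
  \<open>y^p\<close>; each replacement applies \<open>step\<close>, the transpose of multiplication
  by \<open>c (1 - z^p)\<close>.\<close>

definition extend :: "(nat \<Rightarrow> nat \<Rightarrow> nat \<Rightarrow> 'k) \<Rightarrow> nat \<times> nat \<times> nat \<Rightarrow> 'k" where
  "extend f = (\<lambda>(k, i, j). (step lam ^^ (i div p)) ((step mu ^^ (j div p)) (\<lambda>k. f (k mod n) (i mod p) (j mod p))) k)"

lemma extend_QP: "extend f \<in> QP"
proof -
  have per: "(step c ^^ r) h (k + n) = (step c ^^ r) h k" if "\<And>k. h (k + n) = h k" for c r h k
  proof (induction r arbitrary: k)
    case (Suc r)
    show ?case using Suc[of k] Suc[of "k + p"] by (simp add: step_def add_ac)
  qed (simp add: that)
  \<comment> \<open>For an overflow in \<open>j\<close> the additional \<open>step mu\<close> sits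
    inside the iterated \<open>step lam\<close> and has to be moved outside.\<close>
  have "step mu (step lam h) = step lam (step mu h)" for h
    by (simp add: step_def algebra_simps fun_eq_iff)
  then have comm: "step mu ((step lam ^^ r) h) = (step lam ^^ r) (step mu h)" for r h
    by (induction r) simp_all
  have p: "p > 0" using p_gt_2 by simp
  have "extend f (k + n, i, j) = extend f (k, i, j)" for k i j
    unfolding extend_def prod.case by (intro per) simp
  moreover have "extend f (k, i + p, j) = lam * (extend f (k, i, j) - extend f (k + p, i, j))" for k i j
    using p by (simp add: extend_def step_def)
  moreover have "extend f (k, i, j + p) = mu * (extend f (k, i, j) - extend f (k + p, i, j))" for k i j
    using p by (simp add: extend_def comm[symmetric]) (simp add: step_def)
  ultimately show ?thesis by (simp add: quasi_periodic_def)
qed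

text \<open>The first exponent is displaced by \<open>midpoint\<close> because the monomials are
  evaluated at a point with that first entry, see \<open>act_monomial\<close>. The index triple is
  ordered as in a monomial, the argument as in a function on exponents.\<close>

definition dual :: "nat \<times> nat \<times> nat \<Rightarrow> nat \<times> nat \<times> nat \<Rightarrow> 'k" where
  "dual = (\<lambda>(j', i', k'). extend (\<lambda>k i j. if k = (midpoint + k') mod n \<and> i = i' \<and> j = j' then 1 else 0))"

lemma dual_box:
  assumes "i < p" "j < p" "k < n" "k' < n"
  shows "dual (j', i', k') (midpoint + k, i, j) = (if (j', i', k') = (j, i, k) then 1 else 0)"
proof -
  have *: "k1 = k2" if "(midpoint + k1) mod n = (midpoint + k2) mod n" "k1 \<le> k2" "k2 < n" for k1 k2
  proof -
    have "n dvd (midpoint + k2) - (midpoint + k1)"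
      using that mod_eq_dvd_iff_nat[of "midpoint + k1" "midpoint + k2" n] by simp
    then have "n dvd k2 - k1" by simp
    with that(2,3) show ?thesis by (metis dvd_imp_le le_add_diff_inverse less_imp_diff_less linorder_not_le
      neq0_conv add_0_right)
  qed
  have "(midpoint + k) mod n = (midpoint + k') mod n \<longleftrightarrow> k = k'"
    using *[of k k'] *[of k' k] assms by (metis nat_le_linear)
  then show ?thesis using assms by (auto simp: dual_def extend_def)
qed

end

section \<open>The monomial basis\<close>

lemma (in assoc_alg) minus_scale_mult:
  assumes "x \<in> carrier A" "y \<in> carrier A" "z \<in> carrier A"
  shows "x \<otimes> (c \<odot> (y \<ominus> z)) = c \<odot> (x \<otimes> y \<ominus> x \<otimes> z)" "(c \<odot> (y \<ominus> z)) \<otimes> x = c \<odot> (y \<otimes> x \<ominus> z \<otimes> x)"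
  using assms by (simp_all add: a_minus_def minus_eq_scale l_distr r_distr scale_mult_left scale_mult_right)

lemma (in assoc_alg) mult_power_self:
  assumes "x \<in> carrier A" "y \<in> carrier A"
  shows "x \<otimes> (x [^] (t::nat) \<otimes> y) = x [^] t \<otimes> (x \<otimes> y)"
  using assms nat_pow_Suc2[of x t] by (simp add: m_assoc[symmetric])

locale lifting_algebra = rel_alg H p n lam mu a b g
  for H :: "('k::field, 'v, 'm) module_scheme" (structure) and p n lam mu a b g +
  assumes presented: "presented_by H (case_gens a b g) (relators p n lam mu)"
begin

text \<open>In this order right multiplication by \<open>g\<close> or \<open>a\<close> only raises
  an exponent, and \<open>b\<close> stands where \<open>act_monomial\<close> needs it. All exponents
  are allowed; \<open>idx\<close> selects the reduced ones.\<close>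

definition mon :: "nat \<times> nat \<times> nat \<Rightarrow> 'v" where
  "mon = (\<lambda>(j, i, k). b [^] j \<otimes> a [^] i \<otimes> g [^] k)"

definition idx :: "(nat \<times> nat \<times> nat) set" where
  "idx = {..<p} \<times> {..<p} \<times> {..<n}"

fun deg :: "nat \<times> nat \<times> nat \<Rightarrow> nat" where
  "deg (j, i, k) = j + i"

lemma finite_idx [simp]: "finite idx"
  by (simp add: idx_def)

lemma card_idx: "card idx = p\<^sup>2 * n"
  by (simp add: idx_def power2_eq_square)

lemma mon_closed [simp]: "mon v \<in> carrier H"
  by (cases v) (simp add: mon_def)

lemma mon_one: "mon (0, 0, 0) = \<one>"
  by (simp add: mon_def)

lemma mon_mod: "mon (j, i, k mod n) = mon (j, i, k)"
  by (simp add: mon_def g_mod)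

lemma mon_overflow_a: "mon (j, i + p, k) = lam \<odot> (mon (j, i, k) \<ominus> mon (j, i, k + p))"
proof -
  have "mon (j, i + p, k) = b [^] j \<otimes> a [^] i \<otimes> (a [^] p \<otimes> g [^] k)"
    by (simp add: mon_def nat_pow_mult[symmetric] m_assoc)
  also have "a [^] p \<otimes> g [^] k = lam \<odot> (g [^] k \<ominus> g [^] (k + p))"
    by (simp add: a_pow_p minus_scale_mult nat_pow_mult add.commute)
  finally show ?thesis by (simp add: minus_scale_mult mon_def)
qed

lemma mon_overflow_b: "mon (j + p, i, k) = mu \<odot> (mon (j, i, k) \<ominus> mon (j, i, k + p))"
proof -
  have "mon (j + p, i, k) = b [^] j \<otimes> (b [^] p \<otimes> (a [^] i \<otimes> g [^] k))"
    by (simp add: mon_def nat_pow_mult[symmetric] m_assoc)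
  also have "b [^] p \<otimes> (a [^] i \<otimes> g [^] k) = mu \<odot> (a [^] i \<otimes> g [^] k \<ominus> g [^] p \<otimes> a [^] i \<otimes> g [^] k)"
    by (simp add: b_pow_p minus_scale_mult m_assoc)
  also have "g [^] p \<otimes> a [^] i \<otimes> g [^] k = a [^] i \<otimes> g [^] (k + p)"
    by (simp add: a_power_g_power[symmetric] m_assoc nat_pow_mult add.commute)
  finally show ?thesis by (simp add: minus_scale_mult mon_def m_assoc)
qed

lemma mon_g: "mon (j, i, k) \<otimes> g = mon (j, i, Suc k)"
  by (simp add: mon_def m_assoc)

lemma mon_a: "mon (j, i, k) \<otimes> a = mon (j, Suc i, k)"
  using a_power_g_power[of 1 k] by (simp add: mon_def m_assoc)

text \<open>Moving \<open>b\<close> to the left past \<open>g [^] k\<close> and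
  \<open>a [^] i\<close> changes its slope by \<open>- k\<close> and by \<open>- i / 2\<close>. The
  coefficients involve neither \<open>lam\<close> nor \<open>mu\<close>, so the formula is the same
  in the graded case.\<close>

lemma mon_b: "mon (j, i, k) \<otimes> b = mon (Suc j, i, k) \<oplus> (- (of_nat k + of_nat i / 2)) \<odot> mon (j, Suc i, k)"
proof -
  let ?c = "- of_nat k - of_nat i / 2 :: 'k"
  have "g [^] k \<otimes> b = slope (- of_nat k) \<otimes> g [^] k"
    by (simp add: slope_g_power slope_0)
  then have "mon (j, i, k) \<otimes> b = b [^] j \<otimes> (a [^] i \<otimes> slope (- of_nat k)) \<otimes> g [^] k"
    by (simp add: mon_def m_assoc)
  also have "a [^] i \<otimes> slope (- of_nat k) = slope ?c \<otimes> a [^] i"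
    by (simp add: slope_a_power)
  also have "b [^] j \<otimes> (slope ?c \<otimes> a [^] i) \<otimes> g [^] k = mon (Suc j, i, k) \<oplus> ?c \<odot> mon (j, Suc i, k)"
    by (simp add: slope_def mon_def l_distr r_distr scale_mult_left scale_mult_right m_assoc[symmetric])
      (simp add: m_assoc mult_power_self)
  finally show ?thesis by (simp add: algebra_simps)
qed

text \<open>An exponent \<open>\<ge> p\<close> is reduced by the relation for the
  \<open>p\<close>-th power, which lowers the degree by \<open>p\<close>; strong induction on the
  degree finishes. It serves both the span of all reduced monomials and the filtration by
  degree.\<close>

lemma mon_mem:
  assumes W: "subspace_of W H" and mem: "\<And>v. v \<in> idx \<Longrightarrow> deg v \<le> m \<Longrightarrow> mon v \<in> W" and "j + i \<le> m"
  shows "mon (j, i, k) \<in> W"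
  using assms(3)
proof (induction "j + i" arbitrary: j i k rule: less_induct)
  case less
  note sub = subspaceD[OF W]
  have minus: "c \<odot> (x \<ominus> y) \<in> W" if "x \<in> W" "y \<in> W" for c x y
  proof -
    have "y \<in> carrier H" using sub(1) that by auto
    then show ?thesis using that by (simp add: a_minus_def minus_eq_scale sub)
  qed
  consider "i \<ge> p" | "j \<ge> p" | "i < p" "j < p" by linarith
  then show ?case
  proof cases
    case 1
    then obtain i' where "i = i' + p" by (metis le_add_diff_inverse2)
    moreover have "mon (j, i', k') \<in> W" for k'
      by (rule less) (use calculation p_gt_2 less in auto)
    ultimately show ?thesis by (simp add: mon_overflow_a minus)
  next
    case 2
    then obtain j' where "j = j' + p" by (metis le_add_diff_inverse2)
    moreover have "mon (j', i, k') \<in> W" for k'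
      by (rule less) (use calculation p_gt_2 less in auto)
    ultimately show ?thesis by (simp add: mon_overflow_b minus)
  next
    case 3
    then have "(j, i, k mod n) \<in> idx" using n_pos by (simp add: idx_def)
    then have "mon (j, i, k mod n) \<in> W" using mem less.prems by simp
    then show ?thesis by (simp add: mon_mod)
  qed
qed

text \<open>The span of the reduced monomials contains \<open>\<one>\<close> and is stable under
  right multiplication by the generators, hence by all of \<open>H\<close>. With an arbitrary
  subspace \<open>W\<close> it is a principle for extending linear identities from
  monomials.\<close>

lemma span_mon:
  assumes W: "subspace_of W H" and mem: "\<And>v. v \<in> idx \<Longrightarrow> mon v \<in> W"
  shows "W = carrier H"
proof
  note sub = subspaceD[OF W]
  show "W \<subseteq> carrier H" by (rule sub)
  let ?L = "lin_span H (mon ` idx)"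
  have L: "subspace_of ?L H" by (rule span_subspace) auto
  note subL = subspaceD[OF L]
  have mL: "mon (j, i, k) \<in> ?L" for j i k
    by (rule mon_mem[OF L _ le_refl]) (use span_superset[of "mon ` idx"] in \<open>simp add: image_subset_iff\<close>)
  have gen: "x \<otimes> case_gens a b g y \<in> ?L" if "x \<in> ?L" for x y
  proof -
    let ?P = "{x \<in> carrier H. x \<otimes> case_gens a b g y \<in> ?L}"
    have y: "case_gens a b g y \<in> carrier H" by (cases y) simp_all
    have "linear_map H H (\<lambda>x. x \<otimes> case_gens a b g y)"
      using y by (intro linear_mapI) (simp_all add: l_distr scale_mult_left)
    from linear_map_preimage[OF vspace_axioms vspace_axioms this L] have "subspace_of ?P H" .
    moreover have "mon ` idx \<subseteq> ?P"
      by (cases y) (auto simp: mon_a mon_b mon_g mL intro!: subL)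
    ultimately have "?L \<subseteq> ?P" by (rule span_minimal)
    with that show ?thesis by auto
  qed
  have mult: "\<forall>w\<in>?L. w \<otimes> x \<in> ?L" if "x \<in> carrier H" for x
    using presented that
  proof (induction x rule: presented_induct)
    case (add x y)
    then show ?case using subL by (auto simp: r_distr subset_iff)
  next
    case (mult x y)
    then show ?case using subL(1) by (auto simp: m_assoc[symmetric] subset_iff)
  qed (use gen subL in \<open>auto simp: scale_mult_right subset_iff\<close>)
  have "x \<in> ?L" if "x \<in> carrier H" for x
    using mult[OF that] mL[of 0 0 0] that by (force simp: mon_one)
  moreover have "?L \<subseteq> W" by (rule span_minimal[OF W]) (use mem in auto)
  ultimately show "carrier H \<subseteq> W" by auto
qed

section \<open>Coordinate functionals and the dimension\<close>

lemma relators_zero: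
  assumes "rel_alg A p n lam mu a' b' g'" "r \<in> relators p n lam mu"
  shows "free_eval A (case_gens a' b' g') r = \<zero>\<^bsub>A\<^esub>"
proof -
  interpret A: rel_alg A p n lam mu a' b' g' by fact
  have c: "case_gens a' b' g' x \<in> carrier A" for x by (cases x) simp_all
  have "\<forall>r\<in>relators p n lam mu. free_eval A (case_gens a' b' g') r = \<zero>\<^bsub>A\<^esub>"
    by (subst relators_hom_iff[OF A.assoc_alg_axioms A.free_eval_hom n_pos, where a = a' and b = b' and g = g'])
      (use A.g_pow_n A.a_g A.b_g A.a_pow_p A.b_pow_p A.b_a in \<open>simp_all add: c A.free_eval_var\<close>)
  with assms(2) show ?thesis by blast
qed

lemma hom_exists:
  assumes "rel_alg A p n lam mu a' b' g'"
  obtains \<phi> where "algebra_hom H A \<phi>" "\<phi> a = a'" "\<phi> b = b'" "\<phi> g = g'"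
proof -
  interpret A: rel_alg A p n lam mu a' b' g' by fact
  have c: "case_gens a' b' g' x \<in> carrier A" for x by (cases x) simp_all
  obtain \<phi> where \<phi>: "algebra_hom H A \<phi>" "\<And>x. \<phi> (case_gens a b g x) = case_gens a' b' g' x"
    using presented_hom_exists[OF presented assoc_alg_axioms A.assoc_alg_axioms c relators_zero[OF assms]] by blast
  show ?thesis
    using that[OF \<phi>(1)] \<phi>(2)[of GenA] \<phi>(2)[of GenB] \<phi>(2)[of GenG] by simp
qed

definition is_coord :: "(nat \<times> nat \<times> nat \<Rightarrow> 'v \<Rightarrow> 'k) \<Rightarrow> bool" where
  "is_coord \<kappa> \<longleftrightarrow> (\<forall>v. linear_map H ground (\<kappa> v)) \<and>
     (\<forall>u\<in>idx. \<forall>v. \<kappa> v (mon u) = (if v = u then 1 else 0))"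

text \<open>This is the linear independence of the reduced monomials. Let \<open>x\<close> act on
  the dual function of \<open>v\<close> and evaluate at \<open>(midpoint, 0, 0)\<close>: by
  \<open>act_monomial\<close> and \<open>dual_box\<close>, this linear functional is 1 at
  \<open>mon v\<close> and 0 at the other reduced monomials.\<close>

lemma coord_exists: "\<exists>\<kappa>. is_coord \<kappa>"
proof -
  interpret Q: quasi_periodic_functions p n lam mu ..
  let ?E = "end_algebra Q.quasi_periodic"
  have "rel_alg ?E p n lam mu Q.act_a Q.act_b Q.act_g"
    by (intro rel_alg.intro Q.assoc_alg_end parameters_axioms rel_alg_axioms.intro Q.act_closed Q.act_relations)
  then obtain \<rho> where \<rho>: "algebra_hom H ?E \<rho>" "\<rho> a = Q.act_a" "\<rho> b = Q.act_b" "\<rho> g = Q.act_g"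
    by (rule hom_exists)
  note h = algebra_homD[OF \<rho>(1)] and hp = algebra_hom_power[OF assoc_alg_axioms Q.assoc_alg_end \<rho>(1)]
  \<comment> \<open>Outside \<open>idx\<close> the functional is set to zero: \<open>dual\<close>
    reduces its last index modulo \<open>n\<close>, so such an index could otherwise imitate a
    reduced one.\<close>
  define \<kappa> where "\<kappa> v x = (if v \<in> idx then \<rho> x (Q.dual v) (Q.midpoint, 0, 0) else 0)" for v x
  have "Q.dual v \<in> Q.quasi_periodic" for v by (cases v) (simp add: Q.dual_def Q.extend_QP)
  moreover have "\<rho> (mon (j, i, k)) =
      Q.act_b [^]\<^bsub>?E\<^esub> j \<otimes>\<^bsub>?E\<^esub> Q.act_a [^]\<^bsub>?E\<^esub> i \<otimes>\<^bsub>?E\<^esub> Q.act_g [^]\<^bsub>?E\<^esub> k" for j i k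
    by (simp add: mon_def h(4) hp \<rho> del: Q.end_simps)
  ultimately have "\<kappa> v (mon (j, i, k)) = (if v \<in> idx then Q.dual v (Q.midpoint + k, i, j) else 0)" for v j i k
    by (simp add: \<kappa>_def Q.act_monomial del: Q.end_simps)
  then have "\<kappa> v (mon u) = (if v = u then 1 else 0)" if "u \<in> idx" for u v
    using that Q.dual_box by (cases u; cases v) (auto simp: idx_def)
  moreover have "linear_map H ground (\<kappa> v)" for v
    by (rule linear_mapI) (simp_all add: \<kappa>_def h(3,5))
  ultimately show ?thesis unfolding is_coord_def by blast
qed

definition coord :: "nat \<times> nat \<times> nat \<Rightarrow> 'v \<Rightarrow> 'k" where
  "coord = (SOME \<kappa>. is_coord \<kappa>)"

lemma coord_linear: "linear_map H ground (coord v)"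
  and coord_mono: "u \<in> idx \<Longrightarrow> coord v (mon u) = (if v = u then 1 else 0)"
proof -
  have "is_coord coord" unfolding coord_def by (rule someI_ex[OF coord_exists])
  then show "linear_map H ground (coord v)" "u \<in> idx \<Longrightarrow> coord v (mon u) = (if v = u then 1 else 0)"
    unfolding is_coord_def by blast+
qed

lemmas coord_simps = linear_mapD(2,3)[OF coord_linear, unfolded ground_simps]

lemma coord_zero [simp]: "coord v \<zero> = 0"
  using linear_map_zero[OF vspace_axioms vspace_ground coord_linear] by simp

lemma coord_sum: "(\<And>i. i \<in> A \<Longrightarrow> f i \<in> carrier H) \<Longrightarrow> coord v (\<Oplus>i\<in>A. f i) = (\<Sum>i\<in>A. coord v (f i))"
  using linear_map_sum[OF vspace_axioms vspace_ground coord_linear, of A f v] by (simp add: finsum_ground)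

lemma coord_combination:
  assumes "u \<in> idx"
  shows "coord u (\<Oplus>v\<in>idx. c v \<odot> mon v) = c u"
proof -
  have "coord u (\<Oplus>v\<in>idx. c v \<odot> mon v) = (\<Sum>v\<in>idx. if u = v then c v else 0)"
  proof (subst coord_sum)
    show "(\<Sum>v\<in>idx. coord u (c v \<odot> mon v)) = (\<Sum>v\<in>idx. if u = v then c v else 0)"
      by (rule sum.cong) (simp_all add: coord_simps coord_mono)
  qed simp
  then show ?thesis using assms by simp
qed

text \<open>The elements with this expansion form a subspace that contains the reduced monomials,
  hence everything by \<open>span_mon\<close>.\<close>

lemma expand: "x \<in> carrier H \<Longrightarrow> x = (\<Oplus>v\<in>idx. coord v x \<odot> mon v)"
proof -
  let ?W = "{x \<in> carrier H. x = (\<Oplus>v\<in>idx. coord v x \<odot> mon v)}"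
  have "subspace_of ?W H"
  proof (rule subspaceI)
    fix x y assume xy: "x \<in> ?W" "y \<in> ?W"
    then have x: "x \<in> carrier H" "(\<Oplus>v\<in>idx. coord v x \<odot> mon v) = x"
      and y: "y \<in> carrier H" "(\<Oplus>v\<in>idx. coord v y \<odot> mon v) = y"
      unfolding mem_Collect_eq by (blast intro: sym)+
    have "(\<Oplus>v\<in>idx. coord v (x \<oplus> y) \<odot> mon v) = (\<Oplus>v\<in>idx. coord v x \<odot> mon v \<oplus> coord v y \<odot> mon v)"
      by (rule finsum_cong') (use x y in \<open>auto simp: coord_simps scale_add_left\<close>)
    also have "\<dots> = (\<Oplus>v\<in>idx. coord v x \<odot> mon v) \<oplus> (\<Oplus>v\<in>idx. coord v y \<odot> mon v)"
      by (rule finsum_addf) auto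
    finally show "x \<oplus> y \<in> ?W" using x y by simp
  next
    fix c x assume "x \<in> ?W"
    then have x: "x \<in> carrier H" "(\<Oplus>v\<in>idx. coord v x \<odot> mon v) = x"
      unfolding mem_Collect_eq by (blast intro: sym)+
    have "(\<Oplus>v\<in>idx. coord v (c \<odot> x) \<odot> mon v) = (\<Oplus>v\<in>idx. c \<odot> (coord v x \<odot> mon v))"
      by (rule finsum_cong') (use x in \<open>auto simp: coord_simps\<close>)
    also have "\<dots> = c \<odot> (\<Oplus>v\<in>idx. coord v x \<odot> mon v)"
      by (rule scale_sum[symmetric]) auto
    finally show "c \<odot> x \<in> ?W" using x by simp
  qed auto
  moreover have "mon v \<in> ?W" if "v \<in> idx" for v
  proof -
    have "(\<Oplus>u\<in>idx. coord u (mon v) \<odot> mon u) = coord v (mon v) \<odot> mon v"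
      by (rule sum_single) (use that in \<open>auto simp: coord_mono\<close>)
    then show ?thesis using that by (simp add: coord_mono)
  qed
  ultimately have "?W = carrier H" by (rule span_mon)
  then show "x \<in> carrier H \<Longrightarrow> x = (\<Oplus>v\<in>idx. coord v x \<odot> mon v)" by blast
qed

lemma coord_eqI:
  assumes "x \<in> carrier H" "y \<in> carrier H" "\<And>v. v \<in> idx \<Longrightarrow> coord v x = coord v y"
  shows "x = y"
proof -
  have "x = (\<Oplus>v\<in>idx. coord v x \<odot> mon v)" by (rule expand) fact
  also have "\<dots> = (\<Oplus>v\<in>idx. coord v y \<odot> mon v)"
    by (rule finsum_cong') (use assms in auto)
  also have "\<dots> = y" by (rule expand[symmetric]) fact
  finally show ?thesis .
qed

lemma has_dim_idx: "has_dim H (p\<^sup>2 * n)"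
proof -
  obtain e where e: "bij_betw e {..<p\<^sup>2 * n} idx"
    using ex_bij_betw_nat_finite[OF finite_idx] by (auto simp: card_idx atLeast0LessThan)
  let ?N = "{..<p\<^sup>2 * n}"
  have re: "(\<Oplus>i\<in>?N. c (e i) \<odot> mon (e i)) = (\<Oplus>v\<in>idx. c v \<odot> mon v)" for c
    using finsum_reindex[of "\<lambda>v. c v \<odot> mon v" e ?N] e by (auto simp: bij_betw_def)
  define e' where "e' = the_inv_into ?N e"
  have e': "e' (e i) = i" if "i \<in> ?N" for i
    using that e by (auto simp: e'_def bij_betw_def the_inv_into_f_f)
  have rec: "c i = coord (e i) (\<Oplus>i\<in>?N. c i \<odot> mon (e i))" if "i \<in> ?N" for c i
  proof -
    have "(\<Oplus>i\<in>?N. c i \<odot> mon (e i)) = (\<Oplus>i\<in>?N. c (e' (e i)) \<odot> mon (e i))"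
      by (rule finsum_cong') (auto simp: e')
    also have "\<dots> = (\<Oplus>v\<in>idx. c (e' v) \<odot> mon v)" by (rule re)
    finally show ?thesis
      using coord_combination[of "e i" "\<lambda>v. c (e' v)"] that bij_betw_apply[OF e that] e'[OF that] by simp
  qed
  show ?thesis unfolding has_dim_def
  proof (intro exI[of _ "\<lambda>i. mon (e i)"] conjI allI impI ballI mon_closed)
    fix x assume x: "x \<in> carrier H"
    show "\<exists>!c. c \<in> ?N \<rightarrow>\<^sub>E UNIV \<and> x = (\<Oplus>i\<in>?N. c i \<odot> mon (e i))"
    proof (rule ex1I[of _ "restrict (\<lambda>i. coord (e i) x) ?N"])
      have "(\<Oplus>i\<in>?N. restrict (\<lambda>i. coord (e i) x) ?N i \<odot> mon (e i)) = (\<Oplus>i\<in>?N. coord (e i) x \<odot> mon (e i))"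
        by (rule finsum_cong') auto
      also have "\<dots> = x" unfolding re[of "\<lambda>v. coord v x"] by (rule expand[OF x, symmetric])
      finally show "restrict (\<lambda>i. coord (e i) x) ?N \<in> ?N \<rightarrow>\<^sub>E UNIV \<and>
          x = (\<Oplus>i\<in>?N. restrict (\<lambda>i. coord (e i) x) ?N i \<odot> mon (e i))"
        by (intro conjI) (simp, rule sym)
    next
      fix c assume c: "c \<in> ?N \<rightarrow>\<^sub>E UNIV \<and> x = (\<Oplus>i\<in>?N. c i \<odot> mon (e i))"
      show "c = restrict (\<lambda>i. coord (e i) x) ?N"
      proof
        fix i show "c i = restrict (\<lambda>i. coord (e i) x) ?N i"
        proof (cases "i \<in> ?N")
          case True
          from rec[OF this, of c] show ?thesis
            unfolding conjunct2[OF c, symmetric] using True by simp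
        qed (use PiE_arb[OF conjunct1[OF c]] in simp)
      qed
    qed
  qed
qed

end

section \<open>Comultiplication, counit and antipode\<close>

lemma (in assoc_alg) mult_power_mult:
  fixes t :: nat
  assumes "x \<in> carrier A" "y \<in> carrier A"
  shows "x \<otimes> (x [^] t \<otimes> y) = x [^] Suc t \<otimes> y"
proof -
  have "x \<otimes> (x [^] t \<otimes> y) = (x \<otimes> x [^] t) \<otimes> y"
    by (rule m_assoc[symmetric]) (use assms in auto)
  then show ?thesis by (simp only: nat_pow_Suc2[OF assms(1)])
qed

text \<open>A noncommutative binomial theorem: \<open>w j t\<close> collects the words with
  \<open>t\<close> letters \<open>y\<close> in \<open>(x \<oplus> y) [^] j\<close>, and splitting
  off the leftmost letter is the Pascal recursion that is assumed.\<close>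

lemma (in assoc_alg) power_sum_expand:
  assumes "x \<in> carrier A" "y \<in> carrier A" and w: "\<And>j t. w j t \<in> carrier A"
    and "w 0 0 = \<one>" "\<And>j. w j (Suc j) = \<zero>" "\<And>j. w (Suc j) 0 = x \<otimes> w j 0"
    "\<And>j t. t \<le> j \<Longrightarrow> w (Suc j) (Suc t) = x \<otimes> w j (Suc t) \<oplus> y \<otimes> w j t"
  shows "(x \<oplus> y) [^] j = (\<Oplus>t\<in>{..j}. w j t)"
proof (induction j)
  case 0
  show ?case using w[of 0 0] assms(4) by simp
next
  case (Suc j)
  have "(\<Oplus>t\<in>{..Suc j}. w (Suc j) t) = (\<Oplus>t\<in>{..j}. w (Suc j) (Suc t)) \<oplus> w (Suc j) 0"
    by (rule finsum_Suc2) (use w in auto)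
  also have "(\<Oplus>t\<in>{..j}. w (Suc j) (Suc t)) = (\<Oplus>t\<in>{..j}. x \<otimes> w j (Suc t) \<oplus> y \<otimes> w j t)"
    by (rule finsum_cong') (use assms in auto)
  also have "\<dots> = (\<Oplus>t\<in>{..j}. x \<otimes> w j (Suc t)) \<oplus> (\<Oplus>t\<in>{..j}. y \<otimes> w j t)"
    by (rule finsum_addf) (use assms in auto)
  also have "(\<Oplus>t\<in>{..j}. x \<otimes> w j (Suc t)) = x \<otimes> (\<Oplus>t\<in>{..j}. w j (Suc t))"
    by (rule finsum_rdistr[symmetric]) (use assms in auto)
  also have "(\<Oplus>t\<in>{..j}. y \<otimes> w j t) = y \<otimes> (\<Oplus>t\<in>{..j}. w j t)"
    by (rule finsum_rdistr[symmetric]) (use assms in auto)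
  finally have 1: "(\<Oplus>t\<in>{..Suc j}. w (Suc j) t)
      = x \<otimes> ((\<Oplus>t\<in>{..j}. w j (Suc t)) \<oplus> w j 0) \<oplus> y \<otimes> (\<Oplus>t\<in>{..j}. w j t)"
    using assms by (simp add: r_distr a_ac)
  have "(\<Oplus>t\<in>{..j}. w j (Suc t)) \<oplus> w j 0 = (\<Oplus>t\<in>{..Suc j}. w j t)"
    by (rule finsum_Suc2[symmetric]) (use w in auto)
  also have "\<dots> = (\<Oplus>t\<in>{..j}. w j t)"
    using w assms(5) by (simp add: finsum_Suc)
  finally have "(\<Oplus>t\<in>{..Suc j}. w (Suc j) t) = (x \<oplus> y) \<otimes> (\<Oplus>t\<in>{..j}. w j t)"
    using 1 assms by (simp add: l_distr)
  moreover have "(x \<oplus> y) [^] Suc j = (x \<oplus> y) \<otimes> (x \<oplus> y) [^] j"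
    by (rule nat_pow_Suc2) (simp add: assms)
  ultimately show ?case by (simp only: Suc.IH)
qed

text \<open>The antipode reverses products, so it is obtained as a homomorphism into the opposite
  algebra.\<close>

definition op_alg :: "('k::field, 'v, 'm) module_scheme \<Rightarrow> ('k, 'v, 'm) module_scheme" where
  "op_alg A = A\<lparr>monoid.mult := \<lambda>x y. y \<otimes>\<^bsub>A\<^esub> x\<rparr>"

lemma op_simps [simp]:
  "carrier (op_alg A) = carrier A" "x \<otimes>\<^bsub>op_alg A\<^esub> y = y \<otimes>\<^bsub>A\<^esub> x" "one (op_alg A) = one A"
  "zero (op_alg A) = zero A" "add (op_alg A) = add A" "smult (op_alg A) = smult A"
  by (simp_all add: op_alg_def)

lemma (in assoc_alg) assoc_alg_op: "assoc_alg (op_alg A)"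
proof -
  have ag: "abelian_group (op_alg A)"
  proof (rule abelian_groupI)
    fix x assume "x \<in> carrier (op_alg A)"
    then show "\<exists>y\<in>carrier (op_alg A). y \<oplus>\<^bsub>op_alg A\<^esub> x = \<zero>\<^bsub>op_alg A\<^esub>"
      by (intro bexI[of _ "\<ominus> x"]) (simp_all add: l_neg)
  qed (simp_all add: a_ac)
  have "ring (op_alg A)"
    by (rule ringI[OF ag]) ((rule monoidI)?; simp add: m_assoc l_distr r_distr)+
  moreover have "vspace (op_alg A)" unfolding vspace_def
    by (rule moduleI[OF cring_ground ag]) (simp_all add: scale_add_left scale_add_right)
  ultimately show ?thesis
    unfolding assoc_alg_def assoc_alg_axioms_def by (simp add: scale_mult_left scale_mult_right)
qed

lemma (in assoc_alg) op_power: "x \<in> carrier A \<Longrightarrow> x [^]\<^bsub>op_alg A\<^esub> (m::nat) = x [^] m"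
proof -
  interpret O: assoc_alg "op_alg A" by (rule assoc_alg_op)
  assume x: "x \<in> carrier A"
  show ?thesis
  proof (induction m)
    case (Suc m)
    have "x [^]\<^bsub>op_alg A\<^esub> Suc m = x \<otimes> x [^]\<^bsub>op_alg A\<^esub> m" by simp
    also have "\<dots> = x [^] Suc m" unfolding Suc.IH by (rule nat_pow_Suc2[OF x, symmetric])
    finally show ?case .
  qed simp
qed

section \<open>Powers of the coproducts of \<open>a\<close> and \<open>b\<close>\<close>

context rel_alg
begin

definition coeff_b :: "nat \<Rightarrow> nat \<Rightarrow> 'v" where
  "coeff_b j t = of_nat (j choose t) \<odot> (g [^] t \<otimes> slope (of_nat t / 2) [^] (j - t))"

definition coeff_a :: "nat \<Rightarrow> nat \<Rightarrow> 'v" where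
  "coeff_a i s = of_nat (i choose s) \<odot> (g [^] s \<otimes> a [^] (i - s))"

lemma coeff_closed [simp]: "coeff_b j t \<in> carrier A" "coeff_a i s \<in> carrier A"
  by (simp_all add: coeff_b_def coeff_a_def)

text \<open>In the rule for \<open>coeff_b\<close>, let \<open>b\<close> pass
  \<open>g [^] Suc t\<close> and apply \<open>slope_power_shift\<close> to the other summand. Then
  all terms end in the same power of \<open>slope (of_nat (Suc t) / 2)\<close>, and only the linear
  factors in front differ. Their coefficients of \<open>b\<close> agree by the Pascal rule, those of
  \<open>a\<close> by the absorption identity for binomial coefficients.\<close>

lemma coeff_rec:
  assumes "t \<le> j"
  shows "coeff_b (Suc j) (Suc t) = b \<otimes> coeff_b j (Suc t) \<oplus> g \<otimes> coeff_b j t"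
    and "coeff_a (Suc j) (Suc t) = a \<otimes> coeff_a j (Suc t) \<oplus> g \<otimes> coeff_a j t"
proof -
  consider "t = j" | "t < j" using assms by linarith
  then show "coeff_b (Suc j) (Suc t) = b \<otimes> coeff_b j (Suc t) \<oplus> g \<otimes> coeff_b j t"
  proof cases
    case 1
    then show ?thesis by (simp add: coeff_b_def binomial_eq_0 nat_pow_Suc2[symmetric] del: nat_pow_Suc Group.nat_pow_Suc)
  next
    case 2
    define m where "m = j - Suc t"
    have m: "j - Suc t = m" "j - t = Suc m" using 2 by (auto simp: m_def)
    let ?c = "of_nat (Suc t) / 2 :: 'k" and ?P = "slope (of_nat (Suc t) / 2) [^] m"
    let ?A = "of_nat (j choose Suc t) :: 'k" and ?B = "of_nat (j choose t) :: 'k"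
    have b1: "b \<otimes> (g [^] Suc t \<otimes> ?P) = g [^] Suc t \<otimes> (slope (of_nat (Suc t)) \<otimes> ?P)"
      using slope_g_power[of 0 "Suc t"] by (simp add: slope_0 m_assoc[symmetric] del: nat_pow_Suc Group.nat_pow_Suc of_nat_Suc)
    \<comment> \<open>In this form \<open>slope_power_shift\<close> applies and leaves the common
      factor \<open>?P\<close>.\<close>
    have "slope (of_nat t / 2) = slope (?c - 1 / 2)" by (simp add: add_divide_distrib)
    then have b2: "g \<otimes> (g [^] t \<otimes> slope (of_nat t / 2) [^] Suc m)
        = g [^] Suc t \<otimes> (slope (?c - of_nat (Suc m) / 2) \<otimes> ?P)"
      unfolding \<open>slope (of_nat t / 2) = slope (?c - 1 / 2)\<close> slope_power_shift
      by (intro mult_power_mult) auto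
    have "Suc t * (j choose Suc t) = Suc m * (j choose t)"
      using binomial_absorption[of t j] binomial_absorb_comp[of j t] m by simp
    then have "(of_nat (Suc t) * ?A :: 'k) = of_nat (Suc m) * ?B" by (metis of_nat_mult)
    then have c: "?A * of_nat (Suc t) + ?B * (?c - of_nat (Suc m) / 2) = (?B + ?A) * ?c"
    proof -
      \<comment> \<open>The comparison of the coefficients of \<open>a\<close>, with
        \<open>\<tau>\<close> for \<open>Suc t\<close>, \<open>\<sigma>\<close> for
        \<open>Suc m\<close>, and \<open>x\<close>, \<open>y\<close> for the binomial coefficients
        \<open>?A\<close> and \<open>?B\<close>; the premise is the absorption identity.\<close>
      have *: "x * \<tau> + y * (\<tau> / 2 - \<sigma> / 2) = (y + x) * (\<tau> / 2)" if "\<tau> * x = \<sigma> * y" for x y \<tau> \<sigma> :: 'k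
      proof -
        have "x * \<tau> + y * (\<tau> / 2 - \<sigma> / 2) = (2 * (x * \<tau>) + y * \<tau> - \<sigma> * y) / 2" by (simp add: field_simps)
        also have "\<dots> = (y + x) * (\<tau> / 2)" unfolding that[symmetric] by (simp add: field_simps)
        finally show ?thesis .
      qed
      show ?thesis by (rule *) fact
    qed
    have "?A \<odot> slope (of_nat (Suc t)) \<oplus> ?B \<odot> slope (?c - of_nat (Suc m) / 2) =
        (?B + ?A) \<odot> b \<oplus> (?A * of_nat (Suc t) + ?B * (?c - of_nat (Suc m) / 2)) \<odot> a"
      by (simp add: slope_def scale_add_right scale_add_left a_ac del: of_nat_Suc)
    also have "\<dots> = (?B + ?A) \<odot> slope ?c" unfolding c by (simp add: slope_def scale_add_right)
    finally have lin: "?A \<odot> slope (of_nat (Suc t)) \<oplus> ?B \<odot> slope (?c - of_nat (Suc m) / 2) = (?B + ?A) \<odot> slope ?c" .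
    have comb: "(\<alpha> + \<beta>) \<odot> (G \<otimes> (S \<otimes> P)) = \<beta> \<odot> (G \<otimes> (S1 \<otimes> P)) \<oplus> \<alpha> \<odot> (G \<otimes> (S2 \<otimes> P))"
      if "\<beta> \<odot> S1 \<oplus> \<alpha> \<odot> S2 = (\<alpha> + \<beta>) \<odot> S" "G \<in> carrier A" "P \<in> carrier A" "S \<in> carrier A"
        "S1 \<in> carrier A" "S2 \<in> carrier A" for \<alpha> \<beta> G P S S1 S2
    proof -
      have "(\<alpha> + \<beta>) \<odot> (G \<otimes> (S \<otimes> P)) = G \<otimes> ((\<beta> \<odot> S1 \<oplus> \<alpha> \<odot> S2) \<otimes> P)"
        unfolding that(1) using that by (simp add: scale_mult_left scale_mult_right)
      then show ?thesis using that(2-) by (simp add: scale_mult_left scale_mult_right l_distr r_distr)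
    qed
    have "coeff_b (Suc j) (Suc t) = (?B + ?A) \<odot> (g [^] Suc t \<otimes> (slope ?c \<otimes> ?P))"
      unfolding coeff_b_def diff_Suc_Suc m binomial_Suc_Suc of_nat_add nat_pow_Suc2[OF slope_closed] ..
    also have "\<dots> = ?A \<odot> (g [^] Suc t \<otimes> (slope (of_nat (Suc t)) \<otimes> ?P)) \<oplus>
        ?B \<odot> (g [^] Suc t \<otimes> (slope (?c - of_nat (Suc m) / 2) \<otimes> ?P))"
      by (rule comb[OF lin]) (intro nat_pow_closed slope_closed gens_closed)+
    also have "\<dots> = b \<otimes> coeff_b j (Suc t) \<oplus> g \<otimes> coeff_b j t"
      unfolding b1[symmetric] b2[symmetric] coeff_b_def m
      by (subst (1 2) scale_mult_right) (intro m_closed nat_pow_closed slope_closed gens_closed refl)+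
    finally show ?thesis .
  qed
  show "coeff_a (Suc j) (Suc t) = a \<otimes> coeff_a j (Suc t) \<oplus> g \<otimes> coeff_a j t"
  proof (cases "t = j")
    case True
    then show ?thesis by (simp add: coeff_a_def binomial_eq_0 scale_mult_right mult_power_mult[of g \<one>, simplified])
  next
    case False
    define m where "m = j - Suc t"
    have m: "j - Suc t = m" "j - t = Suc m" using False assms by (auto simp: m_def)
    have "a \<otimes> (g [^] Suc t \<otimes> a [^] m) = (a \<otimes> g [^] Suc t) \<otimes> a [^] m"
      by (rule m_assoc[symmetric]) auto
    also have "a \<otimes> g [^] Suc t = g [^] Suc t \<otimes> a"
      using a_power_g_power[of "Suc 0" "Suc t"] by (simp only: nat_pow_Suc[of a] nat_pow_0 l_one gens_closed)
    also have "g [^] Suc t \<otimes> a \<otimes> a [^] m = g [^] Suc t \<otimes> (a \<otimes> a [^] m)"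
      by (rule m_assoc) auto
    finally have 1: "a \<otimes> (g [^] Suc t \<otimes> a [^] m) = g [^] Suc t \<otimes> a [^] Suc m"
      unfolding nat_pow_Suc2[OF gens_closed(1)] .
    have 2: "g \<otimes> (g [^] t \<otimes> a [^] Suc m) = g [^] Suc t \<otimes> a [^] Suc m"
      by (rule mult_power_mult) auto
    have "a \<otimes> coeff_a j (Suc t) \<oplus> g \<otimes> coeff_a j t
      = of_nat (j choose Suc t) \<odot> (a \<otimes> (g [^] Suc t \<otimes> a [^] m)) \<oplus> of_nat (j choose t) \<odot> (g \<otimes> (g [^] t \<otimes> a [^] Suc m))"
      unfolding coeff_a_def m
      by (subst (1 2) scale_mult_right) (intro m_closed nat_pow_closed gens_closed refl)+
    also have "\<dots> = coeff_a (Suc j) (Suc t)"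
      unfolding 1 2 coeff_a_def diff_Suc_Suc m binomial_Suc_Suc of_nat_add
      by (subst scale_add_left) (auto intro: a_comm)
    finally show ?thesis ..
  qed
qed

lemma coeff_simps [simp]:
  "j < t \<Longrightarrow> coeff_b j t = \<zero>" "i < s \<Longrightarrow> coeff_a i s = \<zero>" "coeff_b j 0 = b [^] j" "coeff_a i 0 = a [^] i"
  by (simp_all add: coeff_b_def coeff_a_def binomial_eq_0 slope_0)

abbreviation "T \<equiv> tensor_product A A"

lemma tensor_alg_self: "tensor_alg A A"
  by (rule tensor_algI) (rule assoc_alg_axioms)+

sublocale tensor: tensor_alg A A by (rule tensor_alg_self)

definition "comult_a = tensor A A a \<one> \<oplus>\<^bsub>T\<^esub> tensor A A g a"
definition "comult_b = tensor A A b \<one> \<oplus>\<^bsub>T\<^esub> tensor A A g b"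
definition "comult_g = tensor A A g g"

lemma comult_gens_closed [simp]: "comult_a \<in> carrier T" "comult_b \<in> carrier T" "comult_g \<in> carrier T"
  by (simp_all add: comult_a_def comult_b_def comult_g_def)

lemma comult_b_power: "comult_b [^]\<^bsub>T\<^esub> j = (\<Oplus>\<^bsub>T\<^esub>t\<in>{..j}. tensor A A (coeff_b j t) (b [^] t))"
proof -
  interpret TT: assoc_alg T by (rule tensor.assoc_alg_T)
  show ?thesis unfolding comult_b_def
  proof (rule TT.power_sum_expand[where w = "\<lambda>j t. tensor A A (coeff_b j t) (b [^] t)"])
    fix j t :: nat assume "t \<le> j"
    then show "tensor A A (coeff_b (Suc j) (Suc t)) (b [^] Suc t) =
      tensor A A b \<one> \<otimes>\<^bsub>T\<^esub> tensor A A (coeff_b j (Suc t)) (b [^] Suc t) \<oplus>\<^bsub>T\<^esub>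
      tensor A A g b \<otimes>\<^bsub>T\<^esub> tensor A A (coeff_b j t) (b [^] t)"
      by (simp add: coeff_rec(1) tensor.tensor_simps(1) nat_pow_Suc2[of b t, symmetric] del: nat_pow_Suc Group.nat_pow_Suc)
  qed (simp_all add: tensor.one_T nat_pow_Suc2[of b, symmetric] del: nat_pow_Suc Group.nat_pow_Suc)
qed

lemma comult_a_power: "comult_a [^]\<^bsub>T\<^esub> i = (\<Oplus>\<^bsub>T\<^esub>s\<in>{..i}. tensor A A (coeff_a i s) (a [^] s))"
proof -
  interpret TT: assoc_alg T by (rule tensor.assoc_alg_T)
  show ?thesis unfolding comult_a_def
  proof (rule TT.power_sum_expand[where w = "\<lambda>i s. tensor A A (coeff_a i s) (a [^] s)"])
    fix j t :: nat assume "t \<le> j"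
    then show "tensor A A (coeff_a (Suc j) (Suc t)) (a [^] Suc t) =
      tensor A A a \<one> \<otimes>\<^bsub>T\<^esub> tensor A A (coeff_a j (Suc t)) (a [^] Suc t) \<oplus>\<^bsub>T\<^esub>
      tensor A A g a \<otimes>\<^bsub>T\<^esub> tensor A A (coeff_a j t) (a [^] t)"
      by (simp add: coeff_rec(2) tensor.tensor_simps(1) nat_pow_Suc2[of a t, symmetric] del: nat_pow_Suc Group.nat_pow_Suc)
  qed (simp_all add: tensor.one_T nat_pow_Suc2[of a, symmetric] del: nat_pow_Suc Group.nat_pow_Suc)
qed

end

lemma (in vspace) sum_ends:
  fixes m :: nat
  assumes "0 < m" "f 0 \<in> carrier V" "f m \<in> carrier V" "\<And>t. 0 < t \<Longrightarrow> t < m \<Longrightarrow> f t = \<zero>"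
  shows "(\<Oplus>t\<in>{..m}. f t) = f 0 \<oplus> f m"
proof -
  obtain q where q: "m = Suc q" using assms(1) by (cases m) auto
  have z: "f t = \<zero>" if "t \<in> {..q}" "t \<noteq> 0" for t using assms(4)[of t] that q by auto
  have f: "f t \<in> carrier V" if "t \<le> m" for t using z[of t] assms(2,3) that q by (cases "t = 0"; cases "t = m") auto
  have "(\<Oplus>t\<in>{..m}. f t) = f m \<oplus> (\<Oplus>t\<in>{..q}. f t)"
    unfolding q by (rule finsum_Suc) (use f q in auto)
  also have "(\<Oplus>t\<in>{..q}. f t) = f 0"
    by (rule sum_single) (use z assms in auto)
  finally show ?thesis using assms by (simp add: a_comm)
qed

section \<open>The relations for coproduct, counit and antipode\<close>

context rel_alg
begin

lemma coeff_p_zero: "0 < t \<Longrightarrow> t < p \<Longrightarrow> coeff_b p t = \<zero>" "0 < t \<Longrightarrow> t < p \<Longrightarrow> coeff_a p t = \<zero>"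
  by (simp_all add: coeff_b_def coeff_a_def choose_zero)

lemma coeff_p_p: "coeff_b p p = g [^] p" "coeff_a p p = g [^] p"
  by (simp_all add: coeff_b_def coeff_a_def)

text \<open>The two terms \<open>g^p \<otimes> 1\<close> cancel: \<open>1 - g^p\<close> is
  skew-primitive of the same type as the \<open>p\<close>-th powers of \<open>a\<close> and
  \<open>b\<close>. This makes the right-hand sides of their relations compatible with the
  coproduct.\<close>

lemma comult_power_p:
  assumes "x \<in> carrier A" "x = c \<odot> (\<one> \<ominus> g [^] p)"
  shows "tensor A A x \<one> \<oplus>\<^bsub>T\<^esub> tensor A A (g [^] p) x = c \<odot>\<^bsub>T\<^esub> (\<one>\<^bsub>T\<^esub> \<ominus>\<^bsub>T\<^esub> comult_g [^]\<^bsub>T\<^esub> p)"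
proof -
  interpret TT: assoc_alg T by (rule tensor.assoc_alg_T)
  let ?u = "\<one>\<^bsub>T\<^esub>" and ?v = "tensor A A (g [^] p) \<one>" and ?w = "tensor A A (g [^] p) (g [^] p)"
  have "tensor A A x \<one> \<oplus>\<^bsub>T\<^esub> tensor A A (g [^] p) x =
      c \<odot>\<^bsub>T\<^esub> ?u \<oplus>\<^bsub>T\<^esub> ((- c) \<odot>\<^bsub>T\<^esub> ?v \<oplus>\<^bsub>T\<^esub> (c \<odot>\<^bsub>T\<^esub> ?v \<oplus>\<^bsub>T\<^esub> (- c) \<odot>\<^bsub>T\<^esub> ?w))"
    by (simp add: assms(2) a_minus_def minus_eq_scale tensor.tensor_simps scale_add_right tensor.one_T
        tensor.T.scale_add_right tensor.T.a_assoc)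
  also have "(- c) \<odot>\<^bsub>T\<^esub> ?v \<oplus>\<^bsub>T\<^esub> (c \<odot>\<^bsub>T\<^esub> ?v \<oplus>\<^bsub>T\<^esub> (- c) \<odot>\<^bsub>T\<^esub> ?w) = (- c) \<odot>\<^bsub>T\<^esub> ?w"
    by (simp add: tensor.T.a_assoc[symmetric] tensor.T.scale_add_left[symmetric])
  finally show ?thesis
    by (simp add: comult_g_def tensor.tensor_power a_minus_def tensor.T.minus_eq_scale tensor.T.scale_add_right)
qed

lemma rel_alg_comult: "rel_alg T p n lam mu comult_a comult_b comult_g"
proof -
  interpret TT: assoc_alg T by (rule tensor.assoc_alg_T)
  note ts = tensor.tensor_simps comult_a_def comult_b_def comult_g_def TT.l_distr TT.r_distr
  have p0: "0 < p" using p_gt_2 by simp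
  show ?thesis
  proof (intro rel_alg.intro rel_alg_axioms.intro TT.assoc_alg_axioms parameters_axioms comult_gens_closed)
    show "comult_g [^]\<^bsub>T\<^esub> n = \<one>\<^bsub>T\<^esub>"
      by (simp add: comult_g_def tensor.tensor_power g_pow_n tensor.one_T)
    show "comult_a \<otimes>\<^bsub>T\<^esub> comult_g = comult_g \<otimes>\<^bsub>T\<^esub> comult_a"
      by (simp add: ts a_g)
    show "comult_b \<otimes>\<^bsub>T\<^esub> comult_g = comult_g \<otimes>\<^bsub>T\<^esub> (comult_a \<oplus>\<^bsub>T\<^esub> comult_b)"
      by (simp add: ts b_g r_distr tensor.T.a_ac)
    have "comult_a [^]\<^bsub>T\<^esub> p = tensor A A (a [^] p) \<one> \<oplus>\<^bsub>T\<^esub> tensor A A (g [^] p) (a [^] p)"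
      by (simp add: comult_a_power tensor.T.sum_ends[OF p0] coeff_p_zero coeff_p_p)
    then show "comult_a [^]\<^bsub>T\<^esub> p = lam \<odot>\<^bsub>T\<^esub> (\<one>\<^bsub>T\<^esub> \<ominus>\<^bsub>T\<^esub> comult_g [^]\<^bsub>T\<^esub> p)"
      using comult_power_p[OF _ a_pow_p] by simp
    have "comult_b [^]\<^bsub>T\<^esub> p = tensor A A (b [^] p) \<one> \<oplus>\<^bsub>T\<^esub> tensor A A (g [^] p) (b [^] p)"
      by (simp add: comult_b_power tensor.T.sum_ends[OF p0] coeff_p_zero coeff_p_p)
    then show "comult_b [^]\<^bsub>T\<^esub> p = mu \<odot>\<^bsub>T\<^esub> (\<one>\<^bsub>T\<^esub> \<ominus>\<^bsub>T\<^esub> comult_g [^]\<^bsub>T\<^esub> p)"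
      using comult_power_p[OF _ b_pow_p] by simp
    let ?x = "tensor A A (a \<otimes> a) \<one>" and ?y = "tensor A A (g \<otimes> a) a" and ?z = "tensor A A (g \<otimes> g) (a \<otimes> a)"
    let ?h = "1 / 2 :: 'k"
    \<comment> \<open>The one \<open>?y\<close> that
      \<open>b \<otimes> g = g \<otimes> (a \<oplus> b)\<close> produces has to match the two cross
      terms in half the square of \<open>comult_a\<close>.\<close>
    have y: "?y = ?h \<odot>\<^bsub>T\<^esub> ?y \<oplus>\<^bsub>T\<^esub> ?h \<odot>\<^bsub>T\<^esub> ?y"
      by (simp add: tensor.T.scale_add_left[symmetric])
    have "comult_b \<otimes>\<^bsub>T\<^esub> comult_a = (tensor A A (a \<otimes> b) \<one> \<oplus>\<^bsub>T\<^esub> tensor A A (g \<otimes> a) b \<oplus>\<^bsub>T\<^esub>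
        tensor A A (g \<otimes> b) a \<oplus>\<^bsub>T\<^esub> tensor A A (g \<otimes> g) (a \<otimes> b)) \<oplus>\<^bsub>T\<^esub> (?h \<odot>\<^bsub>T\<^esub> ?x \<oplus>\<^bsub>T\<^esub> ?y \<oplus>\<^bsub>T\<^esub> ?h \<odot>\<^bsub>T\<^esub> ?z)"
      by (simp add: ts b_a b_g r_distr tensor.T.a_ac)
    also have "\<dots> = (tensor A A (a \<otimes> b) \<one> \<oplus>\<^bsub>T\<^esub> tensor A A (g \<otimes> a) b \<oplus>\<^bsub>T\<^esub>
        tensor A A (g \<otimes> b) a \<oplus>\<^bsub>T\<^esub> tensor A A (g \<otimes> g) (a \<otimes> b)) \<oplus>\<^bsub>T\<^esub>
        (?h \<odot>\<^bsub>T\<^esub> ?x \<oplus>\<^bsub>T\<^esub> (?h \<odot>\<^bsub>T\<^esub> ?y \<oplus>\<^bsub>T\<^esub> ?h \<odot>\<^bsub>T\<^esub> ?y) \<oplus>\<^bsub>T\<^esub> ?h \<odot>\<^bsub>T\<^esub> ?z)"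
      using y by simp
    also have "\<dots> = comult_a \<otimes>\<^bsub>T\<^esub> comult_b \<oplus>\<^bsub>T\<^esub> ?h \<odot>\<^bsub>T\<^esub> (comult_a \<otimes>\<^bsub>T\<^esub> comult_a)"
      by (simp add: ts a_g tensor.T.scale_add_right tensor.T.a_ac)
    finally show "comult_b \<otimes>\<^bsub>T\<^esub> comult_a =
        comult_a \<otimes>\<^bsub>T\<^esub> comult_b \<oplus>\<^bsub>T\<^esub> ?h \<odot>\<^bsub>T\<^esub> (comult_a \<otimes>\<^bsub>T\<^esub> comult_a)" .
  qed
qed

lemma rel_alg_counit: "rel_alg (ground :: ('k, 'k) module) p n lam mu 0 0 1"
proof -
  interpret G: assoc_alg "ground :: ('k, 'k) module" by (rule assoc_alg_ground)
  have "p > 0" using p_gt_2 by simp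
  moreover have "1 \<ominus>\<^bsub>ground\<^esub> (1 :: 'k) = 0" by (simp add: a_minus_def G.minus_eq_scale[simplified])
  ultimately show ?thesis
    by (intro rel_alg.intro rel_alg_axioms.intro assoc_alg_ground parameters_axioms)
      (simp_all add: ground_power)
qed

definition "ginv = g [^] (n - 1)"

lemma ginv_closed [simp, intro]: "ginv \<in> carrier A"
  by (simp add: ginv_def)

lemma g_ginv: "g \<otimes> ginv = \<one>" "ginv \<otimes> g = \<one>"
proof -
  obtain m where m: "n = Suc m" using n_pos by (cases n) auto
  then have "ginv = g [^] m" unfolding ginv_def by simp
  then show "g \<otimes> ginv = \<one>" "ginv \<otimes> g = \<one>"
    using g_pow_n[unfolded m] nat_pow_Suc2[of g m] by simp_all
qed

lemma slope_ginv: "slope c \<otimes> ginv = ginv \<otimes> slope (c - 1)"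
proof -
  have "(of_nat (n - 1) :: 'k) = - 1"
    using n_zero n_pos by (simp add: of_nat_diff)
  then show ?thesis by (simp add: slope_g_power ginv_def)
qed

lemma a_ginv: "a \<otimes> ginv = ginv \<otimes> a"
  using a_power_g_power[of 1] by (simp add: ginv_def)

text \<open>Collecting the factors \<open>ginv\<close> on the left leaves a product of the slopes
  \<open>0, - 1, \<dots>, 1 - m\<close>, and \<open>slope_power_shift\<close> turns it into a power
  of their mean \<open>(1 - m) / 2\<close>.\<close>

lemma ginv_b_power: "(ginv \<otimes> b) [^] m = ginv [^] m \<otimes> slope ((1 - of_nat m) / 2) [^] m"
proof (induction m)
  case (Suc m)
  have sg: "slope c \<otimes> ginv [^] m = ginv [^] m \<otimes> slope (c - of_nat m)" for c and m :: nat
  proof (induction m)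
    case (Suc m)
    have "slope c \<otimes> ginv [^] Suc m = (slope c \<otimes> ginv [^] m) \<otimes> ginv" by (simp add: m_assoc)
    also have "\<dots> = ginv [^] m \<otimes> (slope (c - of_nat m) \<otimes> ginv)" by (simp add: Suc m_assoc)
    finally show ?case by (simp add: slope_ginv m_assoc algebra_simps)
  qed simp
  have "(ginv \<otimes> b) [^] Suc m = ginv \<otimes> b \<otimes> (ginv \<otimes> b) [^] m"
    by (rule nat_pow_Suc2) simp
  also have "\<dots> = ginv \<otimes> (slope 0 \<otimes> ginv [^] m) \<otimes> slope ((1 - of_nat m) / 2) [^] m"
    by (simp add: Suc slope_0 m_assoc)
  also have "\<dots> = (ginv \<otimes> ginv [^] m) \<otimes> (slope (- of_nat m) \<otimes> slope ((1 - of_nat m) / 2) [^] m)"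
    by (simp only: sg) (simp add: m_assoc)
  also have "ginv \<otimes> ginv [^] m = ginv [^] Suc m"
    by (rule nat_pow_Suc2[symmetric]) simp
  also have "slope (- of_nat m) \<otimes> slope ((1 - of_nat m) / 2) [^] m
      = slope ((1 - of_nat m) / 2 - of_nat (Suc m) / 2) \<otimes> slope ((1 - of_nat m) / 2) [^] m"
  proof -
    have "(1 - of_nat m) / 2 - of_nat (Suc m) / 2 = (- of_nat m :: 'k)"
      by (simp add: diff_divide_distrib[symmetric])
    then show ?thesis by simp
  qed
  also have "\<dots> = slope ((1 - of_nat (Suc m)) / 2) [^] Suc m"
    unfolding slope_power_shift[symmetric] by (simp add: diff_divide_distrib)
  finally show ?case .
qed simp

text \<open>The antipode axiom forces these images of the generators. All relations are verified
  with products reversed; for the \<open>p\<close>-th powers the sign \<open>(- 1) ^ p = - 1\<close>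
  is combined with \<open>flip\<close>.\<close>

lemma rel_alg_antipode:
  "rel_alg (op_alg A) p n lam mu (\<ominus> (ginv \<otimes> a)) (\<ominus> (ginv \<otimes> b)) ginv"
proof -
  have m: "\<ominus> (ginv \<otimes> x) = (- 1) \<odot> (ginv \<otimes> x)" if "x \<in> carrier A" for x
    using that by (simp add: minus_eq_scale)
  have op_minus: "x \<ominus>\<^bsub>op_alg A\<^esub> y = x \<ominus> y" for x y
    by (simp add: a_minus_def a_inv_def op_alg_def)
  have odd: "(- 1 :: 'k) ^ p = - 1" using odd_p by simp
  have gp: "ginv [^] p \<otimes> g [^] p = \<one>"
  proof -
    have "ginv [^] p \<otimes> g [^] p = (g [^] n) [^] p"
    proof -
      have "(n - 1) * p + p = n * p" using n_pos by (cases n) simp_all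
      then show ?thesis by (simp only: ginv_def nat_pow_pow nat_pow_mult gens_closed)
    qed
    then show ?thesis by (simp add: g_pow_n)
  qed
  \<comment> \<open>Since \<open>- g^-p (1 - g^p) = 1 - g^-p\<close>, the right-hand side becomes
    the same expression in the inverse of \<open>g\<close>.\<close>
  have flip: "(- 1) \<odot> (ginv [^] p \<otimes> (c \<odot> (\<one> \<ominus> g [^] p))) = c \<odot> (\<one> \<ominus> ginv [^] p)" for c
  proof -
    have "ginv [^] p \<otimes> (c \<odot> (\<one> \<ominus> g [^] p)) = c \<odot> (ginv [^] p \<ominus> \<one>)"
      by (simp add: minus_scale_mult gp)
    then show ?thesis by (simp add: a_minus_def minus_eq_scale scale_add_right a_comm)
  qed
  have ap: "(ginv \<otimes> a) [^] p = ginv [^] p \<otimes> a [^] p"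
    by (rule pow_mult_distrib) (simp_all add: a_ginv)
  \<comment> \<open>At exponent \<open>p\<close> the slope \<open>(1 - p) / 2\<close> is
    \<open>1 / 2\<close>, and \<open>slope_power_p\<close> brings it back to
    \<open>b\<close>.\<close>
  have bp: "(ginv \<otimes> b) [^] p = ginv [^] p \<otimes> b [^] p"
    unfolding ginv_b_power using slope_power_p[of 1] by (simp add: p_zero)
  have gg: "g [^] ((n - 1) * n) = \<one>"
    using g_pow_n nat_pow_pow[of g n "n - 1"] by (simp add: mult.commute)
  have bg: "b \<otimes> ginv = ginv \<otimes> (b \<oplus> (- 1) \<odot> a)"
    using slope_ginv[of 0] by (simp add: slope_0 slope_def)
  have bgx: "b \<otimes> (ginv \<otimes> x) = ginv \<otimes> ((b \<oplus> (- 1) \<odot> a) \<otimes> x)" if "x \<in> carrier A" for x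
    using that bg by (simp add: m_assoc[symmetric])
  have agx: "a \<otimes> (ginv \<otimes> x) = ginv \<otimes> (a \<otimes> x)" if "x \<in> carrier A" for x
    using that a_ginv by (simp add: m_assoc[symmetric])
  show ?thesis
  proof (intro rel_alg.intro rel_alg_axioms.intro assoc_alg_op parameters_axioms; unfold op_simps)
    show "ginv [^]\<^bsub>op_alg A\<^esub> n = \<one>"
      using gg by (simp add: op_power ginv_def nat_pow_pow)
    show "ginv \<otimes> (\<ominus> (ginv \<otimes> a)) = \<ominus> (ginv \<otimes> a) \<otimes> ginv"
      by (simp add: m scale_mult_left scale_mult_right m_assoc a_ginv)
    show "ginv \<otimes> (\<ominus> (ginv \<otimes> b)) = (\<ominus> (ginv \<otimes> a) \<oplus> \<ominus> (ginv \<otimes> b)) \<otimes> ginv"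
    proof -
      let ?X = "ginv \<otimes> (ginv \<otimes> a)" and ?Y = "ginv \<otimes> (ginv \<otimes> b)"
      have "(\<ominus> (ginv \<otimes> a) \<oplus> \<ominus> (ginv \<otimes> b)) \<otimes> ginv = (- 1) \<odot> ?X \<oplus> ((- 1) \<odot> ?Y \<oplus> ?X)"
        by (simp add: m scale_mult_left scale_mult_right m_assoc a_ginv bg r_distr l_distr scale_add_right)
      also have "\<dots> = (- 1) \<odot> ?Y \<oplus> (\<ominus> ?X \<oplus> ?X)"
        by (simp add: minus_eq_scale a_lcomm)
      also have "\<dots> = ginv \<otimes> (\<ominus> (ginv \<otimes> b))"
        using l_neg[of ?X] by (simp add: m scale_mult_right)
      finally show ?thesis ..
    qed
    show "\<ominus> (ginv \<otimes> a) [^]\<^bsub>op_alg A\<^esub> p = lam \<odot> (\<one> \<ominus>\<^bsub>op_alg A\<^esub> ginv [^]\<^bsub>op_alg A\<^esub> p)"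
      by (simp add: op_power m scale_power odd ap a_pow_p flip op_minus)
    show "\<ominus> (ginv \<otimes> b) [^]\<^bsub>op_alg A\<^esub> p = mu \<odot> (\<one> \<ominus>\<^bsub>op_alg A\<^esub> ginv [^]\<^bsub>op_alg A\<^esub> p)"
      by (simp add: op_power m scale_power odd bp b_pow_p flip op_minus)
    show "\<ominus> (ginv \<otimes> a) \<otimes> (\<ominus> (ginv \<otimes> b)) =
        \<ominus> (ginv \<otimes> b) \<otimes> (\<ominus> (ginv \<otimes> a)) \<oplus> (1 / 2) \<odot> (\<ominus> (ginv \<otimes> a) \<otimes> (\<ominus> (ginv \<otimes> a)))"
    proof -
      have "(1 / 2 :: 'k) + (- 1 + 1 / 2) = 0" by (simp add: field_simps)
      then show ?thesis
        by (simp add: m scale_mult_left scale_mult_right m_assoc agx bgx b_a r_distr l_distr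
          scale_add_right a_assoc scale_collect)
    qed
  qed simp_all
qed

end

section \<open>The Hopf algebra axioms\<close>

lemma bilinear_cong:
  assumes "vspace V" "vspace W" "bilinear V W U \<gamma>"
    "\<And>x y. x \<in> carrier V \<Longrightarrow> y \<in> carrier W \<Longrightarrow> \<beta> x y = \<gamma> x y"
  shows "bilinear V W U \<beta>"
proof -
  interpret V: vspace V by fact
  interpret W: vspace W by fact
  show ?thesis
    using assms(3,4) unfolding bilinear_def linear_map_def Pi_def by simp
qed

text \<open>Coproduct and counit are prescribed as homomorphisms with given values on the
  generators. The Hopf algebra axioms follow, because the presentation determines homomorphisms by
  these values.\<close>

locale hopf_lifting = lifting_algebra H p n lam mu a b g
  for H :: "('k::field, 'v) hopf" (structure) and p n lam mu a b g +
  assumes comult_hom: "algebra_hom H (tensor_product H H) (comult H)"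
    and comult_gens [simp]: "comult H a = comult_a" "comult H b = comult_b" "comult H g = comult_g"
    and counit_hom: "algebra_hom H ground (counit H)"
    and counit_gens [simp]: "counit H a = 0" "counit H b = 0" "counit H g = 1"
begin

abbreviation "H3 \<equiv> tensor_product H (tensor_product H H)"

lemma assoc_alg_T: "assoc_alg T"
  by (rule tensor.assoc_alg_T)

sublocale H3: tensor_alg H "tensor_product H H"
  by (rule tensor_algI[OF assoc_alg_axioms assoc_alg_T])

lemma assoc_alg_H3: "assoc_alg H3"
  by (rule H3.assoc_alg_T)

lemmas comult_simps = algebra_homD(2-6)[OF comult_hom]
lemmas counit_simps = algebra_homD(3-6)[OF counit_hom, unfolded ground_simps]

lemma comult_closed [simp]: "x \<in> carrier H \<Longrightarrow> comult H x \<in> carrier T"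
  by (rule comult_simps)

text \<open>The map \<open>(\<Delta> \<otimes> id) \<Delta>\<close> is built from embeddings of the
  three tensor slots: \<open>L\<close> fills the first two and \<open>i\<close> the third. Images of
  different slots commute, so two applications of \<open>lift_hom\<close> make it an algebra
  homomorphism.\<close>

lemma coassoc_left:
  defines "\<beta> \<equiv> \<lambda>x y. tensor_lift H3 (\<lambda>u v. tensor H T u (tensor H H v y)) (comult H x)"
  shows "bilinear H H H3 \<beta>" and "algebra_hom H H3 (\<lambda>h. tensor_lift H3 \<beta> (comult H h))"
proof -
  interpret K: assoc_alg H3 by (rule assoc_alg_H3)
  define f where "f u = tensor H T u \<one>\<^bsub>T\<^esub>" for u
  define h where "h v = tensor H T \<one> (tensor H H v \<one>)" for v
  define i where "i y = tensor H T \<one> (tensor H H \<one> y)" for y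
  have f: "algebra_hom H H3 f" unfolding f_def by (rule H3.hom_left)
  have h: "algebra_hom H H3 h"
    unfolding h_def by (rule algebra_hom_comp[OF tensor.hom_left H3.hom_right])
  have i: "algebra_hom H H3 i"
    unfolding i_def by (rule algebra_hom_comp[OF tensor.hom_right H3.hom_right])
  have comm: "h v \<otimes>\<^bsub>H3\<^esub> f u = f u \<otimes>\<^bsub>H3\<^esub> h v" if "u \<in> carrier H" "v \<in> carrier H" for u v
    using that by (simp add: f_def h_def)
  define L where "L = tensor_lift H3 (\<lambda>u v. f u \<otimes>\<^bsub>H3\<^esub> h v)"
  note bL = tensor.lift_hom(1)[OF assoc_alg_H3 f h comm]
  have L: "algebra_hom T H3 L" unfolding L_def by (rule tensor.lift_hom(2)[OF assoc_alg_H3 f h comm])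
  have Lt: "L (tensor H H u v) = tensor H T u (tensor H H v \<one>)" if "u \<in> carrier H" "v \<in> carrier H" for u v
    using that by (simp add: L_def tensor.lift_tensor[OF H3.vspace_T bL]) (simp add: f_def h_def tensor.one_T)
  have uv: "bilinear H H H3 (\<lambda>u v. tensor H T u (tensor H H v y))" if "y \<in> carrier H" for y
    by (rule bilinear_comp2[OF H3.bilinear_tensor _ tensor.linear_tensor_left[OF that]]) (simp add: linear_map_def)
  have eq: "tensor_lift H3 (\<lambda>u v. tensor H T u (tensor H H v y)) t = L t \<otimes>\<^bsub>H3\<^esub> i y"
    if y: "y \<in> carrier H" and t: "t \<in> carrier T" for y t
  proof (rule tensor.linear_map_tensor_eqI[OF tensor.linear_lift[OF H3.vspace_T uv[OF y]] _ t])
    show "linear_map T H3 (\<lambda>t. L t \<otimes>\<^bsub>H3\<^esub> i y)"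
      by (rule linear_mapI) (use y in \<open>simp_all add: algebra_homD[OF L] algebra_homD[OF i] K.l_distr K.scale_mult_left\<close>)
  qed (use y in \<open>simp add: tensor.lift_tensor[OF H3.vspace_T uv] Lt i_def\<close>)
  have L\<Delta>: "algebra_hom H H3 (\<lambda>x. L (comult H x))" by (rule algebra_hom_comp[OF comult_hom L])
  have commL: "i y \<otimes>\<^bsub>H3\<^esub> L t = L t \<otimes>\<^bsub>H3\<^esub> i y" if y: "y \<in> carrier H" and t: "t \<in> carrier T" for y t
    using t
    by (induction t rule: tensor.tensor_induct)
      (use y in \<open>simp_all add: algebra_homD[OF L] algebra_homD[OF i] K.l_distr K.r_distr\<close>, simp add: Lt i_def)
  note G = tensor.lift_hom[OF assoc_alg_H3 L\<Delta> i commL[OF _ comult_closed]]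
  have \<beta>: "\<beta> x y = L (comult H x) \<otimes>\<^bsub>H3\<^esub> i y" if "x \<in> carrier H" "y \<in> carrier H" for x y
    using that by (simp add: \<beta>_def eq)
  show b: "bilinear H H H3 \<beta>"
    by (rule bilinear_cong[OF vspace_axioms vspace_axioms G(1) \<beta>])
  have "tensor_lift H3 \<beta> t = tensor_lift H3 (\<lambda>x y. L (comult H x) \<otimes>\<^bsub>H3\<^esub> i y) t" if "t \<in> carrier T" for t
    by (rule tensor.lift_cong[OF H3.vspace_T b G(1) that \<beta>])
  then have "tensor_lift H3 \<beta> (comult H x) = tensor_lift H3 (\<lambda>x y. L (comult H x) \<otimes>\<^bsub>H3\<^esub> i y) (comult H x)"
    if "x \<in> carrier H" for x using that by simp
  with algebra_hom_comp[OF comult_hom G(2)]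
  show "algebra_hom H H3 (\<lambda>h. tensor_lift H3 \<beta> (comult H h))"
    by (simp add: algebra_hom_def ring_hom_def linear_map_def Pi_def)
qed

lemma coassoc_right:
  defines "\<beta> \<equiv> \<lambda>x y. tensor H T x (comult H y)"
  shows "bilinear H H H3 \<beta>" and "algebra_hom H H3 (\<lambda>h. tensor_lift H3 \<beta> (comult H h))"
proof -
  interpret K: assoc_alg H3 by (rule assoc_alg_H3)
  define h where "h v = tensor H T \<one> (comult H v)" for v
  have h: "algebra_hom H H3 h"
    unfolding h_def by (rule algebra_hom_comp[OF comult_hom H3.hom_right])
  have comm: "h v \<otimes>\<^bsub>H3\<^esub> tensor H T u \<one>\<^bsub>T\<^esub> = tensor H T u \<one>\<^bsub>T\<^esub> \<otimes>\<^bsub>H3\<^esub> h v"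
    if "u \<in> carrier H" "v \<in> carrier H" for u v
    using that by (simp add: h_def)
  note G = tensor.lift_hom[OF assoc_alg_H3 H3.hom_left h comm]
  have \<beta>: "\<beta> x y = tensor H T x \<one>\<^bsub>T\<^esub> \<otimes>\<^bsub>H3\<^esub> h y" if "x \<in> carrier H" "y \<in> carrier H" for x y
    using that by (simp add: \<beta>_def h_def)
  show b: "bilinear H H H3 \<beta>"
    by (rule bilinear_cong[OF vspace_axioms vspace_axioms G(1) \<beta>])
  have "tensor_lift H3 \<beta> t = tensor_lift H3 (\<lambda>x y. tensor H T x \<one>\<^bsub>T\<^esub> \<otimes>\<^bsub>H3\<^esub> h y) t" if "t \<in> carrier T" for t
    by (rule tensor.lift_cong[OF H3.vspace_T b G(1) that \<beta>])
  then have "tensor_lift H3 \<beta> (comult H x) = tensor_lift H3 (\<lambda>x y. tensor H T x \<one>\<^bsub>T\<^esub> \<otimes>\<^bsub>H3\<^esub> h y) (comult H x)"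
    if "x \<in> carrier H" for x using that by simp
  with algebra_hom_comp[OF comult_hom G(2)]
  show "algebra_hom H H3 (\<lambda>h. tensor_lift H3 \<beta> (comult H h))"
    by (simp add: algebra_hom_def ring_hom_def linear_map_def Pi_def)
qed

lemma hom_eqI:
  assumes "assoc_alg A" "algebra_hom H A f" "algebra_hom H A h" "f a = h a" "f b = h b" "f g = h g"
    "x \<in> carrier H"
  shows "f x = h x"
  by (rule presented_hom_unique[OF presented assms(1-3) _ assms(7)]) (auto simp: assms split: gens.split)

text \<open>Both sides are algebra homomorphisms by \<open>coassoc_left\<close> and
  \<open>coassoc_right\<close>, so the generators decide.\<close>

lemma coassoc:
  assumes "h \<in> carrier H"
  shows "tensor_lift H3 (\<lambda>x y. tensor_lift H3 (\<lambda>u v. tensor H T u (tensor H H v y)) (comult H x)) (comult H h)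
    = tensor_lift H3 (\<lambda>x y. tensor H T x (comult H y)) (comult H h)"
proof -
  interpret K: assoc_alg H3 by (rule assoc_alg_H3)
  have uv: "bilinear H H H3 (\<lambda>u v. tensor H T u (tensor H H v y))" if "y \<in> carrier H" for y
    by (rule bilinear_comp2[OF H3.bilinear_tensor _ tensor.linear_tensor_left[OF that]]) (simp add: linear_map_def)
  note [simp] = tensor.lift_tensor[OF H3.vspace_T uv] linear_mapD(2)[OF tensor.linear_lift[OF H3.vspace_T uv]]
    tensor.lift_tensor[OF H3.vspace_T coassoc_left(1)] linear_mapD(2)[OF tensor.linear_lift[OF H3.vspace_T coassoc_left(1)]]
    tensor.lift_tensor[OF H3.vspace_T coassoc_right(1)] linear_mapD(2)[OF tensor.linear_lift[OF H3.vspace_T coassoc_right(1)]]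
    comult_simps(5) comult_a_def comult_b_def comult_g_def
  have one: "tensor H H \<one> \<one> = \<one>\<^bsub>T\<^esub>" by (simp add: tensor.one_T)
  show ?thesis
    by (rule hom_eqI[OF assoc_alg_H3 coassoc_left(2) coassoc_right(2) _ _ _ assms])
      (simp_all add: H3.tensor_simps H3.T.a_assoc one)
qed

text \<open>Scalar multiples of \<open>\<one>\<close> are central, so the counit, viewed as a map
  into them, and the identity combine by \<open>lift_hom\<close>; the resulting homomorphisms fix
  the generators.\<close>

lemma counit_left: "h \<in> carrier H \<Longrightarrow> tensor_lift H (\<lambda>x y. counit H x \<odot> y) (comult H h) = h"
  and counit_right: "h \<in> carrier H \<Longrightarrow> tensor_lift H (\<lambda>x y. counit H y \<odot> x) (comult H h) = h"
proof -
  have id: "algebra_hom H H (\<lambda>x. x)" by (rule algebra_homI) simp_all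
  have e: "algebra_hom H H (\<lambda>x. counit H x \<odot> \<one>)"
    by (rule algebra_homI) (simp_all add: counit_simps scale_add_left scale_mult_left scale_mult_right mult.commute)
  have c1: "y \<otimes> (counit H x \<odot> \<one>) = (counit H x \<odot> \<one>) \<otimes> y" if "x \<in> carrier H" "y \<in> carrier H" for x y
    using that by (simp add: scale_mult_left scale_mult_right)
  have c2: "(counit H y \<odot> \<one>) \<otimes> x = x \<otimes> (counit H y \<odot> \<one>)" if "x \<in> carrier H" "y \<in> carrier H" for x y
    using that by (simp add: scale_mult_left scale_mult_right)
  note G1 = tensor.lift_hom[OF assoc_alg_axioms e id c1] and G2 = tensor.lift_hom[OF assoc_alg_axioms id e c2]
  have eq1: "(counit H x \<odot> \<one>) \<otimes> y = counit H x \<odot> y" and eq2: "x \<otimes> (counit H y \<odot> \<one>) = counit H y \<odot> x"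
    if "x \<in> carrier H" "y \<in> carrier H" for x y
    using that by (simp_all add: scale_mult_left scale_mult_right)
  note b1 = bilinear_cong[OF vspace_axioms vspace_axioms G1(1) eq1[symmetric]]
  note b2 = bilinear_cong[OF vspace_axioms vspace_axioms G2(1) eq2[symmetric]]
  have "tensor_lift H (\<lambda>x y. (counit H x \<odot> \<one>) \<otimes> y) (comult H h) = h" if "h \<in> carrier H" for h
    by (rule hom_eqI[OF assoc_alg_axioms algebra_hom_comp[OF comult_hom G1(2)] id _ _ _ that])
      (simp_all add: comult_a_def comult_b_def comult_g_def linear_mapD(2)[OF algebra_homD(1)[OF G1(2)]]
        tensor.lift_tensor[OF vspace_axioms G1(1)] counit_simps)
  moreover have "tensor_lift H (\<lambda>x y. x \<otimes> (counit H y \<odot> \<one>)) (comult H h) = h" if "h \<in> carrier H" for h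
    by (rule hom_eqI[OF assoc_alg_axioms algebra_hom_comp[OF comult_hom G2(2)] id _ _ _ that])
      (simp_all add: comult_a_def comult_b_def comult_g_def linear_mapD(2)[OF algebra_homD(1)[OF G2(2)]]
        tensor.lift_tensor[OF vspace_axioms G2(1)] counit_simps)
  moreover have "tensor_lift H (\<lambda>x y. (counit H x \<odot> \<one>) \<otimes> y) (comult H h) = tensor_lift H (\<lambda>x y. counit H x \<odot> y) (comult H h)"
    "tensor_lift H (\<lambda>x y. x \<otimes> (counit H y \<odot> \<one>)) (comult H h) = tensor_lift H (\<lambda>x y. counit H y \<odot> x) (comult H h)"
    if "h \<in> carrier H" for h
    by (rule tensor.lift_cong[OF vspace_axioms G1(1) b1] tensor.lift_cong[OF vspace_axioms G2(1) b2];
        use that eq1 eq2 in simp)+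
  ultimately show "h \<in> carrier H \<Longrightarrow> tensor_lift H (\<lambda>x y. counit H x \<odot> y) (comult H h) = h"
    "h \<in> carrier H \<Longrightarrow> tensor_lift H (\<lambda>x y. counit H y \<odot> x) (comult H h) = h" by simp_all
qed

lemma bialgebra: "bialgebra H"
  unfolding bialgebra_def Let_def assoc_algebra_iff
  using assoc_alg_axioms comult_hom counit_hom coassoc counit_left counit_right by blast

definition antipode :: "'v \<Rightarrow> 'v" where
  "antipode = (SOME S. algebra_hom H (op_alg H) S \<and> S a = \<ominus> (ginv \<otimes> a) \<and> S b = \<ominus> (ginv \<otimes> b) \<and> S g = ginv)"

lemma antipode_hom: "algebra_hom H (op_alg H) antipode"
  and antipode_gens: "antipode a = \<ominus> (ginv \<otimes> a)" "antipode b = \<ominus> (ginv \<otimes> b)" "antipode g = ginv"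
proof -
  have "\<exists>S. algebra_hom H (op_alg H) S \<and> S a = \<ominus> (ginv \<otimes> a) \<and> S b = \<ominus> (ginv \<otimes> b) \<and> S g = ginv"
    by (rule hom_exists[OF rel_alg_antipode]) blast
  from someI_ex[OF this] show "algebra_hom H (op_alg H) antipode"
    "antipode a = \<ominus> (ginv \<otimes> a)" "antipode b = \<ominus> (ginv \<otimes> b)" "antipode g = ginv"
    unfolding antipode_def by blast+
qed

lemmas antipode_simps = algebra_homD(2-6)[OF antipode_hom, unfolded op_simps]

lemma antipode_linear: "linear_map H H antipode"
  by (rule linear_mapI) (simp_all add: antipode_simps)

lemma antipode_bilinear:
  "bilinear H H H (\<lambda>x y. antipode x \<otimes> y)" "bilinear H H H (\<lambda>x y. x \<otimes> antipode y)"
  by (intro bilinearI linear_mapI;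
      simp add: antipode_simps l_distr r_distr scale_mult_left scale_mult_right)+

text \<open>The maps \<open>?L\<close> and \<open>?R\<close> are not homomorphisms on the tensor
  square, so the axiom is proved by induction over products. As the antipode reverses products, the
  value of \<open>?L\<close> at the first factor appears innermost (\<open>L1\<close>); once it is a
  scalar, it can be taken out (\<open>L2\<close>). For \<open>?R\<close> it is the second
  factor.\<close>

lemma is_antipode_antipode: "is_antipode H antipode"
proof -
  let ?L = "tensor_lift H (\<lambda>x y. antipode x \<otimes> y)" and ?R = "tensor_lift H (\<lambda>x y. x \<otimes> antipode y)"
  note L = linear_mapD[OF tensor.linear_lift[OF vspace_axioms antipode_bilinear(1)]]
    tensor.lift_tensor[OF vspace_axioms antipode_bilinear(1)]
  note R = linear_mapD[OF tensor.linear_lift[OF vspace_axioms antipode_bilinear(2)]]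
    tensor.lift_tensor[OF vspace_axioms antipode_bilinear(2)]
  have L1: "?L (t \<otimes>\<^bsub>T\<^esub> tensor H H x y) = antipode x \<otimes> (?L t \<otimes> y)"
    if xy: "x \<in> carrier H" "y \<in> carrier H" and t: "t \<in> carrier T" for x y t
    using t by (induction t rule: tensor.tensor_induct)
      (use xy in \<open>simp_all add: L antipode_simps m_assoc l_distr r_distr H3.B.l_distr\<close>)
  have R1: "?R (tensor H H x y \<otimes>\<^bsub>T\<^esub> t) = x \<otimes> (?R t \<otimes> antipode y)"
    if xy: "x \<in> carrier H" "y \<in> carrier H" and t: "t \<in> carrier T" for x y t
    using t by (induction t rule: tensor.tensor_induct)
      (use xy in \<open>simp_all add: R antipode_simps m_assoc l_distr r_distr H3.B.r_distr\<close>)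
  have L2: "?L (t \<otimes>\<^bsub>T\<^esub> t') = c \<odot> ?L t'"
    if t: "t \<in> carrier T" "?L t = c \<odot> \<one>" and t': "t' \<in> carrier T" for t t' c
    using t' by (induction t' rule: tensor.tensor_induct)
      (use t in \<open>simp_all add: L1 L antipode_simps scale_mult_left scale_mult_right H3.B.r_distr scale_add_right\<close>)
  have R2: "?R (t \<otimes>\<^bsub>T\<^esub> t') = c \<odot> ?R t"
    if t': "t' \<in> carrier T" "?R t' = c \<odot> \<one>" and t: "t \<in> carrier T" for t t' c
    using t by (induction t rule: tensor.tensor_induct)
      (use t' in \<open>simp_all add: R1 R antipode_simps scale_mult_left scale_mult_right H3.B.l_distr scale_add_right\<close>)
  have "?L (comult H h) = counit H h \<odot> \<one> \<and> ?R (comult H h) = counit H h \<odot> \<one>" if "h \<in> carrier H" for h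
    using presented that
  proof (induction h rule: presented_induct)
    case one
    show ?case by (simp add: comult_simps(5) counit_simps tensor.one_T L R antipode_simps)
  next
    case (gen y)
    show ?case
      by (cases y) (simp_all add: comult_a_def comult_b_def comult_g_def L R antipode_simps antipode_gens
          g_ginv l_neg r_neg r_minus m_assoc[symmetric])
  next
    case (add x y)
    then show ?case by (simp add: comult_simps counit_simps L R scale_add_left)
  next
    case (scale c x)
    then show ?case by (simp add: comult_simps counit_simps L R)
  next
    case (mult x y)
    then show ?case
      by (simp add: comult_simps counit_simps L2[where c = "counit H x"] R2[where c = "counit H y"] mult.commute)
  qed
  then show ?thesis using antipode_linear by (simp add: is_antipode_def)
qed

lemma hopf_algebra: "hopf_algebra H"
  unfolding hopf_algebra_def using bialgebra is_antipode_antipode by blast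

end

section \<open>Pointedness and the coradical filtration\<close>

context hopf_lifting
begin

text \<open>The map \<open>id \<otimes> coord v\<close>: the left factor that stands at
  \<open>mon v\<close> when a tensor is expanded in its right factor.\<close>

definition theta :: "nat \<times> nat \<times> nat \<Rightarrow> ('k, 'v, 'v) tensor \<Rightarrow> 'v" where
  "theta v = tensor_lift H (\<lambda>x y. coord v y \<odot> x)"

lemma theta_bilinear: "bilinear H H H (\<lambda>x y. coord v y \<odot> x)"
  by (intro bilinearI linear_mapI) (simp_all add: coord_simps scale_add_left scale_add_right mult.commute)

lemma theta_linear: "linear_map T H (theta v)"
  unfolding theta_def by (rule tensor.linear_lift[OF vspace_axioms theta_bilinear])

lemmas theta_simps = linear_mapD[OF theta_linear]

lemma theta_tensor [simp]: "x \<in> carrier H \<Longrightarrow> y \<in> carrier H \<Longrightarrow> theta v (tensor H H x y) = coord v y \<odot> x"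
  unfolding theta_def by (rule tensor.lift_tensor[OF vspace_axioms theta_bilinear])

lemma theta_sum: "(\<And>i. i \<in> I \<Longrightarrow> f i \<in> carrier T) \<Longrightarrow> theta v (\<Oplus>\<^bsub>T\<^esub>i\<in>I. f i) = (\<Oplus>i\<in>I. theta v (f i))"
  by (rule linear_map_sum[OF tensor.vspace_T vspace_axioms theta_linear])

lemma theta_expand: "t \<in> carrier T \<Longrightarrow> t = (\<Oplus>\<^bsub>T\<^esub>v\<in>idx. tensor H H (theta v t) (mon v))"
  unfolding theta_def by (rule tensor.tensor_expand_right[OF finite_idx mon_closed coord_linear expand])

text \<open>The action of the functional \<open>coord v\<close> on \<open>H\<close> that is dual to
  the coproduct. The element \<open>left v x\<close> belongs to every subcoalgebra that contains
  \<open>x\<close>.\<close>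

definition left :: "nat \<times> nat \<times> nat \<Rightarrow> 'v \<Rightarrow> 'v" where
  "left v x = theta v (comult H x)"

lemma left_linear: "linear_map H H (left v)"
  unfolding left_def by (rule linear_map_comp[OF algebra_homD(1)[OF comult_hom] theta_linear])

lemmas left_simps = linear_mapD[OF left_linear]

lemma left_zero [simp]: "left v \<zero> = \<zero>"
  by (rule linear_map_zero[OF vspace_axioms vspace_axioms left_linear])

lemma comult_expand: "x \<in> carrier H \<Longrightarrow> comult H x = (\<Oplus>\<^bsub>T\<^esub>v\<in>idx. tensor H H (left v x) (mon v))"
  unfolding left_def by (rule theta_expand) simp

text \<open>In the product of the three expansions every right factor is \<open>b^t a^s g^k\<close>
  with \<open>t \<le> j\<close> and \<open>s \<le> i\<close>, hence already reduced, and
  \<open>coord\<close> selects at most one summand. The bounds on \<open>t\<close> and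
  \<open>s\<close> can be omitted from the statement because \<open>coeff_b\<close> and
  \<open>coeff_a\<close> vanish beyond them.\<close>

lemma left_mon:
  assumes u: "(j, i, k) \<in> idx" and v: "(t, s, l) \<in> idx"
  shows "left (t, s, l) (mon (j, i, k)) = (if k = l then coeff_b j t \<otimes> coeff_a i s \<otimes> g [^] k else \<zero>)"
proof -
  let ?v = "(t, s, l)"
  define X where "X t = tensor H H (coeff_b j t) (b [^] t)" for t
  define Y where "Y s = tensor H H (coeff_a i s) (a [^] s)" for s
  define Z where "Z = tensor H H (g [^] k) (g [^] k)"
  have [simp]: "X t \<in> carrier T" "Y s \<in> carrier T" "Z \<in> carrier T" for t s
    by (simp_all add: X_def Y_def Z_def)
  have [simp]: "finsum T Y I \<in> carrier T" "finsum T X I \<in> carrier T" for I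
    by (rule tensor.T.finsum_closed; simp)+
  note hp = algebra_hom_power[OF assoc_alg_axioms assoc_alg_T comult_hom]
  have "comult H (mon (j, i, k)) = (\<Oplus>\<^bsub>T\<^esub>t\<in>{..j}. X t) \<otimes>\<^bsub>T\<^esub> ((\<Oplus>\<^bsub>T\<^esub>s\<in>{..i}. Y s) \<otimes>\<^bsub>T\<^esub> Z)"
    by (simp add: mon_def comult_simps hp comult_b_power comult_a_power H3.B.m_assoc
        X_def[symmetric] Y_def[symmetric])
      (simp add: Z_def comult_g_def tensor.tensor_power)
  also have "\<dots> = (\<Oplus>\<^bsub>T\<^esub>t\<in>{..j}. X t \<otimes>\<^bsub>T\<^esub> ((\<Oplus>\<^bsub>T\<^esub>s\<in>{..i}. Y s) \<otimes>\<^bsub>T\<^esub> Z))"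
    by (rule linear_map_sum[OF tensor.vspace_T tensor.vspace_T tensor.tensor_mult_linear_left]) simp_all
  finally have "left ?v (mon (j, i, k)) = (\<Oplus>t'\<in>{..j}. theta ?v (X t' \<otimes>\<^bsub>T\<^esub> ((\<Oplus>\<^bsub>T\<^esub>s\<in>{..i}. Y s) \<otimes>\<^bsub>T\<^esub> Z)))"
    by (simp add: left_def theta_sum)
  also have "\<dots> = (\<Oplus>t'\<in>{..j}. \<Oplus>s'\<in>{..i}. theta ?v (X t' \<otimes>\<^bsub>T\<^esub> (Y s' \<otimes>\<^bsub>T\<^esub> Z)))"
  proof (rule finsum_cong')
    fix t'
    have "linear_map T H (\<lambda>y. theta ?v (X t' \<otimes>\<^bsub>T\<^esub> (y \<otimes>\<^bsub>T\<^esub> Z)))"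
      by (rule linear_map_comp[OF linear_map_comp[OF tensor.tensor_mult_linear_left tensor.tensor_mult_linear_right]
            theta_linear]) simp_all
    from linear_map_sum[OF tensor.vspace_T vspace_axioms this, of "{..i}" Y]
    show "theta ?v (X t' \<otimes>\<^bsub>T\<^esub> ((\<Oplus>\<^bsub>T\<^esub>s\<in>{..i}. Y s) \<otimes>\<^bsub>T\<^esub> Z)) = (\<Oplus>s'\<in>{..i}. theta ?v (X t' \<otimes>\<^bsub>T\<^esub> (Y s' \<otimes>\<^bsub>T\<^esub> Z)))"
      by simp
  qed (auto intro!: finsum_closed simp: theta_simps)
  also have "\<dots> = (\<Oplus>t'\<in>{..j}. \<Oplus>s'\<in>{..i}. if t' = t \<and> s' = s \<and> k = l then coeff_b j t \<otimes> coeff_a i s \<otimes> g [^] k else \<zero>)"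
  proof (intro finsum_cong' refl)
    fix t' s' assume "t' \<in> {..j}" "s' \<in> {..i}"
    then have "(t', s', k) \<in> idx" using u by (simp add: idx_def)
    moreover have "X t' \<otimes>\<^bsub>T\<^esub> (Y s' \<otimes>\<^bsub>T\<^esub> Z) =
        tensor H H (coeff_b j t' \<otimes> coeff_a i s' \<otimes> g [^] k) (mon (t', s', k))"
      by (simp add: X_def Y_def Z_def mon_def m_assoc)
    ultimately show "theta ?v (X t' \<otimes>\<^bsub>T\<^esub> (Y s' \<otimes>\<^bsub>T\<^esub> Z)) =
        (if t' = t \<and> s' = s \<and> k = l then coeff_b j t \<otimes> coeff_a i s \<otimes> g [^] k else \<zero>)"
      by (auto simp: coord_mono)
  qed (auto intro!: finsum_closed)
  also have "\<dots> = (if t \<le> j \<and> s \<le> i \<and> k = l then coeff_b j t \<otimes> coeff_a i s \<otimes> g [^] k else \<zero>)"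
  proof -
    let ?c = "coeff_b j t \<otimes> coeff_a i s \<otimes> g [^] k"
    have 1: "(\<Oplus>s'\<in>{..i}. if t' = t \<and> s' = s \<and> k = l then ?c else \<zero>) =
        (if t' = t \<and> s \<le> i \<and> k = l then ?c else \<zero>)" for t'
    proof (cases "t' = t \<and> s \<le> i \<and> k = l")
      case True
      then show ?thesis by (subst sum_single[of _ s]) auto
    next
      case False
      then have "(\<Oplus>s'\<in>{..i}. if t' = t \<and> s' = s \<and> k = l then ?c else \<zero>) = (\<Oplus>s'\<in>{..i}. \<zero>)"
        by (intro finsum_cong') auto
      with False show ?thesis by auto
    qed
    show ?thesis
    proof (cases "t \<le> j \<and> s \<le> i \<and> k = l")
      case True
      then show ?thesis unfolding 1 by (subst sum_single[of _ t]) auto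
    next
      case False
      then have "(\<Oplus>t'\<in>{..j}. if t' = t \<and> s \<le> i \<and> k = l then ?c else \<zero>) = (\<Oplus>t'\<in>{..j}. \<zero>)"
        by (intro finsum_cong') auto
      with False show ?thesis unfolding 1 by auto
    qed
  qed
  also have "\<dots> = (if k = l then coeff_b j t \<otimes> coeff_a i s \<otimes> g [^] k else \<zero>)"
    by auto
  finally show ?thesis .
qed

lemma left_sum: "x \<in> carrier H \<Longrightarrow> left v x = (\<Oplus>u\<in>idx. coord u x \<odot> left v (mon u))"
proof -
  assume x: "x \<in> carrier H"
  have "left v (\<Oplus>u\<in>idx. coord u x \<odot> mon u) = (\<Oplus>u\<in>idx. left v (coord u x \<odot> mon u))"
    by (rule linear_map_sum[OF vspace_axioms vspace_axioms left_linear]) auto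
  also have "(\<Oplus>u\<in>idx. coord u x \<odot> mon u) = x" by (rule expand[OF x, symmetric])
  finally show ?thesis by (simp add: left_simps)
qed

section \<open>The filtration by degree\<close>

definition filt :: "nat \<Rightarrow> 'v set" where
  "filt m = {x \<in> carrier H. \<forall>u\<in>idx. m < deg u \<longrightarrow> coord u x = 0}"

definition homog :: "nat \<Rightarrow> 'v set" where
  "homog m = {x \<in> carrier H. \<forall>u\<in>idx. deg u \<noteq> m \<longrightarrow> coord u x = 0}"

lemma filt_subspace: "subspace_of (filt m) H"
  by (rule subspaceI) (auto simp: filt_def coord_simps)

lemma homog_subspace: "subspace_of (homog m) H"
  by (rule subspaceI) (auto simp: homog_def coord_simps)

lemmas filt_sub = subspaceD[OF filt_subspace]

lemma filt_mono: "m \<le> m' \<Longrightarrow> filt m \<subseteq> filt m'"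
  by (auto simp: filt_def)

lemma filt_top: "x \<in> carrier H \<Longrightarrow> x \<in> filt (2 * p)"
  by (auto simp: filt_def idx_def)

lemma mon_filt: "j + i \<le> m \<Longrightarrow> mon (j, i, k) \<in> filt m"
  by (rule mon_mem[OF filt_subspace]) (auto simp: filt_def coord_mono)

lemma g_power_filt: "g [^] (k::nat) \<in> filt m"
  using mon_filt[of 0 0 m k] by (simp add: mon_def)

lemma coeff_filt_zero: "coeff_b j j \<otimes> coeff_a i i \<otimes> g [^] k = g [^] (j + i + k)"
  by (simp add: coeff_b_def coeff_a_def nat_pow_mult)

text \<open>A monomial contributes only if its exponents of \<open>b\<close> and \<open>a\<close>
  are at least \<open>t\<close> and \<open>s\<close> and its exponent of \<open>g\<close> is
  \<open>k\<close>. Up to degree \<open>t + s\<close> this leaves \<open>mon (t, s, k)\<close>,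
  whose left factor is a power of \<open>g\<close>.\<close>

lemma left_top:
  assumes x: "x \<in> filt d" and v: "(t, s, k) \<in> idx" "t + s = d"
  shows "left (t, s, k) x = coord (t, s, k) x \<odot> g [^] (t + s + k)"
proof -
  have xc: "x \<in> carrier H" using x filt_sub(1) by auto
  have "(\<Oplus>u\<in>idx. coord u x \<odot> left (t, s, k) (mon u)) = coord (t, s, k) x \<odot> left (t, s, k) (mon (t, s, k))"
  proof (rule sum_single[OF finite_idx v(1)])
    fix u assume u: "u \<in> idx" "u \<noteq> (t, s, k)"
    obtain j i l where u': "u = (j, i, l)" by (cases u)
    consider "d < deg u" | "j < t \<or> i < s \<or> l \<noteq> k" using u u' v(2) by fastforce
    then show "coord u x \<odot> left (t, s, k) (mon u) = \<zero>"
    proof cases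
      case 1
      then have "coord u x = 0" using x u by (simp add: filt_def)
      then show ?thesis by (simp add: left_simps)
    next
      case 2
      then show ?thesis using u v unfolding u' by (auto simp: left_mon)
    qed
  qed (simp add: left_simps)
  then show ?thesis using v by (simp add: left_sum[OF xc] left_mon coeff_filt_zero)
qed

lemma mon_mod_idx: "mon (j, i, k) = mon (j, i, k mod n)"
  by (simp add: mon_mod)

lemma coord_mon_mod:
  assumes "j < p" "i < p"
  shows "coord (j', i', l mod n) (mon (j, i, k)) = (if j' = j \<and> i' = i \<and> l mod n = k mod n then 1 else 0)"
proof -
  have "(j, i, k mod n) \<in> idx" using assms n_pos by (simp add: idx_def)
  then show ?thesis by (subst mon_mod_idx) (auto simp: coord_mono)
qed

text \<open>Moving \<open>g [^] t\<close> to the right turns \<open>slope (t / 2)\<close> into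
  \<open>slope (- t / 2)\<close>. The resulting term in \<open>a\<close> is the reason why
  \<open>filt_descent\<close> settles the coordinates with positive exponent of \<open>b\<close>
  before the others.\<close>

lemma degree_one_b: "coeff_b (Suc t) t \<otimes> coeff_a s s \<otimes> g [^] k =
   of_nat (Suc t) \<odot> mon (1, 0, t + s + k) \<oplus> (of_nat (Suc t) * (- (of_nat t / 2))) \<odot> mon (0, 1, t + s + k)"
proof -
  have coeff_p_diag: "coeff_a s s = g [^] s" by (simp add: coeff_a_def)
  have "g [^] t \<otimes> slope (of_nat t / 2) = slope (- (of_nat t / 2)) \<otimes> g [^] t"
    by (simp add: slope_g_power field_simps)
  then have "coeff_b (Suc t) t = of_nat (Suc t) \<odot> (slope (- (of_nat t / 2)) \<otimes> g [^] t)"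
    by (simp add: coeff_b_def del: of_nat_Suc)
  then have "coeff_b (Suc t) t \<otimes> coeff_a s s \<otimes> g [^] k = of_nat (Suc t) \<odot> (slope (- (of_nat t / 2)) \<otimes> g [^] (t + s + k))"
    using coeff_p_diag by (simp add: scale_mult_left m_assoc nat_pow_mult add.assoc del: of_nat_Suc)
  then show ?thesis
    by (simp add: slope_def mon_def l_distr scale_mult_left scale_add_right del: of_nat_Suc)
qed

lemma degree_one_a: "coeff_b t t \<otimes> coeff_a (Suc s) s \<otimes> g [^] k = of_nat (Suc s) \<odot> mon (0, 1, t + s + k)"
proof -
  have "g [^] t \<otimes> (g [^] s \<otimes> a) \<otimes> g [^] k = (g [^] (t + s) \<otimes> a) \<otimes> g [^] k"
    by (simp add: m_assoc[symmetric] nat_pow_mult)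
  also have "g [^] (t + s) \<otimes> a = a \<otimes> g [^] (t + s)"
    using a_power_g_power[of 1 "t + s"] by simp
  also have "a \<otimes> g [^] (t + s) \<otimes> g [^] k = a \<otimes> g [^] (t + s + k)"
    by (simp add: m_assoc nat_pow_mult)
  finally have "g [^] t \<otimes> (g [^] s \<otimes> a) \<otimes> g [^] k = a \<otimes> g [^] (t + s + k)" .
  moreover have "coeff_b t t = g [^] t" by (simp add: coeff_b_def)
  moreover have "coeff_a (Suc s) s = of_nat (Suc s) \<odot> (g [^] s \<otimes> a)" by (simp add: coeff_a_def del: of_nat_Suc)
  ultimately show ?thesis
    by (simp add: mon_def scale_mult_left scale_mult_right del: of_nat_Suc)
qed

text \<open>
  The coordinates of \<open>x\<close> of degree \<open>m + 1\<close> can be read off from the degree one parts of the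
  \<open>left v x\<close> with \<open>deg v = m\<close>, up to the nonzero factors \<open>1, \<dots>, p - 1\<close>.
\<close>

lemma filt_descent:
  assumes x: "x \<in> filt (Suc m)" and left0: "\<And>v. v \<in> idx \<Longrightarrow> deg v = m \<Longrightarrow> left v x \<in> filt 0"
  shows "x \<in> filt m"
proof -
  have xc: "x \<in> carrier H" using x filt_sub(1) by auto
  have p2: "Suc 0 < p" using p_gt_2 by simp
  have z: "(\<Sum>u\<in>idx. coord u x * coord w (left v (mon u))) = 0"
    if "v \<in> idx" "deg v = m" "w \<in> idx" "deg w = 1" for v w
  proof -
    have "coord w (left v x) = 0" using left0[OF that(1,2)] that(3,4) by (auto simp: filt_def)
    then show ?thesis by (simp add: left_sum[OF xc] coord_sum left_simps coord_simps)
  qed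
  \<comment> \<open>Apart from the two monomials next above \<open>(t, s, k)\<close>, nothing
    contributes in degree one: the coordinate of \<open>x\<close> vanishes, or the left factor is
    zero, or it is a power of \<open>g\<close>.\<close>
  have cases: "coord u x * coord w (left (t, s, k) (mon u)) = 0"
    if u: "u \<in> idx" and v: "(t, s, k) \<in> idx" "t + s = m" and w: "w \<in> idx" "deg w = 1"
      and "u = (Suc t, s, k) \<Longrightarrow> coord u x * coord w (left (t, s, k) (mon u)) = 0"
      "u = (t, Suc s, k) \<Longrightarrow> coord u x * coord w (left (t, s, k) (mon u)) = 0" for u t s k w
  proof -
    obtain j i l where u': "u = (j, i, l)" by (cases u)
    consider "Suc m < deg u" | "j < t \<or> i < s \<or> l \<noteq> k" | "u = (t, s, k)" | "u = (Suc t, s, k)" | "u = (t, Suc s, k)"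
      using u' v(2) by fastforce
    then show ?thesis
    proof cases
      case 1
      then show ?thesis using x u by (simp add: filt_def)
    next
      case 2
      then show ?thesis using u v unfolding u' by (auto simp: left_mon)
    next
      case 3
      then have "left (t, s, k) (mon u) = g [^] (t + s + k)" using v by (simp add: left_mon coeff_filt_zero)
      then show ?thesis using g_power_filt[of "t + s + k" 0] w by (simp add: filt_def)
    qed (use that in auto)
  qed
  \<comment> \<open>The coordinate at \<open>mon (1, 0, _)\<close> separates the two: by
    \<open>degree_one_a\<close> the monomial with one more \<open>a\<close> contributes only to
    \<open>mon (0, 1, _)\<close>.\<close>
  have b: "coord (Suc t, s, k) x = 0" if u: "(Suc t, s, k) \<in> idx" and "t + s = m" for t s k
  proof -
    let ?w = "(1, 0, (t + s + k) mod n)" and ?u = "(Suc t, s, k)" and ?v = "(t, s, k)"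
    have v: "?v \<in> idx" and w: "?w \<in> idx" using u p2 n_pos by (auto simp: idx_def)
    have "(\<Sum>u\<in>idx. coord u x * coord ?w (left ?v (mon u))) = coord ?u x * coord ?w (left ?v (mon ?u))"
    proof (subst sum.remove[OF finite_idx u], subst sum.neutral)
      show "\<forall>u\<in>idx - {?u}. coord u x * coord ?w (left ?v (mon u)) = 0"
      proof
        fix u' assume u': "u' \<in> idx - {?u}"
        show "coord u' x * coord ?w (left ?v (mon u')) = 0"
          by (rule cases[OF _ v that(2) w])
            (use u' v p2 in \<open>auto simp: left_mon degree_one_a coord_simps coord_mon_mod simp del: of_nat_Suc\<close>)
      qed
    qed simp
    also have "coord ?w (left ?v (mon ?u)) = of_nat (Suc t)"
      using u v p2 by (simp add: left_mon degree_one_b coord_simps coord_mon_mod del: of_nat_Suc)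
    finally have "coord ?u x * of_nat (Suc t) = 0" using z[OF v _ w] that(2) by simp
    then show ?thesis using of_nat_nonzero[of "Suc t"] u by (auto simp: idx_def simp del: of_nat_Suc)
  qed
  \<comment> \<open>Only \<open>t = 0\<close> is left. The monomial \<open>(1, s, k)\<close>, which
    could also contribute to \<open>mon (0, 1, _)\<close>, has coordinate zero by
    \<open>b\<close>.\<close>
  have a: "coord (0, Suc s, k) x = 0" if u: "(0, Suc s, k) \<in> idx" and "s = m" for s k
  proof -
    let ?w = "(0, 1, (s + k) mod n)" and ?u = "(0, Suc s, k)" and ?v = "(0, s, k)"
    have v: "?v \<in> idx" and w: "?w \<in> idx" using u p2 n_pos by (auto simp: idx_def)
    have "(\<Sum>u\<in>idx. coord u x * coord ?w (left ?v (mon u))) = coord ?u x * coord ?w (left ?v (mon ?u))"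
    proof (subst sum.remove[OF finite_idx u], subst sum.neutral)
      show "\<forall>u\<in>idx - {?u}. coord u x * coord ?w (left ?v (mon u)) = 0"
      proof
        fix u' assume u': "u' \<in> idx - {?u}"
        show "coord u' x * coord ?w (left ?v (mon u')) = 0"
          by (rule cases[OF _ v _ w]) (use u' that b[of 0 s k] in auto)
      qed
    qed simp
    also have "coord ?w (left ?v (mon ?u)) = of_nat (Suc s)"
      using u v p2 degree_one_a[of 0 s k] by (simp add: left_mon coord_simps coord_mon_mod del: of_nat_Suc)
    finally have "coord ?u x * of_nat (Suc s) = 0" using z[OF v _ w] that(2) by simp
    then show ?thesis using of_nat_nonzero[of "Suc s"] u by (auto simp: idx_def simp del: of_nat_Suc)
  qed
  have "coord u x = 0" if u: "u \<in> idx" "m < deg u" for u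
  proof (cases "deg u = Suc m")
    case True
    obtain j i k where u': "u = (j, i, k)" by (cases u)
    show ?thesis
    proof (cases j)
      case 0
      then show ?thesis using a[of m k] True u u' by simp
    next
      case (Suc t)
      then show ?thesis using b[of t i k] True u u' by simp
    qed
  next
    case False
    then show ?thesis using x u by (simp add: filt_def)
  qed
  with xc show ?thesis by (simp add: filt_def)
qed

lemma tensor_span_carrier:
  assumes "D \<subseteq> carrier H" "E \<subseteq> carrier H"
  shows "subspace_of (tensor_sub H D E) T" "\<And>x y. x \<in> D \<Longrightarrow> y \<in> E \<Longrightarrow> tensor H H x y \<in> tensor_sub H D E"
proof -
  have "{tensor H H x y | x y. x \<in> D \<and> y \<in> E} \<subseteq> carrier T"
    by (auto simp: subsetD[OF assms(1)] subsetD[OF assms(2)])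
  then show "subspace_of (tensor_sub H D E) T" unfolding tensor_sub_def by (rule tensor.T.span_subspace)
  show "tensor H H x y \<in> tensor_sub H D E" if "x \<in> D" "y \<in> E" for x y
    unfolding tensor_sub_def by (rule subsetD[OF tensor.T.span_superset]) (use that in blast)
qed

lemma tensor_sub_theta:
  assumes "D \<subseteq> carrier H" "E \<subseteq> carrier H" "subspace_of W H" "t \<in> tensor_sub H D E"
    "\<And>x y. x \<in> D \<Longrightarrow> y \<in> E \<Longrightarrow> coord v y \<odot> x \<in> W"
  shows "theta v t \<in> W"
proof -
  have "tensor_sub H D E \<subseteq> {t \<in> carrier T. theta v t \<in> W}"
    unfolding tensor_sub_def
  proof (rule tensor.T.span_minimal[OF linear_map_preimage[OF tensor.vspace_T vspace_axioms theta_linear assms(3)]], rule subsetI)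
    fix t assume "t \<in> {tensor H H x y |x y. x \<in> D \<and> y \<in> E}"
    then obtain x y where t: "t = tensor H H x y" "x \<in> D" "y \<in> E" by auto
    then have "x \<in> carrier H" "y \<in> carrier H" using assms(1,2) by auto
    then show "t \<in> {t \<in> carrier T. theta v t \<in> W}" using t assms(5) by simp
  qed
  with assms(4) show ?thesis by auto
qed

section \<open>Group-like lines, pointedness and the coradical\<close>

definition glike :: "nat \<Rightarrow> 'v set" where
  "glike k = {c \<odot> g [^] k | c. True}"

lemma comult_g_power: "comult H (g [^] (k::nat)) = tensor H H (g [^] k) (g [^] k)"
  using algebra_hom_power[OF assoc_alg_axioms assoc_alg_T comult_hom, of g k]
  by (simp add: comult_g_def tensor.tensor_power)

lemma g_power_nonzero: "g [^] (k::nat) \<noteq> \<zero>"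
proof
  assume "g [^] k = \<zero>"
  then have "coord (0, 0, k mod n) (mon (0, 0, k)) = 0" by (simp add: mon_def)
  then show False using p_gt_2 by (simp add: coord_mon_mod)
qed

lemma glike_subspace: "subspace_of (glike k) H"
proof (rule subspaceI)
  have "\<zero> = 0 \<odot> g [^] k" by simp
  then show "\<zero> \<in> glike k" unfolding glike_def by blast
next
  fix x y assume "x \<in> glike k" "y \<in> glike k"
  then obtain c d where "x = c \<odot> g [^] k" "y = d \<odot> g [^] k" by (auto simp: glike_def)
  then have "x \<oplus> y = (c + d) \<odot> g [^] k" by (simp add: scale_add_left)
  then show "x \<oplus> y \<in> glike k" unfolding glike_def by blast
next
  show "glike k \<subseteq> carrier H" by (auto simp: glike_def)
  fix c x assume "x \<in> glike k"
  then obtain d where "x = d \<odot> g [^] k" by (auto simp: glike_def)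
  then have "c \<odot> x = (c * d) \<odot> g [^] k" by simp
  then show "c \<odot> x \<in> glike k" unfolding glike_def by blast
qed

lemma g_power_glike: "g [^] k \<in> glike k"
  unfolding glike_def by (intro CollectI exI[of _ 1]) simp

lemma glike_subcoalgebra: "subcoalgebra H (glike k)"
proof -
  have gc: "glike k \<subseteq> carrier H" by (rule subspaceD(1)[OF glike_subspace])
  note D = tensor_span_carrier[OF gc gc]
  have "comult H (c \<odot> g [^] k) \<in> tensor_sub H (glike k) (glike k)" for c
    by (simp add: comult_simps comult_g_power tensor.T.subspaceD(4)[OF D(1)] D(2) g_power_glike)
  then have "comult H x \<in> tensor_sub H (glike k) (glike k)" if "x \<in> glike k" for x
    using that unfolding glike_def by blast
  then show ?thesis unfolding subcoalgebra_def using glike_subspace by blast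
qed

lemma glike_minimal:
  assumes "subspace_of E H" "E \<subseteq> glike k" "E \<noteq> {\<zero>}"
  shows "E = glike k"
proof
  note E = subspaceD[OF assms(1)]
  obtain x where x: "x \<in> E" "x \<noteq> \<zero>" using assms(3) E(2) by auto
  then obtain c where c: "x = c \<odot> g [^] k" using assms(2) by (auto simp: glike_def)
  with x have "c \<noteq> 0" by auto
  then have "(1 / c) \<odot> x = g [^] k" unfolding c by simp
  with E(4)[OF x(1), of "1 / c"] have "g [^] k \<in> E" by simp
  then show "glike k \<subseteq> E" using E(4) unfolding glike_def by blast
qed fact

lemma simple_glike: "simple_subcoalgebra H (glike k)"
  unfolding simple_subcoalgebra_def
proof (intro conjI allI impI glike_subcoalgebra)
  show "glike k \<noteq> {\<zero>}" using g_power_glike[of k] g_power_nonzero[of k] by blast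
  fix E assume E: "subcoalgebra H E \<and> E \<subseteq> glike k"
  then have "subspace_of E H" by (simp add: subcoalgebra_def)
  with E show "E = {\<zero>} \<or> E = glike k" using glike_minimal by blast
qed

text \<open>The coefficient of a top-degree monomial in the right factor of the coproduct is group-like.\<close>

lemma subcoalgebra_contains_glike:
  assumes D: "subcoalgebra H D" "D \<noteq> {\<zero>}"
  obtains k where "glike k \<subseteq> D"
proof -
  have sub: "subspace_of D H" using D by (simp add: subcoalgebra_def)
  note S = subspaceD[OF sub]
  obtain x where x: "x \<in> D" "x \<noteq> \<zero>" using D(2) S(2) by auto
  then have xc: "x \<in> carrier H" using S(1) by auto
  let ?N = "deg ` {u \<in> idx. coord u x \<noteq> 0}"
  have "{u \<in> idx. coord u x \<noteq> 0} \<noteq> {}"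
    using coord_eqI[OF xc, of \<zero>] x(2) by auto
  moreover have fin: "finite ?N" by simp
  ultimately have "Max ?N \<in> ?N" by (intro Max_in) auto
  then obtain v where v: "v \<in> idx" "coord v x \<noteq> 0" "deg v = Max ?N" by force
  have "x \<in> filt (deg v)"
    unfolding filt_def v(3) using xc Max_ge[OF fin] by (fastforce simp: not_le[symmetric])
  moreover obtain t s k where v': "v = (t, s, k)" by (cases v)
  ultimately have L: "left v x = coord v x \<odot> g [^] (t + s + k)" using left_top v by simp
  have "left v x \<in> D"
    unfolding left_def
    by (rule tensor_sub_theta[OF S(1) S(1) sub, of _]) (use D(1) x(1) S(4) in \<open>auto simp: subcoalgebra_def\<close>)
  then have "(1 / coord v x) \<odot> left v x \<in> D" by (rule S(4))
  then have "g [^] (t + s + k) \<in> D" using v(2) by (simp add: L)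
  then have "glike (t + s + k) \<subseteq> D" using S(4) unfolding glike_def by blast
  then show ?thesis by (rule that)
qed

lemma simple_subcoalgebra_iff: "simple_subcoalgebra H D \<longleftrightarrow> (\<exists>k. D = glike k)"
proof
  assume D: "simple_subcoalgebra H D"
  then obtain k where k: "glike k \<subseteq> D"
    using subcoalgebra_contains_glike by (auto simp: simple_subcoalgebra_def)
  then have "D = glike k"
    using D glike_subcoalgebra[of k] g_power_glike[of k] g_power_nonzero[of k]
    unfolding simple_subcoalgebra_def by blast
  then show "\<exists>k. D = glike k" ..
qed (auto intro: simple_glike)

lemma pointed: "pointed H"
proof -
  have "has_dim (H\<lparr>carrier := glike k\<rparr>) 1" for k
  proof -
    have fs: "(\<Oplus>\<^bsub>H\<lparr>carrier := glike k\<rparr>\<^esub>i\<in>{..<1::nat}. c i \<odot>\<^bsub>H\<lparr>carrier := glike k\<rparr>\<^esub> g [^] k) = c 0 \<odot> g [^] k" for c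
    proof -
      interpret S: vspace "H\<lparr>carrier := glike k\<rparr>"
        unfolding vspace_def using glike_subspace vspace_axioms
        by (intro submodule.submodule_is_module) (auto simp: vspace_def)
      have "c 0 \<odot> g [^] k \<in> carrier (H\<lparr>carrier := glike k\<rparr>)" by (auto simp: glike_def)
      then show ?thesis by (simp add: lessThan_Suc)
    qed
    have inj: "c = d" if "c \<odot> g [^] k = d \<odot> g [^] k" for c d
    proof -
      have "coord (0, 0, k mod n) (c \<odot> mon (0, 0, k)) = coord (0, 0, k mod n) (d \<odot> mon (0, 0, k))"
        using that by (simp add: mon_def)
      then show ?thesis using p_gt_2 by (simp add: coord_simps coord_mon_mod)
    qed
    show ?thesis unfolding has_dim_def
    proof (intro exI[of _ "\<lambda>_. g [^] k"] conjI ballI allI impI)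
      fix x assume "x \<in> carrier (H\<lparr>carrier := glike k\<rparr>)"
      then obtain c where c: "x = c \<odot> g [^] k" by (auto simp: glike_def)
      show "\<exists>!c. c \<in> {..<1::nat} \<rightarrow>\<^sub>E UNIV \<and>
          x = (\<Oplus>\<^bsub>H\<lparr>carrier := glike k\<rparr>\<^esub>i\<in>{..<1}. c i \<odot>\<^bsub>H\<lparr>carrier := glike k\<rparr>\<^esub> g [^] k)"
        unfolding fs
      proof (rule ex1I[of _ "restrict (\<lambda>_. c) {..<1}"])
        fix d assume d: "d \<in> {..<1::nat} \<rightarrow>\<^sub>E UNIV \<and> x = d 0 \<odot> g [^] k"
        then have "d 0 = c" using inj c by auto
        show "d = restrict (\<lambda>_. c) {..<1}"
        proof
          fix i show "d i = restrict (\<lambda>_. c) {..<1} i"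
            using d \<open>d 0 = c\<close> PiE_arb[of d "{..<1}" "\<lambda>_. UNIV" i] by (cases "i = 0") auto
        qed
      qed (simp add: c)
    qed (simp add: g_power_glike)
  qed
  then show ?thesis by (auto simp: pointed_def simple_subcoalgebra_iff)
qed

lemma coradical_eq: "coradical H = filt 0"
proof
  have "glike k \<subseteq> filt 0" for k using g_power_filt[of k 0] filt_sub(4) unfolding glike_def by blast
  then show "coradical H \<subseteq> filt 0"
    unfolding coradical_def by (intro span_minimal filt_subspace) (auto simp: simple_subcoalgebra_iff subset_iff)
  have g: "(\<Union>{D. simple_subcoalgebra H D}) \<subseteq> carrier H"
    using subspaceD(1)[OF glike_subspace] by (auto simp: simple_subcoalgebra_iff)
  note C = span_subspace[OF g, folded coradical_def]
  show "filt 0 \<subseteq> coradical H"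
  proof
    fix x assume x: "x \<in> filt 0"
    then have xc: "x \<in> carrier H" using filt_sub(1) by auto
    have "(\<Oplus>v\<in>idx. coord v x \<odot> mon v) \<in> coradical H"
    proof (rule subspace_sum[OF C])
      fix v assume v: "v \<in> idx"
      show "coord v x \<odot> mon v \<in> coradical H"
      proof (cases "deg v = 0")
        case True
        then obtain k where "v = (0, 0, k)" by (cases v) auto
        then have "mon v \<in> glike k" using g_power_glike by (simp add: mon_def)
        then have "mon v \<in> coradical H"
          unfolding coradical_def by (intro subsetD[OF span_superset]) (use simple_glike in blast)
        then show ?thesis by (rule subspaceD(4)[OF C])
      next
        case False
        then show ?thesis using x v subspaceD(2)[OF C] by (simp add: filt_def)
      qed
    qed
    then show "x \<in> coradical H" by (simp only: expand[OF xc, symmetric])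
  qed
qed

end

section \<open>Comparing leading terms with the graded case\<close>

text \<open>
  \<open>B\<close> is the case \<open>lam = mu = 0\<close>. \<open>rel m x x'\<close> says that \<open>x\<close> has degree at most \<open>m\<close> and that its
  component of degree \<open>m\<close> is the homogeneous element \<open>x'\<close> of \<open>B\<close>. As \<open>rel\<close> is compatible with all
  operations, so are the filtration of \<open>H\<close> and the grading of \<open>B\<close>.
\<close>

locale lifting_pair = H: hopf_lifting H p n lam mu a b g + B: hopf_lifting B p n 0 0 a' b' g'
  for H :: "('k::field, 'v) hopf" and B :: "('k, 'w) hopf" and p n lam mu a b g a' b' g'
begin

definition rel :: "nat \<Rightarrow> 'v \<Rightarrow> 'w \<Rightarrow> bool" where
  "rel m x x' \<longleftrightarrow> x \<in> H.filt m \<and> x' \<in> B.homog m \<and>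
     (\<forall>u\<in>H.idx. H.deg u = m \<longrightarrow> H.coord u x = B.coord u x')"

lemma rel_closed: "rel m x x' \<Longrightarrow> x \<in> carrier H" "rel m x x' \<Longrightarrow> x' \<in> carrier B"
  by (auto simp: rel_def H.filt_def B.homog_def)

lemma rel_filt: "rel m x x' \<Longrightarrow> x \<in> H.filt m"
  and rel_homog: "rel m x x' \<Longrightarrow> x' \<in> B.homog m"
  by (auto simp: rel_def)

lemma rel_zero [simp]: "rel m \<zero>\<^bsub>H\<^esub> \<zero>\<^bsub>B\<^esub>"
  by (simp add: rel_def H.filt_def B.homog_def)

lemma rel_add: "rel m x x' \<Longrightarrow> rel m y y' \<Longrightarrow> rel m (x \<oplus>\<^bsub>H\<^esub> y) (x' \<oplus>\<^bsub>B\<^esub> y')"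
  by (auto simp: rel_def H.filt_def B.homog_def H.coord_simps B.coord_simps)

lemma rel_scale: "rel m x x' \<Longrightarrow> rel m (c \<odot>\<^bsub>H\<^esub> x) (c \<odot>\<^bsub>B\<^esub> x')"
  by (auto simp: rel_def H.filt_def B.homog_def H.coord_simps B.coord_simps)

lemma rel_lower: "x \<in> H.filt l \<Longrightarrow> l < m \<Longrightarrow> rel m x \<zero>\<^bsub>B\<^esub>"
  by (auto simp: rel_def H.filt_def B.homog_def)

lemma rel_sum:
  assumes "\<And>i. i \<in> I \<Longrightarrow> rel m (f i) (f' i)"
  shows "rel m (\<Oplus>\<^bsub>H\<^esub>i\<in>I. f i) (\<Oplus>\<^bsub>B\<^esub>i\<in>I. f' i)"
proof (cases "finite I")
  case True
  then show ?thesis using assms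
  proof (induction I)
    case (insert i I)
    have "f \<in> I \<rightarrow> carrier H" "f' \<in> I \<rightarrow> carrier B" "f i \<in> carrier H" "f' i \<in> carrier B"
      using insert.prems rel_closed by blast+
    then show ?case using insert by (simp add: rel_add)
  qed simp
qed (simp add: H.finsum_infinite B.finsum_infinite)

text \<open>Compatibility of two linear maps is decided on monomials: those of degree
  \<open>m\<close> must correspond, and those of lower degree must contribute nothing in degree
  \<open>l\<close>. The statements on products, antipode and coproduct are reduced to this.\<close>

lemma rel_map:
  assumes "rel m x x'" and f: "linear_map H H f" and f': "linear_map B B f'"
    and top: "\<And>u. u \<in> H.idx \<Longrightarrow> H.deg u = m \<Longrightarrow> rel l (f (H.mon u)) (f' (B.mon u))"
    and low: "\<And>u. u \<in> H.idx \<Longrightarrow> H.deg u < m \<Longrightarrow> rel l (f (H.mon u)) \<zero>\<^bsub>B\<^esub>"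
  shows "rel l (f x) (f' x')"
proof -
  note c = rel_closed[OF assms(1)]
  note F = linear_mapD[OF f] linear_map_zero[OF H.vspace_axioms H.vspace_axioms f] and F' = linear_mapD[OF f'] linear_map_zero[OF B.vspace_axioms B.vspace_axioms f']
  have "rel l (\<Oplus>\<^bsub>H\<^esub>u\<in>H.idx. f (H.coord u x \<odot>\<^bsub>H\<^esub> H.mon u)) (\<Oplus>\<^bsub>B\<^esub>u\<in>H.idx. f' (B.coord u x' \<odot>\<^bsub>B\<^esub> B.mon u))"
  proof (rule rel_sum)
    fix u assume u: "u \<in> H.idx"
    consider "H.deg u = m" | "H.deg u < m" | "m < H.deg u" by linarith
    then show "rel l (f (H.coord u x \<odot>\<^bsub>H\<^esub> H.mon u)) (f' (B.coord u x' \<odot>\<^bsub>B\<^esub> B.mon u))"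
    proof cases
      case 1
      then have "H.coord u x = B.coord u x'" using assms(1) u by (simp add: rel_def)
      then show ?thesis using rel_scale[OF top[OF u 1]] by (simp add: F F')
    next
      case 2
      then have "B.coord u x' = 0" using assms(1) u by (simp add: rel_def B.homog_def)
      then show ?thesis using rel_scale[OF low[OF u 2], of "H.coord u x"] by (simp add: F F')
    next
      case 3
      then have "H.coord u x = 0" "B.coord u x' = 0"
        using assms(1) u by (simp_all add: rel_def B.homog_def H.filt_def)
      then show ?thesis by (simp add: F F')
    qed
  qed
  moreover have "(\<Oplus>\<^bsub>H\<^esub>u\<in>H.idx. f (H.coord u x \<odot>\<^bsub>H\<^esub> H.mon u)) = f x"
    by (subst linear_map_sum[OF H.vspace_axioms H.vspace_axioms f, symmetric])
      (auto simp only: H.expand[OF c(1), symmetric] H.scale_closed H.mon_closed)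
  moreover have "(\<Oplus>\<^bsub>B\<^esub>u\<in>H.idx. f' (B.coord u x' \<odot>\<^bsub>B\<^esub> B.mon u)) = f' x'"
    by (subst linear_map_sum[OF B.vspace_axioms B.vspace_axioms f', symmetric])
      (auto simp only: B.expand[OF c(2), symmetric] B.scale_closed B.mon_closed)
  ultimately show ?thesis by simp
qed

text \<open>Reduced monomials correspond by definition. If an exponent reaches \<open>p\<close>, the
  monomial is zero in \<open>B\<close>, while in \<open>H\<close> it drops by \<open>p\<close>
  degrees and leaves nothing in degree \<open>j + i\<close>.\<close>

lemma rel_mon: "rel (j + i) (H.mon (j, i, k)) (B.mon (j, i, k))"
proof -
  have p2: "2 < p" by (rule H.p_gt_2)
  consider "p \<le> i" | "p \<le> j" | "i < p" "j < p" by linarith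
  then show ?thesis
  proof cases
    case 1
    then obtain i0 where i: "i = i0 + p" by (metis le_add_diff_inverse2)
    have m: "H.mon (j, i0, k') \<in> H.filt (j + i0)" for k' by (rule H.mon_filt) simp
    have "H.mon (j, i, k) \<in> H.filt (j + i0)"
      unfolding i H.mon_overflow_a using m H.filt_sub(3)[OF m H.filt_sub(4)[OF m]]
      by (simp add: a_minus_def H.minus_eq_scale H.filt_sub(4))
    moreover have "B.mon (j, i, k) = \<zero>\<^bsub>B\<^esub>" unfolding i B.mon_overflow_a by simp
    ultimately show ?thesis using rel_lower[of _ "j + i0"] i p2 by simp
  next
    case 2
    then obtain j0 where j: "j = j0 + p" by (metis le_add_diff_inverse2)
    have m: "H.mon (j0, i, k') \<in> H.filt (j0 + i)" for k' by (rule H.mon_filt) simp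
    have "H.mon (j, i, k) \<in> H.filt (j0 + i)"
      unfolding j H.mon_overflow_b using m H.filt_sub(3)[OF m H.filt_sub(4)[OF m]]
      by (simp add: a_minus_def H.minus_eq_scale H.filt_sub(4))
    moreover have "B.mon (j, i, k) = \<zero>\<^bsub>B\<^esub>" unfolding j B.mon_overflow_b by simp
    ultimately show ?thesis using rel_lower[of _ "j0 + i"] j p2 by simp
  next
    case 3
    then have v: "(j, i, k mod n) \<in> H.idx" using H.n_pos by (simp add: H.idx_def)
    show ?thesis
      unfolding H.mon_mod_idx[of j i k] B.mon_mod_idx[of j i k]
      using v by (auto simp: rel_def H.filt_def B.homog_def H.coord_mono B.coord_mono)
  qed
qed

lemma rel_mon': "rel (H.deg u) (H.mon u) (B.mon u)"
  using rel_mon by (cases u) simp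

text \<open>The rules \<open>mon_g\<close>, \<open>mon_a\<close> and \<open>mon_b\<close> have the
  same coefficients in \<open>H\<close> and in \<open>B\<close>.\<close>

lemma rel_mult_gens:
  assumes "rel m x x'"
  shows "rel m (x \<otimes>\<^bsub>H\<^esub> g) (x' \<otimes>\<^bsub>B\<^esub> g')"
    and "rel (Suc m) (x \<otimes>\<^bsub>H\<^esub> a) (x' \<otimes>\<^bsub>B\<^esub> a')"
    and "rel (Suc m) (x \<otimes>\<^bsub>H\<^esub> b) (x' \<otimes>\<^bsub>B\<^esub> b')"
proof -
  have lin: "linear_map H H (\<lambda>x. x \<otimes>\<^bsub>H\<^esub> y)" if "y \<in> carrier H" for y
    using that by (intro linear_mapI) (simp_all add: H.l_distr H.scale_mult_left)
  have lin': "linear_map B B (\<lambda>x. x \<otimes>\<^bsub>B\<^esub> y)" if "y \<in> carrier B" for y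
    using that by (intro linear_mapI) (simp_all add: B.l_distr B.scale_mult_left)
  have key: "rel (H.deg u) (H.mon u \<otimes>\<^bsub>H\<^esub> g) (B.mon u \<otimes>\<^bsub>B\<^esub> g')"
    "rel (Suc (H.deg u)) (H.mon u \<otimes>\<^bsub>H\<^esub> a) (B.mon u \<otimes>\<^bsub>B\<^esub> a')"
    "rel (Suc (H.deg u)) (H.mon u \<otimes>\<^bsub>H\<^esub> b) (B.mon u \<otimes>\<^bsub>B\<^esub> b')" for u
  proof -
    obtain j i k where u: "u = (j, i, k)" by (cases u)
    show "rel (H.deg u) (H.mon u \<otimes>\<^bsub>H\<^esub> g) (B.mon u \<otimes>\<^bsub>B\<^esub> g')"
      using rel_mon[of j i "Suc k"] by (simp add: u H.mon_g B.mon_g)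
    show "rel (Suc (H.deg u)) (H.mon u \<otimes>\<^bsub>H\<^esub> a) (B.mon u \<otimes>\<^bsub>B\<^esub> a')"
      using rel_mon[of j "Suc i" k] by (simp add: u H.mon_a B.mon_a)
    show "rel (Suc (H.deg u)) (H.mon u \<otimes>\<^bsub>H\<^esub> b) (B.mon u \<otimes>\<^bsub>B\<^esub> b')"
      using rel_add[OF rel_mon[of "Suc j" i k] rel_scale[of _ _ _ "- (of_nat k + of_nat i / 2)"]] rel_mon[of j "Suc i" k]
      by (simp add: u H.mon_b B.mon_b)
  qed
  show "rel m (x \<otimes>\<^bsub>H\<^esub> g) (x' \<otimes>\<^bsub>B\<^esub> g')"
    by (rule rel_map[OF assms lin lin']) (use key(1) rel_lower[OF rel_filt[OF key(1)]] in auto)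
  show "rel (Suc m) (x \<otimes>\<^bsub>H\<^esub> a) (x' \<otimes>\<^bsub>B\<^esub> a')"
    by (rule rel_map[OF assms lin lin']) (use key(2) rel_lower[OF rel_filt[OF key(2)]] in auto)
  show "rel (Suc m) (x \<otimes>\<^bsub>H\<^esub> b) (x' \<otimes>\<^bsub>B\<^esub> b')"
    by (rule rel_map[OF assms lin lin']) (use key(3) rel_lower[OF rel_filt[OF key(3)]] in auto)
qed

lemma rel_mult_mon:
  assumes "rel m x x'"
  shows "rel (m + H.deg u) (x \<otimes>\<^bsub>H\<^esub> H.mon u) (x' \<otimes>\<^bsub>B\<^esub> B.mon u)"
proof -
  note c [simp] = rel_closed[OF assms]
  obtain j i k where u: "u = (j, i, k)" by (cases u)
  have 1: "rel (m + j) (x \<otimes>\<^bsub>H\<^esub> b [^]\<^bsub>H\<^esub> j) (x' \<otimes>\<^bsub>B\<^esub> b' [^]\<^bsub>B\<^esub> j)"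
  proof (induction j)
    case (Suc j)
    then show ?case using rel_mult_gens(3)[OF Suc] by (simp add: H.m_assoc B.m_assoc)
  qed (use assms in simp)
  have 2: "rel (m + j + i) (x \<otimes>\<^bsub>H\<^esub> b [^]\<^bsub>H\<^esub> j \<otimes>\<^bsub>H\<^esub> a [^]\<^bsub>H\<^esub> i) (x' \<otimes>\<^bsub>B\<^esub> b' [^]\<^bsub>B\<^esub> j \<otimes>\<^bsub>B\<^esub> a' [^]\<^bsub>B\<^esub> i)"
  proof (induction i)
    case (Suc i)
    then show ?case using rel_mult_gens(2)[OF Suc] by (simp add: H.m_assoc B.m_assoc)
  qed (use 1 in simp)
  have "rel (m + j + i) (x \<otimes>\<^bsub>H\<^esub> b [^]\<^bsub>H\<^esub> j \<otimes>\<^bsub>H\<^esub> a [^]\<^bsub>H\<^esub> i \<otimes>\<^bsub>H\<^esub> g [^]\<^bsub>H\<^esub> k)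
      (x' \<otimes>\<^bsub>B\<^esub> b' [^]\<^bsub>B\<^esub> j \<otimes>\<^bsub>B\<^esub> a' [^]\<^bsub>B\<^esub> i \<otimes>\<^bsub>B\<^esub> g' [^]\<^bsub>B\<^esub> k)"
  proof (induction k)
    case (Suc k)
    then show ?case using rel_mult_gens(1)[OF Suc] by (simp add: H.m_assoc B.m_assoc)
  qed (use 2 in simp)
  then show ?thesis by (simp add: u H.mon_def B.mon_def H.m_assoc B.m_assoc add.assoc)
qed

lemma rel_mult:
  assumes x: "rel m x x'" and y: "rel l y y'"
  shows "rel (m + l) (x \<otimes>\<^bsub>H\<^esub> y) (x' \<otimes>\<^bsub>B\<^esub> y')"
proof (rule rel_map[OF y])
  show "linear_map H H (\<lambda>y. x \<otimes>\<^bsub>H\<^esub> y)" "linear_map B B (\<lambda>y. x' \<otimes>\<^bsub>B\<^esub> y)"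
    using rel_closed[OF x] by (auto intro!: linear_mapI simp: H.r_distr H.scale_mult_right B.r_distr B.scale_mult_right)
  show "rel (m + l) (x \<otimes>\<^bsub>H\<^esub> H.mon u) (x' \<otimes>\<^bsub>B\<^esub> B.mon u)" if "H.deg u = l" for u
    using rel_mult_mon[OF x, of u] that by simp
  show "rel (m + l) (x \<otimes>\<^bsub>H\<^esub> H.mon u) \<zero>\<^bsub>B\<^esub>" if "H.deg u < l" for u
    using rel_lower[OF rel_filt[OF rel_mult_mon[OF x, of u]]] that by simp
qed

lemma rel_one: "rel 0 \<one>\<^bsub>H\<^esub> \<one>\<^bsub>B\<^esub>"
  using rel_mon[of 0 0 0] by (simp add: H.mon_def B.mon_def)

lemma rel_power: "rel m x x' \<Longrightarrow> rel (r * m) (x [^]\<^bsub>H\<^esub> r) (x' [^]\<^bsub>B\<^esub> r)" for r :: nat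
proof (induction r)
  case (Suc r)
  then show ?case using rel_mult[of "r * m" _ _ m x x'] by (simp add: add.commute)
qed (simp add: rel_one)

lemma rel_gens: "rel 0 g g'" "rel 1 a a'" "rel 1 b b'"
  using rel_mon[of 0 0 1] rel_mon[of 0 1 0] rel_mon[of 1 0 0] by (simp_all add: H.mon_def B.mon_def)

lemma rel_slope: "rel 1 (H.slope c) (B.slope c)"
  unfolding H.slope_def B.slope_def by (intro rel_add rel_scale rel_gens)

lemma rel_coeff: "rel (j - t) (H.coeff_b j t) (B.coeff_b j t)" "rel (i - s) (H.coeff_a i s) (B.coeff_a i s)"
  using rel_scale[OF rel_mult[OF rel_power[OF rel_gens(1)] rel_power[OF rel_slope, of "j - t"]]]
    rel_scale[OF rel_mult[OF rel_power[OF rel_gens(1)] rel_power[OF rel_gens(2), of "i - s"]]]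
  by (simp_all add: H.coeff_b_def B.coeff_b_def H.coeff_a_def B.coeff_a_def)

lemma rel_antipode:
  assumes "rel m x x'"
  shows "rel m (H.antipode x) (B.antipode x')"
proof -
  have gi: "rel 0 H.ginv B.ginv"
    using rel_power[OF rel_gens(1)] by (simp add: H.ginv_def B.ginv_def)
  have "rel 1 ((- 1) \<odot>\<^bsub>H\<^esub> (H.ginv \<otimes>\<^bsub>H\<^esub> a)) ((- 1) \<odot>\<^bsub>B\<^esub> (B.ginv \<otimes>\<^bsub>B\<^esub> a'))"
    "rel 1 ((- 1) \<odot>\<^bsub>H\<^esub> (H.ginv \<otimes>\<^bsub>H\<^esub> b)) ((- 1) \<odot>\<^bsub>B\<^esub> (B.ginv \<otimes>\<^bsub>B\<^esub> b'))"
    using rel_scale[OF rel_mult[OF gi rel_gens(2)]] rel_scale[OF rel_mult[OF gi rel_gens(3)]] by simp_all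
  then have S: "rel 1 (H.antipode a) (B.antipode a')" "rel 1 (H.antipode b) (B.antipode b')"
    "rel 0 (H.antipode g) (B.antipode g')"
    using gi by (simp_all add: H.antipode_gens B.antipode_gens H.minus_eq_scale B.minus_eq_scale)
  have SH: "H.antipode (x [^]\<^bsub>H\<^esub> r) = H.antipode x [^]\<^bsub>H\<^esub> r" if "x \<in> carrier H" for x and r :: nat
    using algebra_hom_power[OF H.assoc_alg_axioms H.assoc_alg_op H.antipode_hom that]
      H.op_power[OF H.antipode_simps(1)[OF that]] by simp
  have SB: "B.antipode (x [^]\<^bsub>B\<^esub> r) = B.antipode x [^]\<^bsub>B\<^esub> r" if "x \<in> carrier B" for x and r :: nat
    using algebra_hom_power[OF B.assoc_alg_axioms B.assoc_alg_op B.antipode_hom that]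
      B.op_power[OF B.antipode_simps(1)[OF that]] by simp
  have key: "rel (H.deg u) (H.antipode (H.mon u)) (B.antipode (B.mon u))" for u
  proof -
    obtain j i k where u: "u = (j, i, k)" by (cases u)
    have "rel (0 + (i + j)) (H.antipode g [^]\<^bsub>H\<^esub> k \<otimes>\<^bsub>H\<^esub> (H.antipode a [^]\<^bsub>H\<^esub> i \<otimes>\<^bsub>H\<^esub> H.antipode b [^]\<^bsub>H\<^esub> j))
        (B.antipode g' [^]\<^bsub>B\<^esub> k \<otimes>\<^bsub>B\<^esub> (B.antipode a' [^]\<^bsub>B\<^esub> i \<otimes>\<^bsub>B\<^esub> B.antipode b' [^]\<^bsub>B\<^esub> j))"
      using rel_mult[OF rel_power[OF S(3), of k] rel_mult[OF rel_power[OF S(1), of i] rel_power[OF S(2), of j]]] by simp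
    then show ?thesis
      by (simp add: u H.mon_def B.mon_def H.antipode_simps B.antipode_simps SH SB H.m_assoc B.m_assoc add.commute)
  qed
  show ?thesis
    by (rule rel_map[OF assms H.antipode_linear B.antipode_linear])
      (use key rel_lower[OF rel_filt[OF key]] in auto)
qed

lemma left_mon_zero:
  assumes "u \<in> H.idx" "v \<in> H.idx" "\<not> H.deg v \<le> H.deg u"
  shows "H.left v (H.mon u) = \<zero>\<^bsub>H\<^esub>" "B.left v (B.mon u) = \<zero>\<^bsub>B\<^esub>"
proof -
  obtain j i k t s l where uv: "u = (j, i, k)" "v = (t, s, l)" by (cases u; cases v)
  then have "j < t \<or> i < s" using assms(3) by auto
  then show "H.left v (H.mon u) = \<zero>\<^bsub>H\<^esub>" "B.left v (B.mon u) = \<zero>\<^bsub>B\<^esub>"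
    using assms(1,2) unfolding uv by (auto simp: H.left_mon B.left_mon)
qed

lemma rel_left_mon:
  assumes "u \<in> H.idx" "v \<in> H.idx"
  shows "rel (H.deg u - H.deg v) (H.left v (H.mon u)) (B.left v (B.mon u))"
proof -
  obtain j i k t s l where uv: "u = (j, i, k)" "v = (t, s, l)" by (cases u; cases v)
  show ?thesis
  proof (cases "t \<le> j \<and> s \<le> i \<and> k = l")
    case True
    have "rel ((j - t) + (i - s) + k * 0) (H.coeff_b j t \<otimes>\<^bsub>H\<^esub> H.coeff_a i s \<otimes>\<^bsub>H\<^esub> g [^]\<^bsub>H\<^esub> k)
      (B.coeff_b j t \<otimes>\<^bsub>B\<^esub> B.coeff_a i s \<otimes>\<^bsub>B\<^esub> g' [^]\<^bsub>B\<^esub> k)"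
      by (intro rel_mult rel_coeff rel_power rel_gens)
    then show ?thesis using True assms by (simp add: uv H.left_mon B.left_mon)
  next
    case False
    then have "k \<noteq> l \<or> j < t \<or> i < s" by auto
    then show ?thesis using assms unfolding uv by (auto simp: H.left_mon B.left_mon)
  qed
qed

text \<open>Compatibility of the coproducts, slice by slice: \<open>coeff_b\<close> and
  \<open>coeff_a\<close> are the same expressions in both algebras and agree to leading order by
  \<open>rel_coeff\<close>.\<close>

lemma rel_left:
  assumes x: "rel m x x'" and v: "v \<in> H.idx"
  shows "H.deg v \<le> m \<Longrightarrow> rel (m - H.deg v) (H.left v x) (B.left v x')"
    and "m < H.deg v \<Longrightarrow> H.left v x = \<zero>\<^bsub>H\<^esub> \<and> B.left v x' = \<zero>\<^bsub>B\<^esub>"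
proof -
  assume vm: "H.deg v \<le> m"
  show "rel (m - H.deg v) (H.left v x) (B.left v x')"
  proof (rule rel_map[OF x H.left_linear B.left_linear])
    fix u assume u: "u \<in> H.idx"
    show "rel (m - H.deg v) (H.left v (H.mon u)) (B.left v (B.mon u))" if "H.deg u = m"
      using rel_left_mon[OF u v] that by simp
    show "rel (m - H.deg v) (H.left v (H.mon u)) \<zero>\<^bsub>B\<^esub>" if "H.deg u < m"
    proof (cases "H.deg v \<le> H.deg u")
      case True
      then show ?thesis using rel_lower[OF rel_filt[OF rel_left_mon[OF u v]], of "m - H.deg v"] that by simp
    qed (simp add: left_mon_zero[OF u v])
  qed
next
  assume vm: "m < H.deg v"
  show "H.left v x = \<zero>\<^bsub>H\<^esub> \<and> B.left v x' = \<zero>\<^bsub>B\<^esub>"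
  proof -
    have z: "H.coord u x \<odot>\<^bsub>H\<^esub> H.left v (H.mon u) = \<zero>\<^bsub>H\<^esub>" "B.coord u x' \<odot>\<^bsub>B\<^esub> B.left v (B.mon u) = \<zero>\<^bsub>B\<^esub>"
      if u: "u \<in> H.idx" for u
    proof (atomize(full), cases "H.deg u \<le> m")
      case True
      then show "H.coord u x \<odot>\<^bsub>H\<^esub> H.left v (H.mon u) = \<zero>\<^bsub>H\<^esub> \<and> B.coord u x' \<odot>\<^bsub>B\<^esub> B.left v (B.mon u) = \<zero>\<^bsub>B\<^esub>"
        using left_mon_zero[OF u v] vm by simp
    next
      case False
      then show "H.coord u x \<odot>\<^bsub>H\<^esub> H.left v (H.mon u) = \<zero>\<^bsub>H\<^esub> \<and> B.coord u x' \<odot>\<^bsub>B\<^esub> B.left v (B.mon u) = \<zero>\<^bsub>B\<^esub>"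
        using x u by (simp add: rel_def H.filt_def B.homog_def H.left_simps B.left_simps)
    qed
    have "(\<Oplus>\<^bsub>H\<^esub>u\<in>H.idx. H.coord u x \<odot>\<^bsub>H\<^esub> H.left v (H.mon u)) = (\<Oplus>\<^bsub>H\<^esub>u\<in>H.idx. \<zero>\<^bsub>H\<^esub>)"
      by (rule H.finsum_cong') (use z in auto)
    moreover have "(\<Oplus>\<^bsub>B\<^esub>u\<in>H.idx. B.coord u x' \<odot>\<^bsub>B\<^esub> B.left v (B.mon u)) = (\<Oplus>\<^bsub>B\<^esub>u\<in>H.idx. \<zero>\<^bsub>B\<^esub>)"
      by (rule B.finsum_cong') (use z in auto)
    ultimately show ?thesis
      unfolding H.left_sum[OF rel_closed(1)[OF x]] B.left_sum[OF rel_closed(2)[OF x]] by simp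
  qed
qed

text \<open>The symbol in degree \<open>m\<close>; \<open>section_of\<close> is a right inverse of
  it on homogeneous elements. Every element of \<open>filt m\<close> is thus related to one of
  \<open>B\<close>, and every homogeneous element of \<open>B\<close> to one of \<open>H\<close>, so
  facts about \<open>rel\<close> yield facts about the filtration and the grading
  separately.\<close>

definition lead :: "nat \<Rightarrow> 'v \<Rightarrow> 'w" where
  "lead m x = (\<Oplus>\<^bsub>B\<^esub>u\<in>H.idx. (if H.deg u = m then H.coord u x else 0) \<odot>\<^bsub>B\<^esub> B.mon u)"

definition section_of :: "nat \<Rightarrow> 'w \<Rightarrow> 'v" where
  "section_of m x' = (\<Oplus>\<^bsub>H\<^esub>u\<in>H.idx. (if H.deg u = m then B.coord u x' else 0) \<odot>\<^bsub>H\<^esub> H.mon u)"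

lemma coord_section: "u \<in> H.idx \<Longrightarrow> H.coord u (section_of m x') = (if H.deg u = m then B.coord u x' else 0)"
  unfolding section_of_def by (rule H.coord_combination)

lemma section_closed [simp]: "section_of m x' \<in> carrier H"
  unfolding section_of_def by (intro H.finsum_closed) auto

lemma section_filt: "section_of m x' \<in> H.filt m"
  by (auto simp: H.filt_def coord_section)

lemma rel_lead: "x \<in> H.filt m \<Longrightarrow> rel m x (lead m x)"
proof -
  have "lead m x \<in> carrier B" unfolding lead_def by (intro B.finsum_closed) auto
  moreover have "B.coord u (lead m x) = (if H.deg u = m then H.coord u x else 0)" if "u \<in> H.idx" for u
    unfolding lead_def by (rule B.coord_combination) (rule that)
  ultimately show "x \<in> H.filt m \<Longrightarrow> ?thesis" by (simp add: rel_def B.homog_def)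
qed

lemma rel_section: "x' \<in> B.homog m \<Longrightarrow> rel m (section_of m x') x'"
  using section_filt by (simp add: rel_def coord_section)

section \<open>Consequences for the filtration and the grading\<close>

lemma filt_mult: "x \<in> H.filt m \<Longrightarrow> y \<in> H.filt l \<Longrightarrow> x \<otimes>\<^bsub>H\<^esub> y \<in> H.filt (m + l)"
  using rel_filt[OF rel_mult[OF rel_lead rel_lead]] .

lemma homog_mult: "x \<in> B.homog m \<Longrightarrow> y \<in> B.homog l \<Longrightarrow> x \<otimes>\<^bsub>B\<^esub> y \<in> B.homog (m + l)"
  using rel_homog[OF rel_mult[OF rel_section rel_section]] .

lemma filt_left:
  assumes "x \<in> H.filt m" "v \<in> H.idx"
  shows "H.deg v \<le> m \<Longrightarrow> H.left v x \<in> H.filt (m - H.deg v)" "m < H.deg v \<Longrightarrow> H.left v x = \<zero>\<^bsub>H\<^esub>"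
  using rel_left[OF rel_lead[OF assms(1)] assms(2)] rel_filt by blast+

lemma homog_left:
  assumes "x \<in> B.homog m" "v \<in> H.idx"
  shows "H.deg v \<le> m \<Longrightarrow> B.left v x \<in> B.homog (m - H.deg v)" "m < H.deg v \<Longrightarrow> B.left v x = \<zero>\<^bsub>B\<^esub>"
  using rel_left[OF rel_section[OF assms(1)] assms(2)] rel_homog by blast+

text \<open>For \<open>x\<close> of degree at most \<open>m + 1\<close>, the terms of its coproduct
  with right factor of degree \<open>\<le> m\<close> lie in \<open>H \<otimes> H_m\<close>, and
  those of degree \<open>m + 1\<close> have left factors of degree 0. Conversely, slicing at a
  monomial of degree above \<open>m\<close> kills \<open>H \<otimes> H_m\<close> and maps the rest
  into degree 0, which is the hypothesis of \<open>filt_descent\<close>.\<close>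

lemma coradical_filtration_eq: "coradical_filtration H m = H.filt m"
proof (induction m)
  case 0
  show ?case by (simp add: H.coradical_eq)
next
  case (Suc m)
  let ?F = "H.filt" and ?T = "tensor_product H H"
  let ?U = "tensor_sub H (carrier H) (?F m) \<union> tensor_sub H (?F 0) (carrier H)"
  have Fc: "?F m \<subseteq> carrier H" for m by (rule H.filt_sub(1))
  note U1 = H.tensor_span_carrier[OF subset_refl Fc[of m]] and U2 = H.tensor_span_carrier[OF Fc[of 0] subset_refl]
  have Uc: "?U \<subseteq> carrier ?T"
    using H.tensor.T.subspaceD(1)[OF U1(1)] H.tensor.T.subspaceD(1)[OF U2(1)] by blast
  note U = H.tensor.T.subspaceD[OF H.tensor.T.span_subspace[OF Uc]]
  have "{x \<in> carrier H. comult H x \<in> lin_span ?T ?U} = ?F (Suc m)"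
  proof (intro equalityI subsetI)
    fix x assume x: "x \<in> ?F (Suc m)"
    then have xc: "x \<in> carrier H" using Fc by auto
    have "(\<Oplus>\<^bsub>?T\<^esub>v\<in>H.idx. tensor H H (H.left v x) (H.mon v)) \<in> lin_span ?T ?U"
    proof (rule H.tensor.T.subspace_sum[OF H.tensor.T.span_subspace[OF Uc]])
      fix v assume v: "v \<in> H.idx"
      have "tensor H H (H.left v x) (H.mon v) \<in> ?U"
      proof (cases "H.deg v \<le> m")
        case True
        then have "H.mon v \<in> ?F m" using H.mon_filt by (cases v) simp
        then show ?thesis using U1(2) H.left_simps(1)[OF xc] by blast
      next
        case False
        then have "H.left v x \<in> ?F 0"
          using filt_left[OF x v] H.filt_sub(2)[of 0] by (cases "H.deg v = Suc m") auto
        then show ?thesis using U2(2) H.mon_closed by blast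
      qed
      then show "tensor H H (H.left v x) (H.mon v) \<in> lin_span ?T ?U"
        by (rule subsetD[OF H.tensor.T.span_superset])
    qed
    then show "x \<in> {x \<in> carrier H. comult H x \<in> lin_span ?T ?U}"
      using xc by (simp only: H.comult_expand[symmetric] mem_Collect_eq simp_thms)
  next
    fix x assume "x \<in> {x \<in> carrier H. comult H x \<in> lin_span ?T ?U}"
    then have xc: "x \<in> carrier H" and \<Delta>: "comult H x \<in> lin_span ?T ?U" by auto
    have left0: "H.left v x \<in> ?F 0" if v: "v \<in> H.idx" "m < H.deg v" for v
    proof -
      let ?P = "{t \<in> carrier ?T. H.theta v t \<in> ?F 0}"
      have P: "subspace_of ?P ?T"
        by (rule linear_map_preimage[OF H.tensor.vspace_T H.vspace_axioms H.theta_linear H.filt_subspace])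
      have "H.coord v y = 0" if "y \<in> ?F m" for y using that v by (simp add: H.filt_def)
      then have "H.theta v t \<in> ?F 0" if "t \<in> tensor_sub H (carrier H) (?F m)" for t
        using H.tensor_sub_theta[OF subset_refl Fc H.filt_subspace that, of v 0] H.filt_sub(2) by auto
      moreover have "H.theta v t \<in> ?F 0" if "t \<in> tensor_sub H (?F 0) (carrier H)" for t
        using H.tensor_sub_theta[OF Fc subset_refl H.filt_subspace that, of v 0] H.filt_sub(4) by auto
      ultimately have "?U \<subseteq> ?P" using Uc by auto
      from H.tensor.T.span_minimal[OF P this] \<Delta> show ?thesis by (auto simp: H.left_def)
    qed
    \<comment> \<open>Descent one degree at a time, starting from \<open>Suc m + 2 * p\<close>,
      which is above the degree of every reduced monomial.\<close>
    have "x \<in> ?F (Suc m + r) \<Longrightarrow> x \<in> ?F (Suc m)" for r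
    proof (induction r)
      case (Suc r)
      have "x \<in> ?F (Suc m + r)"
        by (rule H.filt_descent) (use Suc.prems left0 in auto)
      then show ?case by (rule Suc.IH)
    qed simp
    moreover have "x \<in> ?F (Suc m + 2 * p)" using H.filt_top[OF xc] H.filt_mono[of "2 * p" "Suc m + 2 * p"] by auto
    ultimately show "x \<in> ?F (Suc m)" .
  qed
  then show ?case by (simp add: Suc H.coradical_eq)
qed

lemma filtered: "filtered_hopf_algebra H H.filt"
  unfolding filtered_hopf_algebra_def
proof (intro conjI allI ballI H.hopf_algebra H.filt_subspace)
  show "H.filt m \<subseteq> H.filt (Suc m)" for m by (rule H.filt_mono) simp
  show "(\<Union>m. H.filt m) = carrier H"
    using H.filt_top H.filt_sub(1) by blast
  show "\<one>\<^bsub>H\<^esub> \<in> H.filt 0" using H.g_power_filt[of 0 0] by simp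
  show "x \<otimes>\<^bsub>H\<^esub> y \<in> H.filt (i + j)" if "x \<in> H.filt i" "y \<in> H.filt j" for x y i j
    using that by (rule filt_mult)
  show "\<exists>S. is_antipode H S \<and> (\<forall>m. S ` H.filt m \<subseteq> H.filt m)"
    using H.is_antipode_antipode rel_filt[OF rel_antipode[OF rel_lead]] by blast
  fix m x assume x: "x \<in> H.filt m"
  then have xc: "x \<in> carrier H" using H.filt_sub(1) by auto
  let ?T = "tensor_product H H"
  let ?U = "\<Union>i\<le>m. tensor_sub H (H.filt i) (H.filt (m - i))"
  note U1 = H.tensor_span_carrier[OF H.filt_sub(1) H.filt_sub(1)]
  have Uc: "?U \<subseteq> carrier ?T"
    using H.tensor.T.subspaceD(1)[OF U1(1)] by blast
  note Us = H.tensor.T.span_subspace[OF Uc]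
  have "(\<Oplus>\<^bsub>?T\<^esub>v\<in>H.idx. tensor H H (H.left v x) (H.mon v)) \<in> lin_span ?T ?U"
  proof (rule H.tensor.T.subspace_sum[OF Us])
    fix v assume v: "v \<in> H.idx"
    show "tensor H H (H.left v x) (H.mon v) \<in> lin_span ?T ?U"
    proof (cases "H.deg v \<le> m")
      case True
      have "H.mon v \<in> H.filt (m - (m - H.deg v))" using True rel_filt[OF rel_mon'] by simp
      from U1(2)[OF filt_left(1)[OF x v True] this]
      have "tensor H H (H.left v x) (H.mon v) \<in> ?U"
        by (intro UN_I[of "m - H.deg v"]) auto
      then show ?thesis by (rule subsetD[OF H.tensor.T.span_superset])
    next
      case False
      then show ?thesis using filt_left(2)[OF x v] H.tensor.T.subspaceD(2)[OF Us] by simp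
    qed
  qed
  then show "comult H x \<in> lin_span ?T ?U" by (simp only: H.comult_expand[OF xc, symmetric])
qed

end

section \<open>Homogeneous components and the grading of \<open>B\<close>\<close>

context hopf_lifting
begin

definition comp :: "nat \<Rightarrow> 'v \<Rightarrow> 'v" where
  "comp m x = (\<Oplus>u\<in>idx. (if deg u = m then coord u x else 0) \<odot> mon u)"

lemma comp_closed [simp]: "comp m x \<in> carrier H"
  unfolding comp_def by (intro finsum_closed) auto

lemma coord_comp: "u \<in> idx \<Longrightarrow> coord u (comp m x) = (if deg u = m then coord u x else 0)"
  unfolding comp_def by (rule coord_combination)

lemma comp_homog: "comp m x \<in> homog m"
  by (auto simp: homog_def coord_comp)

lemma comp_large: "2 * p < m \<Longrightarrow> comp m x = \<zero>"
  by (rule coord_eqI) (auto simp: coord_comp idx_def)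

lemma comp_sum:
  assumes "x \<in> carrier H" "2 * p \<le> N"
  shows "x = (\<Oplus>m\<in>{..N}. comp m x)"
proof (rule coord_eqI[OF assms(1)])
  fix u assume u: "u \<in> idx"
  then have "deg u \<le> N" using assms(2) by (auto simp: idx_def)
  with u show "coord u x = coord u (\<Oplus>m\<in>{..N}. comp m x)"
    by (subst coord_sum) (simp_all add: coord_comp)
qed (auto intro: finsum_closed)

lemma counit_mon: "counit H (mon u) = (if deg u = 0 then 1 else 0)"
proof -
  obtain j i k where u: "u = (j, i, k)" by (cases u)
  have "counit H (x [^] r) = counit H x ^ r" if "x \<in> carrier H" for x and r :: nat
    using algebra_hom_power[OF assoc_alg_axioms assoc_alg_ground counit_hom that] by (simp add: ground_power)
  then show ?thesis by (simp add: u mon_def counit_simps power_0_left)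
qed

lemma counit_sum: "x \<in> carrier H \<Longrightarrow> counit H x = (\<Sum>u\<in>idx. if deg u = 0 then coord u x else 0)"
proof -
  assume x: "x \<in> carrier H"
  have "counit H (\<Oplus>u\<in>idx. coord u x \<odot> mon u) = (\<Sum>u\<in>idx. counit H (coord u x \<odot> mon u))"
    using linear_map_sum[OF vspace_axioms vspace_ground algebra_homD(1)[OF counit_hom],
      of idx "\<lambda>u. coord u x \<odot> mon u"] by (simp add: finsum_ground)
  also have "\<dots> = (\<Sum>u\<in>idx. if deg u = 0 then coord u x else 0)"
    by (rule sum.cong) (simp_all add: counit_simps counit_mon)
  finally show ?thesis by (simp only: expand[OF x, symmetric])
qed

end

context lifting_pair
begin

lemma graded: "graded_hopf_algebra B B.homog"
  unfolding graded_hopf_algebra_def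
proof (intro conjI allI ballI impI B.hopf_algebra B.homog_subspace)
  show "\<one>\<^bsub>B\<^esub> \<in> B.homog 0" by (rule rel_homog[OF rel_one])
  show "x \<otimes>\<^bsub>B\<^esub> y \<in> B.homog (i + j)" if "x \<in> B.homog i" "y \<in> B.homog j" for x y i j
    using that by (rule homog_mult)
  show "\<exists>S. is_antipode B S \<and> (\<forall>m. S ` B.homog m \<subseteq> B.homog m)"
    using B.is_antipode_antipode rel_homog[OF rel_antipode[OF rel_section]] by blast
  show "counit B x = 0" if m: "0 < m" and x: "x \<in> B.homog m" for m x
    using x m by (subst B.counit_sum) (auto simp: B.homog_def intro!: sum.neutral)
next
  fix x assume x: "x \<in> carrier B"
  show "\<exists>!f. (\<forall>m. f m \<in> B.homog m) \<and> finite {m. f m \<noteq> \<zero>\<^bsub>B\<^esub>} \<and>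
      x = (\<Oplus>\<^bsub>B\<^esub>m\<in>{m. f m \<noteq> \<zero>\<^bsub>B\<^esub>}. f m)"
  proof (rule ex1I[of _ "\<lambda>m. B.comp m x"], intro conjI allI B.comp_homog)
    have sub: "{m. B.comp m x \<noteq> \<zero>\<^bsub>B\<^esub>} \<subseteq> {..2 * p}" using B.comp_large by (force simp: not_le[symmetric])
    then show "finite {m. B.comp m x \<noteq> \<zero>\<^bsub>B\<^esub>}" by (rule finite_subset) simp
    have "(\<Oplus>\<^bsub>B\<^esub>m\<in>{m. B.comp m x \<noteq> \<zero>\<^bsub>B\<^esub>}. B.comp m x) = (\<Oplus>\<^bsub>B\<^esub>m\<in>{..2 * p}. B.comp m x)"
      by (rule B.add.finprod_mono_neutral_cong_left) (use sub in auto)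
    also have "\<dots> = x" by (rule B.comp_sum[OF x le_refl, symmetric])
    finally show "x = (\<Oplus>\<^bsub>B\<^esub>m\<in>{m. B.comp m x \<noteq> \<zero>\<^bsub>B\<^esub>}. B.comp m x)" ..
  next
    fix f assume f: "(\<forall>m. f m \<in> B.homog m) \<and> finite {m. f m \<noteq> \<zero>\<^bsub>B\<^esub>} \<and>
      x = (\<Oplus>\<^bsub>B\<^esub>m\<in>{m. f m \<noteq> \<zero>\<^bsub>B\<^esub>}. f m)"
    let ?S = "{m. f m \<noteq> \<zero>\<^bsub>B\<^esub>}"
    have fh: "f m \<in> B.homog m" and fc: "f m \<in> carrier B" for m
      using f by (auto simp: B.homog_def)
    have "B.coord u x = B.coord u (f (B.deg u))" if u: "u \<in> B.idx" for u
    proof -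
      have "B.coord u x = (\<Sum>m\<in>?S. B.coord u (f m))"
        using f fc B.coord_sum[of ?S f u] by simp
      also have "\<dots> = (\<Sum>m\<in>?S. if m = B.deg u then B.coord u (f m) else 0)"
        by (rule sum.cong) (use fh u in \<open>auto simp: B.homog_def\<close>)
      also have "\<dots> = B.coord u (f (B.deg u))" using f by (auto simp: sum.delta')
      finally show ?thesis .
    qed
    then have "f m = B.comp m x" for m
      using fh by (intro B.coord_eqI fc B.comp_closed) (auto simp: B.coord_comp B.homog_def)
    then show "f = (\<lambda>m. B.comp m x)" by auto
  qed
next
  fix m x assume x: "x \<in> B.homog m"
  then have xc: "x \<in> carrier B" by (simp add: B.homog_def)
  let ?T = "tensor_product B B"
  let ?U = "\<Union>i\<le>m. tensor_sub B (B.homog i) (B.homog (m - i))"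
  have hc: "B.homog i \<subseteq> carrier B" for i by (auto simp: B.homog_def)
  note U1 = B.tensor_span_carrier[OF hc hc]
  have Uc: "?U \<subseteq> carrier ?T"
    using B.tensor.T.subspaceD(1)[OF U1(1)] by blast
  note Us = B.tensor.T.span_subspace[OF Uc]
  have "(\<Oplus>\<^bsub>?T\<^esub>v\<in>H.idx. tensor B B (B.left v x) (B.mon v)) \<in> lin_span ?T ?U"
  proof (rule B.tensor.T.subspace_sum[OF Us])
    fix v assume v: "v \<in> H.idx"
    show "tensor B B (B.left v x) (B.mon v) \<in> lin_span ?T ?U"
    proof (cases "H.deg v \<le> m")
      case True
      have "B.mon v \<in> B.homog (m - (m - H.deg v))" using True rel_homog[OF rel_mon'] by simp
      from U1(2)[OF homog_left(1)[OF x v True] this]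
      have "tensor B B (B.left v x) (B.mon v) \<in> ?U"
        by (intro UN_I[of "m - H.deg v"]) auto
      then show ?thesis by (rule subsetD[OF B.tensor.T.span_superset])
    next
      case False
      then show ?thesis using homog_left(2)[OF x v] B.tensor.T.subspaceD(2)[OF Us] by simp
    qed
  qed
  then show "comult B x \<in> lin_span ?T ?U" by (simp only: B.comult_expand[OF xc, symmetric])
qed

end

section \<open>The associated graded Hopf algebra\<close>

lemma extend_simps [simp]:
  "carrier (module.extend A X) = carrier A" "monoid.mult (module.extend A X) = monoid.mult A"
  "one (module.extend A X) = one A" "zero (module.extend A X) = zero A"
  "add (module.extend A X) = add A" "smult (module.extend A X) = smult A"
  "comult (module.extend A (hopf.fields c e)) = c" "counit (module.extend A (hopf.fields c e)) = e"
  by (simp_all add: module.defs hopf.defs)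

lemma tensor_extend:
  "tensor_product (module.extend A X) (module.extend A X) = tensor_product A A"
  "tensor (module.extend A X) (module.extend A X) = tensor A A"
  by (simp_all add: tensor_product_def tensor_def[abs_def] tensor_class_def[abs_def] tensor_null_def)

text \<open>The natural map \<open>gr_map\<close> goes from \<open>B\<close> to the associated
  graded algebra, and the isomorphism is wanted in the other direction. The coproduct condition is
  inverted on pure tensors.\<close>

lemma hopf_hom_inverse:
  fixes B :: "('k::field, 'w) hopf" and G :: "('k, 'v) hopf"
  assumes B: "assoc_alg B" and G: "assoc_alg G" and comultB: "\<And>x. x \<in> carrier B \<Longrightarrow> comult B x \<in> carrier (tensor_product B B)"
    and iso: "hopf_iso B G f"
  shows "hopf_iso G B (the_inv_into (carrier B) f)"
proof -
  let ?h = "the_inv_into (carrier B) f"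
  have f: "algebra_hom B G f" "bij_betw f (carrier B) (carrier G)" using iso by (simp_all add: hopf_iso_def)
  note fs = algebra_homD[OF f(1)]
  have inj: "inj_on f (carrier B)" and im: "f ` carrier B = carrier G"
    using f(2) by (simp_all add: bij_betw_def)
  have hf: "?h (f x) = x" if "x \<in> carrier B" for x using inj that by (rule the_inv_into_f_f)
  have ex: "\<exists>x\<in>carrier B. y = f x" if "y \<in> carrier G" for y using im that by auto
  interpret B: assoc_alg B by fact
  have h: "algebra_hom G B ?h"
  proof (rule algebra_homI)
    have "?h (f \<one>\<^bsub>B\<^esub>) = \<one>\<^bsub>B\<^esub>" by (rule hf) simp
    then show "?h \<one>\<^bsub>G\<^esub> = \<one>\<^bsub>B\<^esub>" by (simp add: fs)
  qed (auto dest!: ex simp: hf fs(3-6)[symmetric])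
  interpret TB: tensor_alg B B by (rule tensor_algI[OF B B])
  interpret TG: tensor_alg G G by (rule tensor_algI[OF G G])
  let ?F = "tensor_lift (tensor_product G G) (\<lambda>u v. tensor G G (f u) (f v))"
  let ?H = "tensor_lift (tensor_product B B) (\<lambda>u v. tensor B B (?h u) (?h v))"
  have bf: "bilinear B B (tensor_product G G) (\<lambda>u v. tensor G G (f u) (f v))"
    by (rule bilinear_comp2[OF TG.bilinear_tensor algebra_homD(1)[OF f(1)] algebra_homD(1)[OF f(1)]])
  have bh: "bilinear G G (tensor_product B B) (\<lambda>u v. tensor B B (?h u) (?h v))"
    by (rule bilinear_comp2[OF TB.bilinear_tensor algebra_homD(1)[OF h] algebra_homD(1)[OF h]])
  note F = linear_mapD[OF TB.linear_lift[OF TG.vspace_T bf]] TB.lift_tensor[OF TG.vspace_T bf]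
  note K = linear_mapD[OF TG.linear_lift[OF TB.vspace_T bh]] TG.lift_tensor[OF TB.vspace_T bh]
  have inv: "?H (?F t) = t" if "t \<in> carrier (tensor_product B B)" for t
    using that by (induction t rule: TB.tensor_induct) (simp_all add: F K fs(2) hf)
  show ?thesis unfolding hopf_iso_def
  proof (intro conjI ballI h bij_betw_the_inv_into[OF f(2)])
    fix y assume "y \<in> carrier G"
    then obtain x where x: "x \<in> carrier B" "y = f x" using ex by auto
    then show "comult B (?h y) = ?H (comult G y)" "counit B (?h y) = counit G y"
      using iso by (simp_all add: hopf_iso_def hf inv comultB)
  qed
qed

section \<open>Classes of the degree filtration and their identification with
  \<open>B\<close>\<close>

context lifting_pair
begin

abbreviation "G \<equiv> gr_hopf H H.filt"
abbreviation "cls m \<equiv> gr_class H H.filt m"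

lemma gr_simps:
  "carrier G = {f. (\<forall>m. f m \<in> cls m ` H.filt m) \<and> finite {m. f m \<noteq> cls m \<zero>\<^bsub>H\<^esub>}}"
  "x \<otimes>\<^bsub>G\<^esub> y = (\<lambda>m. cls m (\<Oplus>\<^bsub>H\<^esub>i\<in>{..m}. rep (x i) \<otimes>\<^bsub>H\<^esub> rep (y (m - i))))"
  "\<one>\<^bsub>G\<^esub> = gr_elem H H.filt 0 \<one>\<^bsub>H\<^esub>" "\<zero>\<^bsub>G\<^esub> = gr_elem H H.filt 0 \<zero>\<^bsub>H\<^esub>"
  "x \<oplus>\<^bsub>G\<^esub> y = (\<lambda>m. cls m (rep (x m) \<oplus>\<^bsub>H\<^esub> rep (y m)))"
  "c \<odot>\<^bsub>G\<^esub> x = (\<lambda>m. cls m (c \<odot>\<^bsub>H\<^esub> rep (x m)))"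
  "counit G x = counit H (rep (x 0))"
  unfolding gr_hopf_def by (simp_all add: gr_algebra_def)

lemma tensor_gr: "tensor_product (gr_algebra H H.filt) (gr_algebra H H.filt) = tensor_product G G"
  "tensor (gr_algebra H H.filt) (gr_algebra H H.filt) = tensor G G"
  unfolding gr_hopf_def by (simp_all add: tensor_extend)

lemma gr_comult:
  "comult G x = (\<Oplus>\<^bsub>tensor_product G G\<^esub>m\<in>{m. x m \<noteq> cls m \<zero>\<^bsub>H\<^esub>}. gr_comult_hom H H.filt m (rep (x m)))"
  unfolding tensor_gr[symmetric] by (simp add: gr_hopf_def)

text \<open>A description that is uniform in \<open>m\<close>: for \<open>m = 0\<close> it forces
  all coordinates to vanish, in accordance with the convention that
  \<open>F (-1) = 0\<close>.\<close>

lemma gr_below_eq: "gr_below H H.filt m = {x \<in> carrier H. \<forall>u\<in>H.idx. m \<le> H.deg u \<longrightarrow> H.coord u x = 0}"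
proof (cases m)
  case 0
  have "x = \<zero>\<^bsub>H\<^esub>" if "x \<in> carrier H" "\<forall>u\<in>H.idx. H.coord u x = 0" for x
    by (rule H.coord_eqI) (use that in auto)
  then show ?thesis by (auto simp: gr_below_def 0)
qed (auto simp: gr_below_def H.filt_def)

text \<open>A class in degree \<open>m\<close> remembers exactly the coordinates of degree
  \<open>m\<close>. Equality of classes and the properties of chosen representatives reduce to
  these.\<close>

lemma cls_eq:
  assumes "x \<in> H.filt m"
  shows "cls m x = {y \<in> H.filt m. \<forall>u\<in>H.idx. H.deg u = m \<longrightarrow> H.coord u y = H.coord u x}"
proof (intro equalityI subsetI)
  have xc: "x \<in> carrier H" using assms H.filt_sub(1) by auto
  fix y
  {
    assume "y \<in> cls m x"
    then obtain h where h: "h \<in> gr_below H H.filt m" "y = h \<oplus>\<^bsub>H\<^esub> x"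
      by (auto simp: gr_class_def a_r_coset_def')
    then show "y \<in> {y \<in> H.filt m. \<forall>u\<in>H.idx. H.deg u = m \<longrightarrow> H.coord u y = H.coord u x}"
      using assms by (auto simp: gr_below_eq H.filt_def H.coord_simps)
  next
    assume y: "y \<in> {y \<in> H.filt m. \<forall>u\<in>H.idx. H.deg u = m \<longrightarrow> H.coord u y = H.coord u x}"
    then have yc: "y \<in> carrier H" using H.filt_sub(1) by auto
    let ?h = "y \<oplus>\<^bsub>H\<^esub> (- 1) \<odot>\<^bsub>H\<^esub> x"
    have "H.coord u ?h = 0" if "u \<in> H.idx" "m \<le> H.deg u" for u
      using y assms that xc yc by (cases "H.deg u = m") (auto simp: H.coord_simps H.filt_def)
    then have "?h \<in> gr_below H H.filt m" using xc yc by (simp add: gr_below_eq)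
    moreover have "y = ?h \<oplus>\<^bsub>H\<^esub> x"
      using xc yc by (simp add: H.a_assoc H.minus_eq_scale[symmetric] H.l_neg)
    ultimately show "y \<in> cls m x" by (auto simp: gr_class_def a_r_coset_def')
  }
qed

lemma cls_eq_iff:
  assumes "x \<in> H.filt m" "y \<in> H.filt m"
  shows "cls m x = cls m y \<longleftrightarrow> (\<forall>u\<in>H.idx. H.deg u = m \<longrightarrow> H.coord u x = H.coord u y)"
proof
  assume "cls m x = cls m y"
  moreover have "x \<in> cls m x" using assms by (simp add: cls_eq)
  ultimately show "\<forall>u\<in>H.idx. H.deg u = m \<longrightarrow> H.coord u x = H.coord u y" using assms by (auto simp: cls_eq)
qed (use assms in \<open>auto simp: cls_eq\<close>)

lemma rep_cls:
  assumes "x \<in> H.filt m"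
  shows "rep (cls m x) \<in> H.filt m" "u \<in> H.idx \<Longrightarrow> H.deg u = m \<Longrightarrow> H.coord u (rep (cls m x)) = H.coord u x"
proof -
  have "x \<in> cls m x" using assms by (simp add: cls_eq)
  then have "rep (cls m x) \<in> cls m x" unfolding rep_def by (rule someI)
  then show "rep (cls m x) \<in> H.filt m" "u \<in> H.idx \<Longrightarrow> H.deg u = m \<Longrightarrow> H.coord u (rep (cls m x)) = H.coord u x"
    using assms by (auto simp: cls_eq)
qed

text \<open>Inverse to taking symbols, for all degrees at once: in degree \<open>m\<close>,
  \<open>section_of\<close> copies the coordinates of degree \<open>m\<close> from \<open>B\<close>
  to \<open>H\<close>.\<close>

definition gr_map :: "'w \<Rightarrow> nat \<Rightarrow> 'v set" where
  "gr_map x' = (\<lambda>m. cls m (section_of m x'))"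

text \<open>Whatever representative is chosen, its leading part is the component of
  \<open>x'\<close>. The operations of the associated graded algebra are computed with
  representatives, so \<open>rel\<close> controls them.\<close>

lemma rel_rep: "rel m (rep (gr_map x' m)) (B.comp m x')"
proof -
  have "section_of m x' \<in> H.filt m" by (rule section_filt)
  from rep_cls[OF this] show ?thesis
    using B.comp_homog by (simp add: rel_def gr_map_def coord_section B.coord_comp)
qed

lemma rep_closed [simp]: "rep (gr_map x' m) \<in> carrier H"
  by (rule rel_closed(1)[OF rel_rep])

lemma rep_coord: "u \<in> H.idx \<Longrightarrow> H.coord u (rep (gr_map x' (H.deg u))) = B.coord u x'"
  using rel_rep[of "H.deg u" x'] by (simp add: rel_def B.coord_comp)

lemma gr_map_eqI:
  assumes "\<And>m. y m \<in> H.filt m" "\<And>u. u \<in> H.idx \<Longrightarrow> H.coord u (y (H.deg u)) = B.coord u x'"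
  shows "(\<lambda>m. cls m (y m)) = gr_map x'"
  unfolding gr_map_def
proof
  fix m show "cls m (y m) = cls m (section_of m x')"
    by (subst cls_eq_iff) (use assms section_filt coord_section in auto)
qed

lemma gr_map_carrier: "gr_map ` carrier B = carrier G"
proof (intro equalityI subsetI)
  fix \<phi> assume "\<phi> \<in> gr_map ` carrier B"
  then obtain x' where x': "\<phi> = gr_map x'" by auto
  \<comment> \<open>Reduced monomials have degree at most \<open>2 * p\<close>, so almost all
    components are zero.\<close>
  have "cls m (section_of m x') = cls m \<zero>\<^bsub>H\<^esub>" if "2 * p < m" for m
    by (subst cls_eq_iff) (use that section_filt H.filt_sub(2) in \<open>auto simp: coord_section H.idx_def\<close>)
  then have "{m. \<phi> m \<noteq> cls m \<zero>\<^bsub>H\<^esub>} \<subseteq> {..2 * p}" by (force simp: x' gr_map_def not_le[symmetric])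
  then have "finite {m. \<phi> m \<noteq> cls m \<zero>\<^bsub>H\<^esub>}" by (rule finite_subset) simp
  then show "\<phi> \<in> carrier G" using section_filt by (auto simp: gr_simps x' gr_map_def)
next
  fix \<phi> assume "\<phi> \<in> carrier G"
  then have "\<forall>m. \<exists>x. x \<in> H.filt m \<and> \<phi> m = cls m x" by (auto simp: gr_simps)
  then obtain y where y: "\<And>m. y m \<in> H.filt m" "\<And>m. \<phi> m = cls m (y m)" by metis
  let ?x = "\<Oplus>\<^bsub>B\<^esub>u\<in>H.idx. H.coord u (y (H.deg u)) \<odot>\<^bsub>B\<^esub> B.mon u"
  have "(\<lambda>m. cls m (y m)) = gr_map ?x"
    by (rule gr_map_eqI[OF y(1)]) (simp add: B.coord_combination)
  moreover have "\<phi> = (\<lambda>m. cls m (y m))" using y(2) by auto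
  moreover have "?x \<in> carrier B" by (intro B.finsum_closed) auto
  ultimately show "\<phi> \<in> gr_map ` carrier B" by (intro image_eqI[of _ _ ?x]) simp_all
qed

lemma gr_map_inj: "inj_on gr_map (carrier B)"
proof (rule inj_onI)
  fix x' y' assume "x' \<in> carrier B" "y' \<in> carrier B" "gr_map x' = gr_map y'"
  then show "x' = y'" using rep_coord by (metis B.coord_eqI)
qed

text \<open>The product of \<open>B\<close> adds degrees, so of all products of components only
  those with total degree \<open>deg u\<close> are seen. This is the shape of the product in the
  associated graded algebra.\<close>

lemma coord_mult:
  assumes x: "x' \<in> carrier B" and y: "y' \<in> carrier B" and u: "u \<in> H.idx"
  shows "B.coord u (x' \<otimes>\<^bsub>B\<^esub> y') = (\<Sum>i\<le>H.deg u. B.coord u (B.comp i x' \<otimes>\<^bsub>B\<^esub> B.comp (H.deg u - i) y'))"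
proof -
  \<comment> \<open>The bound exceeds all degrees of reduced monomials and also all indices
    \<open>i \<le> deg u\<close> of the right-hand side.\<close>
  let ?m = "H.deg u" and ?N = "2 * p + H.deg u"
  let ?c = "\<lambda>i l. B.coord u (B.comp i x' \<otimes>\<^bsub>B\<^esub> B.comp l y')"
  have z: "?c i l = 0" if "i + l \<noteq> ?m" for i l
    using homog_mult[OF B.comp_homog B.comp_homog, of i x' l y'] that u by (auto simp: B.homog_def)
  have lin: "linear_map B B (\<lambda>z. z \<otimes>\<^bsub>B\<^esub> y')" using y
    by (intro linear_mapI) (simp_all add: B.l_distr B.scale_mult_left)
  have lin2: "linear_map B B (\<lambda>z. B.comp i x' \<otimes>\<^bsub>B\<^esub> z)" for i
    by (intro linear_mapI) (simp_all add: B.r_distr B.scale_mult_right)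
  have "B.coord u (x' \<otimes>\<^bsub>B\<^esub> y') = B.coord u ((\<Oplus>\<^bsub>B\<^esub>i\<in>{..?N}. B.comp i x') \<otimes>\<^bsub>B\<^esub> y')"
    by (subst B.comp_sum[OF x, of ?N]) simp_all
  also have "\<dots> = (\<Sum>i\<le>?N. B.coord u (B.comp i x' \<otimes>\<^bsub>B\<^esub> y'))"
    by (subst linear_map_sum[OF B.vspace_axioms B.vspace_axioms lin]) (simp_all add: B.coord_sum y)
  also have "\<dots> = (\<Sum>i\<le>?N. \<Sum>l\<le>?N. ?c i l)"
  proof (rule sum.cong[OF refl])
    fix i
    have "B.coord u (B.comp i x' \<otimes>\<^bsub>B\<^esub> y') = B.coord u (B.comp i x' \<otimes>\<^bsub>B\<^esub> (\<Oplus>\<^bsub>B\<^esub>l\<in>{..?N}. B.comp l y'))"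
      by (subst B.comp_sum[OF y, of ?N]) simp_all
    also have "\<dots> = (\<Sum>l\<le>?N. ?c i l)"
      by (subst linear_map_sum[OF B.vspace_axioms B.vspace_axioms lin2]) (simp_all add: B.coord_sum)
    finally show "B.coord u (B.comp i x' \<otimes>\<^bsub>B\<^esub> y') = (\<Sum>l\<le>?N. ?c i l)" .
  qed
  also have "\<dots> = (\<Sum>i\<le>?N. if i \<le> ?m then ?c i (?m - i) else 0)"
  proof (rule sum.cong[OF refl])
    fix i
    have "(\<Sum>l\<le>?N. ?c i l) = (\<Sum>l\<le>?N. if l = ?m - i then (if i \<le> ?m then ?c i (?m - i) else 0) else 0)"
      by (rule sum.cong[OF refl]) (use z in auto)
    also have "\<dots> = (if i \<le> ?m then ?c i (?m - i) else 0)"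
      by (subst sum.delta) auto
    finally show "(\<Sum>l\<le>?N. ?c i l) = (if i \<le> ?m then ?c i (?m - i) else 0)" .
  qed
  also have "\<dots> = (\<Sum>i\<le>?m. ?c i (?m - i))"
    by (rule sum.mono_neutral_cong_right) auto
  finally show ?thesis .
qed

text \<open>Families of classes are compared by coordinates, one degree at a time. For products,
  \<open>rel_mult\<close> handles each pair of representatives and \<open>coord_mult\<close>
  assembles the degree.\<close>

lemma gr_map_hom: "algebra_hom B G gr_map" and gr_map_zero: "gr_map \<zero>\<^bsub>B\<^esub> = \<zero>\<^bsub>G\<^esub>"
proof -
  have rf: "rep (gr_map x' m) \<in> H.filt m" for x' m by (rule rel_filt[OF rel_rep])
  show "gr_map \<zero>\<^bsub>B\<^esub> = \<zero>\<^bsub>G\<^esub>"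
    unfolding gr_simps gr_elem_def by (rule gr_map_eqI[symmetric]) (auto simp: H.filt_sub)
  show "algebra_hom B G gr_map"
  proof (rule algebra_homI)
    show "gr_map x \<in> carrier G" if "x \<in> carrier B" for x using gr_map_carrier that by auto
    have one: "\<one>\<^bsub>H\<^esub> \<in> H.filt 0" by (rule rel_filt[OF rel_one])
    have "H.coord u \<one>\<^bsub>H\<^esub> = B.coord u \<one>\<^bsub>B\<^esub>" if "u \<in> H.idx" "H.deg u = 0" for u
      using rel_one that by (simp add: rel_def)
    moreover have "B.coord u \<one>\<^bsub>B\<^esub> = 0" if "u \<in> H.idx" "H.deg u \<noteq> 0" for u
      using rel_homog[OF rel_one] that by (simp add: B.homog_def)
    ultimately show "gr_map \<one>\<^bsub>B\<^esub> = \<one>\<^bsub>G\<^esub>"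
      unfolding gr_simps gr_elem_def by (intro gr_map_eqI[symmetric]) (auto simp: H.filt_sub one)
    fix x y assume xy: "x \<in> carrier B" "y \<in> carrier B"
    then show "gr_map (x \<oplus>\<^bsub>B\<^esub> y) = gr_map x \<oplus>\<^bsub>G\<^esub> gr_map y"
      unfolding gr_simps
      by (intro gr_map_eqI[symmetric]) (auto simp: H.filt_sub rf H.coord_simps B.coord_simps rep_coord)
    show "gr_map (x \<otimes>\<^bsub>B\<^esub> y) = gr_map x \<otimes>\<^bsub>G\<^esub> gr_map y"
      unfolding gr_simps
    proof (rule gr_map_eqI[symmetric])
      let ?s = "\<lambda>m. \<Oplus>\<^bsub>H\<^esub>i\<in>{..m}. rep (gr_map x i) \<otimes>\<^bsub>H\<^esub> rep (gr_map y (m - i))"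
      have r: "rel m (?s m) (\<Oplus>\<^bsub>B\<^esub>i\<in>{..m}. B.comp i x \<otimes>\<^bsub>B\<^esub> B.comp (m - i) y)" for m
      proof (rule rel_sum)
        fix i assume "i \<in> {..m}"
        then show "rel m (rep (gr_map x i) \<otimes>\<^bsub>H\<^esub> rep (gr_map y (m - i))) (B.comp i x \<otimes>\<^bsub>B\<^esub> B.comp (m - i) y)"
          using rel_mult[OF rel_rep[of i x] rel_rep[of "m - i" y]] by simp
      qed
      then show "?s m \<in> H.filt m" for m by (rule rel_filt)
      fix u assume u: "u \<in> H.idx"
      have "H.coord u (?s (H.deg u)) = B.coord u (\<Oplus>\<^bsub>B\<^esub>i\<in>{..H.deg u}. B.comp i x \<otimes>\<^bsub>B\<^esub> B.comp (H.deg u - i) y)"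
        using r[of "H.deg u"] u by (simp add: rel_def)
      then show "H.coord u (?s (H.deg u)) = B.coord u (x \<otimes>\<^bsub>B\<^esub> y)"
        by (simp add: coord_mult[OF xy u] B.coord_sum)
    qed
  next
    fix c x assume x: "x \<in> carrier B"
    then show "gr_map (c \<odot>\<^bsub>B\<^esub> x) = c \<odot>\<^bsub>G\<^esub> gr_map x"
      unfolding gr_simps
      by (intro gr_map_eqI[symmetric]) (auto simp: H.filt_sub rf H.coord_simps B.coord_simps rep_coord)
  qed
qed

text \<open>The axioms are carried over from \<open>B\<close> along the bijection
  \<open>gr_map\<close>; this replaces a verification with chosen representatives of
  classes.\<close>

lemma assoc_alg_G: "assoc_alg G"
  by (rule assoc_alg_image[OF B.assoc_alg_axioms gr_map_hom gr_map_carrier gr_map_zero])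

lemma counit_gr: "x' \<in> carrier B \<Longrightarrow> counit G (gr_map x') = counit B x'"
  using rep_coord[of "(0, 0, _)" x']
  by (auto simp: gr_simps H.counit_sum B.counit_sum intro!: sum.cong)

definition gr_coord :: "nat \<times> nat \<times> nat \<Rightarrow> (nat \<Rightarrow> 'v set) \<Rightarrow> 'k" where
  "gr_coord u \<phi> = H.coord u (rep (\<phi> (H.deg u)))"

lemma gr_coord_map: "u \<in> H.idx \<Longrightarrow> gr_coord u (gr_map x') = B.coord u x'"
  by (simp add: gr_coord_def rep_coord)

lemma carrier_gr_ex: "\<phi> \<in> carrier G \<Longrightarrow> \<exists>x'\<in>carrier B. \<phi> = gr_map x'"
  using gr_map_carrier by auto

lemma gr_map_closed [simp]: "x' \<in> carrier B \<Longrightarrow> gr_map x' \<in> carrier G"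
  using gr_map_carrier by auto

lemmas gr_map_simps = algebra_homD(3-6)[OF gr_map_hom]

lemma gr_coord_linear: "u \<in> H.idx \<Longrightarrow> linear_map G ground (gr_coord u)"
proof (rule linear_mapI)
  assume u: "u \<in> H.idx"
  fix \<phi> c assume "\<phi> \<in> carrier G"
  then obtain x' where x': "x' \<in> carrier B" "\<phi> = gr_map x'" using carrier_gr_ex by blast
  show "gr_coord u \<phi> \<in> carrier ground" by simp
  show "gr_coord u (c \<odot>\<^bsub>G\<^esub> \<phi>) = c \<odot>\<^bsub>ground\<^esub> gr_coord u \<phi>"
    unfolding x'(2) gr_map_simps(3)[OF x'(1), symmetric] using x'(1) by (simp add: gr_coord_map u B.coord_simps)
  fix \<psi> assume "\<psi> \<in> carrier G"
  then obtain y' where y': "y' \<in> carrier B" "\<psi> = gr_map y'" using carrier_gr_ex by blast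
  show "gr_coord u (\<phi> \<oplus>\<^bsub>G\<^esub> \<psi>) = gr_coord u \<phi> \<oplus>\<^bsub>ground\<^esub> gr_coord u \<psi>"
    unfolding x'(2) y'(2) gr_map_simps(1)[OF x'(1) y'(1), symmetric] using x'(1) y'(1)
    by (simp add: gr_coord_map u B.coord_simps)
qed

lemma gr_expand:
  assumes "\<phi> \<in> carrier G"
  shows "\<phi> = (\<Oplus>\<^bsub>G\<^esub>u\<in>H.idx. gr_coord u \<phi> \<odot>\<^bsub>G\<^esub> gr_map (B.mon u))"
proof -
  interpret G: assoc_alg G by (rule assoc_alg_G)
  obtain x' where x': "x' \<in> carrier B" "\<phi> = gr_map x'" using carrier_gr_ex[OF assms] by blast
  have "gr_map (\<Oplus>\<^bsub>B\<^esub>u\<in>H.idx. B.coord u x' \<odot>\<^bsub>B\<^esub> B.mon u) = (\<Oplus>\<^bsub>G\<^esub>u\<in>H.idx. gr_map (B.coord u x' \<odot>\<^bsub>B\<^esub> B.mon u))"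
    by (rule linear_map_sum[OF B.vspace_axioms G.vspace_axioms algebra_homD(1)[OF gr_map_hom]]) auto
  also have "\<dots> = (\<Oplus>\<^bsub>G\<^esub>u\<in>H.idx. gr_coord u \<phi> \<odot>\<^bsub>G\<^esub> gr_map (B.mon u))"
    by (rule G.finsum_cong') (auto simp: x' gr_map_simps gr_coord_map)
  finally show ?thesis unfolding B.expand[OF x'(1), symmetric] x'(2)[symmetric] .
qed

lemma gr_eqI:
  assumes "\<phi> \<in> carrier G" "\<psi> \<in> carrier G" "\<And>u. u \<in> H.idx \<Longrightarrow> gr_coord u \<phi> = gr_coord u \<psi>"
  shows "\<phi> = \<psi>"
proof -
  obtain x' where x': "x' \<in> carrier B" "\<phi> = gr_map x'" using carrier_gr_ex[OF assms(1)] by blast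
  obtain y' where y': "y' \<in> carrier B" "\<psi> = gr_map y'" using carrier_gr_ex[OF assms(2)] by blast
  have "x' = y'"
  proof (rule B.coord_eqI[OF x'(1) y'(1)])
    show "B.coord u x' = B.coord u y'" if "u \<in> H.idx" for u
      using assms(3)[OF that] that by (simp add: x'(2) y'(2) gr_coord_map)
  qed
  then show ?thesis by (simp only: x'(2) y'(2))
qed

section \<open>Coordinates on the tensor square of the associated graded algebra\<close>

abbreviation "TG \<equiv> tensor_product G G"

lemma tensor_alg_G: "tensor_alg G G"
  by (rule tensor_algI[OF assoc_alg_G assoc_alg_G])

text \<open>The functional \<open>gr_coord u \<otimes> gr_coord v\<close> on the tensor square. By
  \<open>gr_coord2_eqI\<close> these functionals separate its elements, so coproducts are compared
  through them.\<close>

definition gr_coord2 where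
  "gr_coord2 u v t = gr_coord u (tensor_lift G (\<lambda>x y. gr_coord v y \<odot>\<^bsub>G\<^esub> x) t)"

lemma gr_coord2:
  assumes u: "u \<in> H.idx" and v: "v \<in> H.idx"
  shows "linear_map TG ground (gr_coord2 u v)"
    and "x \<in> carrier G \<Longrightarrow> y \<in> carrier G \<Longrightarrow> gr_coord2 u v (tensor G G x y) = gr_coord v y * gr_coord u x"
proof -
  interpret TG: tensor_alg G G by (rule tensor_alg_G)
  note L = linear_mapD[OF gr_coord_linear[OF v], unfolded ground_simps]
  have b: "bilinear G G G (\<lambda>x y. gr_coord v y \<odot>\<^bsub>G\<^esub> x)"
    by (intro bilinearI linear_mapI)
      (simp_all add: L TG.A.scale_add_left TG.A.scale_add_right mult.commute)
  show "linear_map TG ground (gr_coord2 u v)"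
    unfolding gr_coord2_def
    by (rule linear_map_comp[OF TG.linear_lift[OF TG.A.vspace_axioms b] gr_coord_linear[OF u]])
  show "x \<in> carrier G \<Longrightarrow> y \<in> carrier G \<Longrightarrow> gr_coord2 u v (tensor G G x y) = gr_coord v y * gr_coord u x"
    by (simp add: gr_coord2_def TG.lift_tensor[OF TG.A.vspace_axioms b]
        linear_mapD(3)[OF gr_coord_linear[OF u], unfolded ground_simps])
qed

lemma gr_coord2_eqI:
  assumes s: "s \<in> carrier TG" and t: "t \<in> carrier TG"
    and eq: "\<And>u v. u \<in> H.idx \<Longrightarrow> v \<in> H.idx \<Longrightarrow> gr_coord2 u v s = gr_coord2 u v t"
  shows "s = t"
proof -
  interpret TG: tensor_alg G G by (rule tensor_alg_G)
  let ?\<theta> = "\<lambda>v t. tensor_lift G (\<lambda>x y. gr_coord v y \<odot>\<^bsub>G\<^esub> x) t"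
  have b: "bilinear G G G (\<lambda>x y. gr_coord v y \<odot>\<^bsub>G\<^esub> x)" if "v \<in> H.idx" for v
    using linear_mapD[OF gr_coord_linear[OF that], unfolded ground_simps]
    by (intro bilinearI linear_mapI)
      (simp_all add: TG.A.scale_add_left TG.A.scale_add_right mult.commute)
  note \<theta>c = linear_mapD(1)[OF TG.linear_lift[OF TG.A.vspace_axioms b]]
  have "?\<theta> v s = ?\<theta> v t" if v: "v \<in> H.idx" for v
    by (rule gr_eqI[OF \<theta>c[OF v s] \<theta>c[OF v t]]) (use eq[OF _ v] in \<open>simp add: gr_coord2_def\<close>)
  then have eq: "(\<Oplus>\<^bsub>TG\<^esub>v\<in>H.idx. tensor G G (?\<theta> v s) (gr_map (B.mon v))) =
      (\<Oplus>\<^bsub>TG\<^esub>v\<in>H.idx. tensor G G (?\<theta> v t) (gr_map (B.mon v)))"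
    by (intro TG.T.finsum_cong') (use \<theta>c t in auto)
  have ex: "u = (\<Oplus>\<^bsub>TG\<^esub>v\<in>H.idx. tensor G G (?\<theta> v u) (gr_map (B.mon v)))" if "u \<in> carrier TG" for u
    by (rule TG.tensor_expand_right[OF H.finite_idx _ gr_coord_linear gr_expand that]) auto
  show ?thesis by (rule trans[OF ex[OF s] trans[OF eq ex[OF t, symmetric]]])
qed

lemma gr_elem_eq: "x \<in> H.filt m \<Longrightarrow> gr_elem H H.filt m x = gr_map (lead m x)"
  unfolding gr_elem_def
proof (rule gr_map_eqI)
  assume x: "x \<in> H.filt m"
  show "(if j = m then x else \<zero>\<^bsub>H\<^esub>) \<in> H.filt j" for j using x H.filt_sub(2) by simp
  fix u assume u: "u \<in> H.idx"
  show "H.coord u (if H.deg u = m then x else \<zero>\<^bsub>H\<^esub>) = B.coord u (lead m x)"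
    using rel_lead[OF x] u by (auto simp: rel_def B.homog_def)
qed

lemma gr_elem_closed: "x \<in> H.filt m \<Longrightarrow> gr_elem H H.filt m x \<in> carrier G"
  using rel_closed(2)[OF rel_lead] by (simp add: gr_elem_eq)

lemma gr_coord_elem:
  "x \<in> H.filt m \<Longrightarrow> u \<in> H.idx \<Longrightarrow> gr_coord u (gr_elem H H.filt m x) = (if H.deg u = m then H.coord u x else 0)"
  using rel_lead[of x m] by (auto simp: gr_elem_eq gr_coord_map rel_def B.homog_def)

text \<open>Guarantees that the choice made in \<open>gr_comult_hom\<close> meets its specification.
  The expansion of the coproduct is sorted by degree: the term with right factor
  \<open>mon v\<close> goes into \<open>r (m - deg v)\<close>.\<close>

lemma comult_decomposition:
  assumes x: "x \<in> H.filt m"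
  shows "\<exists>r. (\<forall>i\<le>m. Poly_Mapping.keys (r i) \<subseteq> H.filt i \<times> H.filt (m - i)) \<and>
    comult H x = tensor_class H H (\<Sum>i\<le>m. r i)"
proof -
  have xc: "x \<in> carrier H" using x H.filt_sub(1) by auto
  note left_c = H.left_simps(1)[OF xc]
  let ?s = "\<lambda>v. Poly_Mapping.single (H.left v x, H.mon v) (1 :: 'k)"
  define r where "r i = (\<Sum>v\<in>H.idx. if H.deg v + i = m then ?s v else 0)" for i
  have "Poly_Mapping.keys (r i) \<subseteq> H.filt i \<times> H.filt (m - i)" if "i \<le> m" for i
  proof -
    have "Poly_Mapping.keys (if H.deg v + i = m then ?s v else 0) \<subseteq> H.filt i \<times> H.filt (m - i)"
      if v: "v \<in> H.idx" for v
    proof (cases "H.deg v + i = m")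
      case True
      then have "H.left v x \<in> H.filt i" "H.mon v \<in> H.filt (m - i)"
        using filt_left(1)[OF x v] rel_filt[OF rel_mon', of v] by auto
      then show ?thesis using True by simp
    qed simp
    then show ?thesis unfolding r_def by (intro order_trans[OF keys_sum UN_least])
  qed
  moreover have "comult H x = tensor_class H H (\<Sum>i\<le>m. r i)"
  proof -
    have "comult H x = (\<Oplus>\<^bsub>tensor_product H H\<^esub>v\<in>H.idx. tensor H H (H.left v x) (H.mon v))"
      by (rule H.comult_expand[OF xc])
    also have "\<dots> = (\<Oplus>\<^bsub>tensor_product H H\<^esub>v\<in>H.idx. tensor_class H H (if H.deg v \<le> m then ?s v else 0))"
    proof (rule H.tensor.T.finsum_cong')
      fix v assume v: "v \<in> H.idx"
      show "tensor H H (H.left v x) (H.mon v) = tensor_class H H (if H.deg v \<le> m then ?s v else 0)"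
        using filt_left(2)[OF x v] by (cases "H.deg v \<le> m") (simp_all add: tensor_def[symmetric] H.tensor.class_zero[symmetric])
    qed (auto intro!: H.tensor.class_closed simp: left_c split: if_splits)
    also have "\<dots> = tensor_class H H (\<Sum>v\<in>H.idx. if H.deg v \<le> m then ?s v else 0)"
      by (rule H.tensor.class_sum[symmetric]) (auto simp: left_c split: if_splits)
    also have "(\<Sum>v\<in>H.idx. if H.deg v \<le> m then ?s v else 0) = (\<Sum>v\<in>H.idx. \<Sum>i\<le>m. if H.deg v + i = m then ?s v else 0)"
    proof (rule sum.cong[OF refl])
      fix v
      have "(\<Sum>i\<le>m. if H.deg v + i = m then ?s v else 0) = (\<Sum>i\<le>m. if i = m - H.deg v then (if H.deg v \<le> m then ?s v else 0) else 0)"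
        by (rule sum.cong[OF refl]) auto
      also have "\<dots> = (if H.deg v \<le> m then ?s v else 0)" by (subst sum.delta) auto
      finally show "(if H.deg v \<le> m then ?s v else 0) = (\<Sum>i\<le>m. if H.deg v + i = m then ?s v else 0)" ..
    qed
    also have "\<dots> = (\<Sum>i\<le>m. r i)" unfolding r_def by (rule sum.swap)
    finally show ?thesis .
  qed
  ultimately show ?thesis by blast
qed

text \<open>The functional \<open>gr_coord2 u v\<close> sees only the bidegree
  \<open>(deg u, deg v)\<close>, of total degree \<open>m\<close>. In that bidegree the summands
  \<open>r i\<close> with \<open>i \<noteq> deg u\<close> have no coordinate in \<open>H\<close>
  either, so the value is a coordinate of the coproduct of \<open>x\<close> itself and does not
  depend on the chosen \<open>r\<close>.\<close>

lemma gr_comult_hom: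
  assumes x: "x \<in> H.filt m"
  shows "gr_comult_hom H H.filt m x \<in> carrier TG"
    and "u \<in> H.idx \<Longrightarrow> v \<in> H.idx \<Longrightarrow> gr_coord2 u v (gr_comult_hom H H.filt m x) =
      (if H.deg u + H.deg v = m then H.coord u (H.left v x) else 0)"
proof -
  interpret TG: tensor_alg G G by (rule tensor_alg_G)
  define r where "r = (SOME r. (\<forall>i\<le>m. Poly_Mapping.keys (r i) \<subseteq> H.filt i \<times> H.filt (m - i)) \<and>
    comult H x = tensor_class H H (\<Sum>i\<le>m. r i))"
  have r: "\<And>i. i \<le> m \<Longrightarrow> Poly_Mapping.keys (r i) \<subseteq> H.filt i \<times> H.filt (m - i)"
    "comult H x = tensor_class H H (\<Sum>i\<le>m. r i)"
    using someI_ex[OF comult_decomposition[OF x]] unfolding r_def by blast+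
  let ?e = "\<lambda>i q. Poly_Mapping.lookup (r i) q \<odot>\<^bsub>TG\<^esub> tensor G G (gr_elem H H.filt i (fst q)) (gr_elem H H.filt (m - i) (snd q))"
  have def: "gr_comult_hom H H.filt m x = (\<Oplus>\<^bsub>TG\<^esub>i\<in>{..m}. \<Oplus>\<^bsub>TG\<^esub>q\<in>Poly_Mapping.keys (r i). ?e i q)"
    unfolding gr_comult_hom_def Let_def tensor_gr r_def ..
  have q: "fst q \<in> H.filt i" "snd q \<in> H.filt (m - i)" if "i \<le> m" "q \<in> Poly_Mapping.keys (r i)" for i q
    using r(1)[OF that(1)] that(2) by auto
  have ec: "?e i q \<in> carrier TG" if "i \<le> m" "q \<in> Poly_Mapping.keys (r i)" for i q
    using q[OF that] by (simp add: gr_elem_closed)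
  have sc: "(\<Oplus>\<^bsub>TG\<^esub>q\<in>Poly_Mapping.keys (r i). ?e i q) \<in> carrier TG" if "i \<le> m" for i
    using ec[OF that] by (intro TG.T.finsum_closed) auto
  show "gr_comult_hom H H.filt m x \<in> carrier TG"
    unfolding def using sc by (intro TG.T.finsum_closed) auto
  assume u: "u \<in> H.idx" and v: "v \<in> H.idx"
  note K = gr_coord2[OF u v]
  note Ks = linear_mapD[OF K(1), unfolded ground_simps]
  have "gr_coord2 u v (gr_comult_hom H H.filt m x) = (\<Sum>i\<le>m. gr_coord2 u v (\<Oplus>\<^bsub>TG\<^esub>q\<in>Poly_Mapping.keys (r i). ?e i q))"
    unfolding def using linear_map_sum[OF TG.vspace_T vspace_ground K(1), of "{..m}"] sc by (simp add: finsum_ground)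
  also have "\<dots> = (\<Sum>i\<le>m. \<Sum>q\<in>Poly_Mapping.keys (r i). gr_coord2 u v (?e i q))"
  proof (rule sum.cong[OF refl])
    fix i assume "i \<in> {..m}"
    then show "gr_coord2 u v (\<Oplus>\<^bsub>TG\<^esub>q\<in>Poly_Mapping.keys (r i). ?e i q) = (\<Sum>q\<in>Poly_Mapping.keys (r i). gr_coord2 u v (?e i q))"
      using linear_map_sum[OF TG.vspace_T vspace_ground K(1), of "Poly_Mapping.keys (r i)" "?e i"] ec
      by (simp add: finsum_ground)
  qed
  also have "\<dots> = (\<Sum>i\<le>m. \<Sum>q\<in>Poly_Mapping.keys (r i). if H.deg u + H.deg v = m
      then Poly_Mapping.lookup (r i) q * (H.coord v (snd q) * H.coord u (fst q)) else 0)"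
  proof (intro sum.cong[OF refl])
    fix i q assume i: "i \<in> {..m}" and qr: "q \<in> Poly_Mapping.keys (r i)"
    then have qF: "fst q \<in> H.filt i" "snd q \<in> H.filt (m - i)" using q by auto
    have e: "gr_coord2 u v (?e i q) = Poly_Mapping.lookup (r i) q *
        ((if H.deg v = m - i then H.coord v (snd q) else 0) * (if H.deg u = i then H.coord u (fst q) else 0))"
      using qF u v by (simp add: Ks K(2) gr_elem_closed gr_coord_elem)
    show "gr_coord2 u v (?e i q) = (if H.deg u + H.deg v = m
      then Poly_Mapping.lookup (r i) q * (H.coord v (snd q) * H.coord u (fst q)) else 0)"
    proof (cases "H.deg u + H.deg v = m")
      case True
      \<comment> \<open>For \<open>i \<noteq> deg u\<close> one of the two factors lies in too small
        a step of the filtration: the left one if \<open>i < deg u\<close>, the right one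
        otherwise.\<close>
      have "H.coord v (snd q) * H.coord u (fst q) = 0" if ne: "H.deg u \<noteq> i"
      proof -
        have "i \<le> m" using i by simp
        then consider "i < H.deg u" | "m - i < H.deg v" using ne True by linarith
        then show ?thesis using qF u v by cases (auto simp: H.filt_def)
      qed
      then show ?thesis unfolding e using True by auto
    next
      case False
      then show ?thesis unfolding e using i by auto
    qed
  qed
  also have "\<dots> = (if H.deg u + H.deg v = m then H.coord u (H.left v x) else 0)"
  proof -
    have kc: "r i \<in> cross_keys H H" if "i \<in> {..m}" for i
      using r(1)[of i] that H.filt_sub(1) by (fastforce simp: subset_iff)
    have rc: "tensor_class H H (r i) \<in> carrier (tensor_product H H)" if "i \<in> {..m}" for i
      using kc[OF that] by (intro H.tensor.class_closed) simp
    have "H.coord u (H.left v x) = (\<Sum>i\<le>m. H.coord u (H.theta v (tensor_class H H (r i))))"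
    proof -
      have "tensor_class H H (\<Sum>i\<le>m. r i) = (\<Oplus>\<^bsub>tensor_product H H\<^esub>i\<in>{..m}. tensor_class H H (r i))"
        by (rule H.tensor.class_sum) (use kc in auto)
      then have "H.left v x = (\<Oplus>\<^bsub>H\<^esub>i\<in>{..m}. H.theta v (tensor_class H H (r i)))"
        unfolding H.left_def r(2) using H.theta_sum[of "{..m}" "\<lambda>i. tensor_class H H (r i)" v, OF rc] by (simp only:)
      then show ?thesis using H.coord_sum[of "{..m}", OF H.theta_simps(1)[OF rc]] by (simp only:)
    qed
    also have "\<dots> = (\<Sum>i\<le>m. \<Sum>q\<in>Poly_Mapping.keys (r i). Poly_Mapping.lookup (r i) q * (H.coord v (snd q) * H.coord u (fst q)))"
    proof (rule sum.cong[OF refl])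
      fix i assume i: "i \<in> {..m}"
      have f: "fst q \<in> carrier H" if "q \<in> Poly_Mapping.keys (r i)" for q using kc[OF i] that by auto
      have "H.theta v (tensor_class H H (r i)) = pm_eval H (\<lambda>q. H.coord v (snd q) \<odot>\<^bsub>H\<^esub> fst q) (r i)"
        unfolding H.theta_def by (rule H.tensor.lift_class[OF H.vspace_axioms H.theta_bilinear kc[OF i]])
      then show "H.coord u (H.theta v (tensor_class H H (r i))) =
          (\<Sum>q\<in>Poly_Mapping.keys (r i). Poly_Mapping.lookup (r i) q * (H.coord v (snd q) * H.coord u (fst q)))"
        using f by (simp add: pm_eval_def H.coord_sum H.coord_simps mult.assoc)
    qed
    finally show ?thesis by simp
  qed
  finally show "gr_coord2 u v (gr_comult_hom H H.filt m x) =
      (if H.deg u + H.deg v = m then H.coord u (H.left v x) else 0)" .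
qed

end

section \<open>Transport of the Hopf structure to the associated graded algebra\<close>

lemma algebra_hom_factor:
  assumes "algebra_hom B G f" "f ` carrier B = carrier G" "algebra_hom B A (\<lambda>x. k (f x))"
  shows "algebra_hom G A k"
proof -
  have ex: "\<exists>x\<in>carrier B. y = f x" if "y \<in> carrier G" for y using assms(2) that by auto
  note f = algebra_homD(3-6)[OF assms(1), symmetric] and kf = algebra_homD(2-6)[OF assms(3)]
  show ?thesis
  proof (rule algebra_homI)
    show "k \<one>\<^bsub>G\<^esub> = \<one>\<^bsub>A\<^esub>" unfolding f(4) by (rule kf(5))
    fix x c assume "x \<in> carrier G"
    then obtain u where u: "u \<in> carrier B" "x = f u" using ex by blast
    show "k x \<in> carrier A" unfolding u(2) by (rule kf(1)[OF u(1)])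
    show "k (c \<odot>\<^bsub>G\<^esub> x) = c \<odot>\<^bsub>A\<^esub> k x" unfolding u(2) f(3)[OF u(1)] by (rule kf(4)[OF u(1)])
    fix y assume "y \<in> carrier G"
    then obtain v where v: "v \<in> carrier B" "y = f v" using ex by blast
    show "k (x \<oplus>\<^bsub>G\<^esub> y) = k x \<oplus>\<^bsub>A\<^esub> k y" unfolding u(2) v(2) f(1)[OF u(1) v(1)] by (rule kf(2)[OF u(1) v(1)])
    show "k (x \<otimes>\<^bsub>G\<^esub> y) = k x \<otimes>\<^bsub>A\<^esub> k y" unfolding u(2) v(2) f(2)[OF u(1) v(1)] by (rule kf(3)[OF u(1) v(1)])
  qed
qed

lemma algebra_hom_cong:
  assumes "assoc_alg B" "algebra_hom B A f" "\<And>x. x \<in> carrier B \<Longrightarrow> h x = f x"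
  shows "algebra_hom B A h"
proof -
  interpret B: assoc_alg B by fact
  show ?thesis by (rule algebra_homI) (simp_all add: assms(3) algebra_homD[OF assms(2)])
qed

lemma lifting_algebraI:
  fixes A :: "('k::field, 'v, 'm) module_scheme"
  assumes A: "assoc_alg A" and P: "parameters TYPE('k) p n"
    and pres: "presented_by A (case_gens a b g) (relators p n lam mu)"
  shows "lifting_algebra A p n lam mu a b g"
proof -
  interpret assoc_alg A by (rule A)
  obtain \<pi> where \<pi>: "algebra_hom free_algebra A \<pi>" "\<forall>x. \<pi> (var x) = case_gens a b g x"
    "a_kernel free_algebra A \<pi> = Idl\<^bsub>free_algebra\<^esub> (relators p n lam mu)"
    using pres by (auto simp: presented_by_def)
  have "\<pi> r = \<zero>\<^bsub>A\<^esub>" if "r \<in> relators p n lam mu" for r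
  proof -
    have "r \<in> Idl\<^bsub>free_algebra\<^esub> (relators p n lam mu)"
      using free.genideal_self[of "relators p n lam mu"] that by auto
    then show ?thesis by (simp add: \<pi>(3)[symmetric] a_kernel_def')
  qed
  then have rels: "\<forall>r\<in>relators p n lam mu. \<pi> r = \<zero>\<^bsub>A\<^esub>" by blast
  have n: "n > 0" using P by (simp add: parameters_def)
  have gens: "\<pi> (var GenA) = a" "\<pi> (var GenB) = b" "\<pi> (var GenG) = g" using \<pi>(2) by simp_all
  have c: "a \<in> carrier A" "b \<in> carrier A" "g \<in> carrier A"
    using presented_gen_closed[OF pres, of GenA] presented_gen_closed[OF pres, of GenB]
      presented_gen_closed[OF pres, of GenG] by simp_all
  from rels[unfolded relators_hom_iff[OF A \<pi>(1) n gens]] c have "rel_alg A p n lam mu a b g"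
    using A P by (simp add: rel_alg_def rel_alg_axioms_def)
  then show ?thesis using pres by (simp add: lifting_algebra_def lifting_algebra_axioms_def)
qed

context lifting_pair
begin

text \<open>The coproduct of \<open>B\<close> preserves the total degree, so the other components of
  \<open>x'\<close> have their slices at \<open>v\<close> in degrees different from
  \<open>deg u\<close>, or these slices vanish.\<close>

lemma left_comp:
  assumes x: "x' \<in> carrier B" and u: "u \<in> H.idx" and v: "v \<in> H.idx"
  shows "B.coord u (B.left v x') = B.coord u (B.left v (B.comp (H.deg u + H.deg v) x'))"
proof -
  let ?m = "H.deg u + H.deg v" and ?N = "2 * p + (H.deg u + H.deg v)"
  have "B.left v (\<Oplus>\<^bsub>B\<^esub>l\<in>{..?N}. B.comp l x') = (\<Oplus>\<^bsub>B\<^esub>l\<in>{..?N}. B.left v (B.comp l x'))"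
    by (rule linear_map_sum[OF B.vspace_axioms B.vspace_axioms B.left_linear]) simp
  then have "B.coord u (B.left v x') = (\<Sum>l\<le>?N. B.coord u (B.left v (B.comp l x')))"
    unfolding B.comp_sum[OF x, of ?N, simplified, symmetric] by (simp add: B.coord_sum B.left_simps)
  also have "\<dots> = (\<Sum>l\<le>?N. if l = ?m then B.coord u (B.left v (B.comp ?m x')) else 0)"
  proof (rule sum.cong[OF refl])
    fix l
    have "B.coord u (B.left v (B.comp l x')) = 0" if "l \<noteq> ?m"
    proof (cases "H.deg v \<le> l")
      case True
      then have "B.left v (B.comp l x') \<in> B.homog (l - H.deg v)" by (rule homog_left(1)[OF B.comp_homog v])
      moreover have "H.deg u \<noteq> l - H.deg v" using that True by linarith
      ultimately show ?thesis using u by (simp add: B.homog_def)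
    next
      case False
      then show ?thesis using homog_left(2)[OF B.comp_homog v, of l x'] by simp
    qed
    then show "B.coord u (B.left v (B.comp l x')) = (if l = ?m then B.coord u (B.left v (B.comp ?m x')) else 0)"
      by simp
  qed
  also have "\<dots> = B.coord u (B.left v (B.comp ?m x'))" by (subst sum.delta) auto
  finally show ?thesis .
qed

abbreviation "tensor_gr_map \<equiv> tensor_lift TG (\<lambda>x y. tensor G G (gr_map x) (gr_map y))"

lemma tensor_gr_map:
  shows "bilinear B B TG (\<lambda>x y. tensor G G (gr_map x) (gr_map y))"
    and "algebra_hom (tensor_product B B) TG tensor_gr_map"
proof -
  interpret TG: tensor_alg G G by (rule tensor_alg_G)
  have f: "algebra_hom B TG (\<lambda>x. tensor G G (gr_map x) \<one>\<^bsub>G\<^esub>)"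
    by (rule algebra_hom_comp[OF gr_map_hom TG.hom_left])
  have h: "algebra_hom B TG (\<lambda>y. tensor G G \<one>\<^bsub>G\<^esub> (gr_map y))"
    by (rule algebra_hom_comp[OF gr_map_hom TG.hom_right])
  have eq: "tensor G G (gr_map x) (gr_map y) = tensor G G (gr_map x) \<one>\<^bsub>G\<^esub> \<otimes>\<^bsub>TG\<^esub> tensor G G \<one>\<^bsub>G\<^esub> (gr_map y)"
    and comm: "tensor G G \<one>\<^bsub>G\<^esub> (gr_map y) \<otimes>\<^bsub>TG\<^esub> tensor G G (gr_map x) \<one>\<^bsub>G\<^esub> =
      tensor G G (gr_map x) \<one>\<^bsub>G\<^esub> \<otimes>\<^bsub>TG\<^esub> tensor G G \<one>\<^bsub>G\<^esub> (gr_map y)"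
    if "x \<in> carrier B" "y \<in> carrier B" for x y using that by simp_all
  note L = B.tensor.lift_hom[OF TG.assoc_alg_T f h comm]
  show b: "bilinear B B TG (\<lambda>x y. tensor G G (gr_map x) (gr_map y))"
    by (rule bilinear_cong[OF B.vspace_axioms B.vspace_axioms L(1) eq])
  have lc: "tensor_gr_map t = tensor_lift TG (\<lambda>x y. tensor G G (gr_map x) \<one>\<^bsub>G\<^esub> \<otimes>\<^bsub>TG\<^esub> tensor G G \<one>\<^bsub>G\<^esub> (gr_map y)) t"
    if "t \<in> carrier (tensor_product B B)" for t
    by (rule B.tensor.lift_cong[OF TG.vspace_T b L(1) that eq])
  note Ls = algebra_homD[OF L(2)]
  interpret TB: assoc_alg "tensor_product B B" by (rule B.assoc_alg_T)
  show "algebra_hom (tensor_product B B) TG tensor_gr_map"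
    by (rule algebra_homI) (simp_all add: lc Ls)
qed

text \<open>Both sides are compared through \<open>gr_coord2 u v\<close>. On the left only degree
  \<open>deg u + deg v\<close> survives by \<open>gr_comult_hom\<close>, on the right by
  \<open>left_comp\<close>, and \<open>rel_left\<close> matches the two.\<close>

lemma comult_gr:
  assumes x: "x' \<in> carrier B"
  shows "comult G (gr_map x') = tensor_gr_map (comult B x')"
proof (rule gr_coord2_eqI)
  interpret TG: tensor_alg G G by (rule tensor_alg_G)
  let ?M = "{m. gr_map x' m \<noteq> cls m \<zero>\<^bsub>H\<^esub>}" and ?c = "\<lambda>m. gr_comult_hom H H.filt m (rep (gr_map x' m))"
  have cc: "?c m \<in> carrier TG" for m by (rule gr_comult_hom(1)[OF rel_filt[OF rel_rep]])
  have fin: "finite ?M" using gr_map_closed[OF x] by (simp add: gr_simps)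
  show "comult G (gr_map x') \<in> carrier TG"
    unfolding gr_comult using cc by (intro TG.T.finsum_closed) auto
  show "tensor_gr_map (comult B x') \<in> carrier TG"
    using algebra_homD(2)[OF tensor_gr_map(2)] x by simp
  fix u v assume u: "u \<in> H.idx" and v: "v \<in> H.idx"
  let ?m = "H.deg u + H.deg v"
  have K: "gr_coord2 u v (tensor_gr_map t) = B.coord u (B.theta v t)" if "t \<in> carrier (tensor_product B B)" for t
    using that
    by (induction t rule: B.tensor.tensor_induct)
      (simp_all add: B.tensor.lift_tensor[OF TG.vspace_T tensor_gr_map(1)] gr_coord2(2)[OF u v] gr_coord_map u v
        algebra_homD(2,3)[OF tensor_gr_map(2)] linear_mapD(2)[OF gr_coord2(1)[OF u v], unfolded ground_simps]
        B.coord_simps B.theta_simps)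
  have "gr_coord2 u v (comult G (gr_map x')) = (\<Sum>m\<in>?M. gr_coord2 u v (?c m))"
    unfolding gr_comult using linear_map_sum[OF TG.vspace_T vspace_ground gr_coord2(1)[OF u v], of ?M ?c] cc
    by (simp add: finsum_ground)
  also have "\<dots> = (\<Sum>m\<in>?M. if m = ?m then H.coord u (H.left v (rep (gr_map x' ?m))) else 0)"
    by (rule sum.cong[OF refl]) (auto simp: gr_comult_hom(2)[OF rel_filt[OF rel_rep] u v])
  also have "\<dots> = (if ?m \<in> ?M then H.coord u (H.left v (rep (gr_map x' ?m))) else 0)"
    using fin by (subst sum.delta) auto
  also have "\<dots> = B.coord u (B.left v (B.comp ?m x'))"
  proof (cases "?m \<in> ?M")
    case True
    have "rel (H.deg u) (H.left v (rep (gr_map x' ?m))) (B.left v (B.comp ?m x'))"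
      using rel_left(1)[OF rel_rep[of ?m x'] v] by simp
    then show ?thesis using True u by (simp add: rel_def)
  next
    \<comment> \<open>A degree that is missing from the sum in \<open>gr_comult\<close> is one where
      the component of \<open>x'\<close> is zero, so the right-hand side vanishes as well.\<close>
    case False
    then have "cls ?m (section_of ?m x') = cls ?m \<zero>\<^bsub>H\<^esub>" by (simp add: gr_map_def)
    then have z: "\<forall>w\<in>H.idx. H.deg w = ?m \<longrightarrow> B.coord w x' = 0"
      by (simp add: cls_eq_iff[OF section_filt H.filt_sub(2)] coord_section)
    have "B.comp ?m x' = \<zero>\<^bsub>B\<^esub>"
      by (rule B.coord_eqI) (use z in \<open>auto simp: B.coord_comp\<close>)
    then show ?thesis using False by simp
  qed
  also have "\<dots> = gr_coord2 u v (tensor_gr_map (comult B x'))"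
    unfolding left_comp[OF x u v, symmetric] using x by (simp add: K B.left_def)
  finally show "gr_coord2 u v (comult G (gr_map x')) = gr_coord2 u v (tensor_gr_map (comult B x'))" .
qed

lemma hopf_iso_gr: "hopf_iso B G gr_map"
  unfolding hopf_iso_def
  using gr_map_hom gr_map_inj gr_map_carrier comult_gr counit_gr by (auto simp: bij_betw_def)

text \<open>Presentation, coproduct and counit are transported from \<open>B\<close> along
  \<open>gr_map\<close>. The associated graded algebra thereby becomes an instance of the same
  locale with zero parameters, and its Hopf axioms come from there.\<close>

lemma hopf_lifting_gr: "hopf_lifting G p n 0 0 (gr_map a') (gr_map b') (gr_map g')"
proof -
  interpret TG: tensor_alg G G by (rule tensor_alg_G)
  obtain \<pi> where \<pi>: "algebra_hom free_algebra B \<pi>" "\<forall>x. \<pi> (var x) = case_gens a' b' g' x"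
    "range \<pi> = carrier B" "a_kernel free_algebra B \<pi> = Idl\<^bsub>free_algebra\<^esub> (relators p n 0 0)"
    using B.presented by (auto simp: presented_by_def)
  have \<pi>c: "\<pi> f \<in> carrier B" for f using \<pi>(3) by auto
  have pres: "presented_by G (case_gens (gr_map a') (gr_map b') (gr_map g')) (relators p n 0 0)"
    unfolding presented_by_def
  proof (intro exI[of _ "\<lambda>f. gr_map (\<pi> f)"] conjI allI)
    show "algebra_hom free_algebra G (\<lambda>f. gr_map (\<pi> f))" by (rule algebra_hom_comp[OF \<pi>(1) gr_map_hom])
    show "gr_map (\<pi> (var x)) = case_gens (gr_map a') (gr_map b') (gr_map g') x" for x
      using \<pi>(2) by (cases x) simp_all
    show "range (\<lambda>f. gr_map (\<pi> f)) = carrier G"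
      unfolding gr_map_carrier[symmetric] \<pi>(3)[symmetric] by auto
    have "gr_map (\<pi> f) = \<zero>\<^bsub>G\<^esub> \<longleftrightarrow> \<pi> f = \<zero>\<^bsub>B\<^esub>" for f
      unfolding gr_map_zero[symmetric] using inj_on_eq_iff[OF gr_map_inj \<pi>c B.zero_closed] .
    then show "a_kernel free_algebra G (\<lambda>f. gr_map (\<pi> f)) = Idl\<^bsub>free_algebra\<^esub> (relators p n 0 0)"
      unfolding \<pi>(4)[symmetric] by (simp add: a_kernel_def')
  qed
  interpret GL: lifting_algebra G p n 0 0 "gr_map a'" "gr_map b'" "gr_map g'"
    by (rule lifting_algebraI[OF assoc_alg_G B.parameters_axioms pres])
  note t = B.tensor.lift_tensor[OF TG.vspace_T tensor_gr_map(1)] algebra_homD(3)[OF tensor_gr_map(2)]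
  show ?thesis
  proof (intro hopf_lifting.intro GL.lifting_algebra_axioms hopf_lifting_axioms.intro)
    have "algebra_hom B TG (\<lambda>x. tensor_gr_map (comult B x))"
      by (rule algebra_hom_comp[OF B.comult_hom tensor_gr_map(2)])
    then have "algebra_hom B TG (\<lambda>x. comult G (gr_map x))"
      by (rule algebra_hom_cong[OF B.assoc_alg_axioms]) (rule comult_gr)
    then show "algebra_hom G TG (comult G)" by (rule algebra_hom_factor[OF gr_map_hom gr_map_carrier])
    have "algebra_hom B ground (\<lambda>x. counit G (gr_map x))"
      by (rule algebra_hom_cong[OF B.assoc_alg_axioms B.counit_hom]) (rule counit_gr)
    then show "algebra_hom G ground (counit G)" by (rule algebra_hom_factor[OF gr_map_hom gr_map_carrier])
  qed (simp_all add: comult_gr counit_gr t B.comult_a_def B.comult_b_def B.comult_g_def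
      GL.comult_a_def GL.comult_b_def GL.comult_g_def gr_map_simps(4))
qed

text \<open>Pairing the associated graded algebra with itself makes \<open>graded\<close> applicable
  to it. What remains is to identify the grading by degrees of monomials with
  \<open>gr_degree\<close>, which is done through coordinates.\<close>

lemma graded_gr: "graded_hopf_algebra G (gr_degree H H.filt)"
  and gr_map_degree: "gr_map ` B.homog m = gr_degree H H.filt m"
proof -
  interpret GL: lifting_pair G G p n 0 0 "gr_map a'" "gr_map b'" "gr_map g'" "gr_map a'" "gr_map b'" "gr_map g'"
    by (intro lifting_pair.intro hopf_lifting_gr)
  have mon: "GL.H.mon u = gr_map (B.mon u)" for u
    using algebra_hom_power[OF B.assoc_alg_axioms assoc_alg_G gr_map_hom]
    by (cases u) (simp add: GL.H.mon_def B.mon_def gr_map_simps)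
  have coord: "GL.H.coord u (gr_map x') = B.coord u x'" if x: "x' \<in> carrier B" and u: "u \<in> H.idx" for u x'
  proof -
    have "gr_map x' = (\<Oplus>\<^bsub>G\<^esub>v\<in>H.idx. gr_coord v (gr_map x') \<odot>\<^bsub>G\<^esub> GL.H.mon v)"
      unfolding mon by (rule gr_expand[OF gr_map_closed[OF x]])
    then have "GL.H.coord u (gr_map x') = GL.H.coord u (\<Oplus>\<^bsub>G\<^esub>v\<in>H.idx. gr_coord v (gr_map x') \<odot>\<^bsub>G\<^esub> GL.H.mon v)"
      by (rule arg_cong)
    also have "\<dots> = gr_coord u (gr_map x')" by (rule GL.H.coord_combination[OF u])
    finally show ?thesis using u by (simp add: gr_coord_map)
  qed
  have 1: "GL.H.homog m = gr_map ` B.homog m" for m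
    unfolding GL.H.homog_def B.homog_def gr_map_carrier[symmetric] by (auto simp: coord)
  have "gr_map x' \<in> gr_degree H H.filt m \<longleftrightarrow> x' \<in> B.homog m" if x: "x' \<in> carrier B" for x' m
  proof -
    have "gr_map x' \<in> gr_degree H H.filt m \<longleftrightarrow> (\<forall>j. j \<noteq> m \<longrightarrow> cls j (section_of j x') = cls j \<zero>\<^bsub>H\<^esub>)"
      using gr_map_closed[OF x] by (simp add: gr_degree_def gr_map_def)
    also have "\<dots> \<longleftrightarrow> x' \<in> B.homog m"
      using x by (auto simp: cls_eq_iff[OF section_filt H.filt_sub(2)] coord_section B.homog_def)
    finally show ?thesis .
  qed
  note 2 = this
  have 3: "gr_map ` B.homog m = gr_degree H H.filt m" for m
  proof (intro equalityI subsetI)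
    fix \<phi> assume "\<phi> \<in> gr_map ` B.homog m"
    then show "\<phi> \<in> gr_degree H H.filt m" using 2 by (auto simp: B.homog_def)
  next
    fix \<phi> assume \<phi>: "\<phi> \<in> gr_degree H H.filt m"
    then have "\<phi> \<in> carrier G" by (simp add: gr_degree_def)
    then obtain x' where "x' \<in> carrier B" "\<phi> = gr_map x'" using carrier_gr_ex by blast
    with 2 \<phi> show "\<phi> \<in> gr_map ` B.homog m" by blast
  qed
  then show "gr_map ` B.homog m = gr_degree H H.filt m" .
  have "GL.H.homog = gr_degree H H.filt" using 1 3 by auto
  then show "graded_hopf_algebra G (gr_degree H H.filt)" using GL.graded by simp
qed

lemma graded_iso: "graded_hopf_isomorphic G (gr_degree H H.filt) B B.homog"
  unfolding graded_hopf_isomorphic_def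
proof (intro exI conjI allI)
  let ?h = "the_inv_into (carrier B) gr_map"
  show "hopf_iso G B ?h"
    by (rule hopf_hom_inverse[OF B.assoc_alg_axioms assoc_alg_G B.comult_closed hopf_iso_gr])
  have "?h (gr_map x') = x'" if "x' \<in> carrier B" for x'
    by (rule the_inv_into_f_f[OF gr_map_inj that])
  then show "?h ` gr_degree H H.filt m = B.homog m" for m
    unfolding gr_map_degree[symmetric] by (force simp: B.homog_def image_iff)
qed

end

section \<open>Existence of the Hopf algebras and conclusion\<close>

context hopf_lifting
begin

lemma hopf_with_relations: "hopf_with_relations p n lam mu H a b g"
  unfolding hopf_with_relations_def
  using hopf_algebra presented by (simp add: comult_a_def comult_b_def comult_g_def)

end

text \<open>Coproduct and counit come from the universal property of the presentation, applied to
  \<open>rel_alg_comult\<close> and \<open>rel_alg_counit\<close>. Adjoining them to the record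
  gives a formally different algebra, to which the structure passes along the identity map.\<close>

lemma hopf_lifting_exists:
  fixes lam mu :: "'k::field"
  assumes "parameters TYPE('k) p n"
  shows "\<exists>(H :: ('k, ('k, gens) free set) hopf) a b g. hopf_lifting H p n lam mu a b g"
proof -
  let ?R = "relators p n lam mu" and ?Q = "presented_algebra (relators p n lam mu)"
  let ?c = "\<lambda>x. quot_class (Idl\<^bsub>free_algebra\<^esub> ?R) (var x)"
  note Q = presented_algebra[of ?R]
  have gens: "case_gens (?c GenA) (?c GenB) (?c GenG) = ?c" by (auto simp: fun_eq_iff split: gens.split)
  interpret L: lifting_algebra ?Q p n lam mu "?c GenA" "?c GenB" "?c GenG"
    by (rule lifting_algebraI[OF Q(1) assms]) (simp only: gens Q(2))
  obtain \<Delta> where \<Delta>: "algebra_hom ?Q (tensor_product ?Q ?Q) \<Delta>" "\<Delta> (?c GenA) = L.comult_a"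
    "\<Delta> (?c GenB) = L.comult_b" "\<Delta> (?c GenG) = L.comult_g"
    by (rule L.hom_exists[OF L.rel_alg_comult])
  obtain \<epsilon> :: "('k, gens) free set \<Rightarrow> 'k" where \<epsilon>: "algebra_hom ?Q ground \<epsilon>"
    "\<epsilon> (?c GenA) = 0" "\<epsilon> (?c GenB) = 0" "\<epsilon> (?c GenG) = 1"
    by (rule L.hom_exists[OF L.rel_alg_counit])
  let ?H = "module.extend ?Q (hopf.fields \<Delta> \<epsilon>)"
  have hom: "algebra_hom A ?H f = algebra_hom A ?Q f" "algebra_hom ?H A' f' = algebra_hom ?Q A' f'"
    for A :: "('k, 'x, 'y) module_scheme" and A' :: "('k, 'x', 'y') module_scheme" and f f'
    by (simp_all add: algebra_hom_def ring_hom_def linear_map_def)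
  have "algebra_hom ?Q ?Q (\<lambda>x. x)" by (rule algebra_homI) simp_all
  then have "algebra_hom ?Q ?H (\<lambda>x. x)" by (simp only: hom)
  then have AH: "assoc_alg ?H" by (rule assoc_alg_image[OF Q(1)]) simp_all
  have "presented_by ?H (case_gens (?c GenA) (?c GenB) (?c GenG)) ?R"
    using Q(2) unfolding presented_by_def hom gens by (simp add: a_kernel_def')
  then interpret LH: lifting_algebra ?H p n lam mu "?c GenA" "?c GenB" "?c GenG"
    by (rule lifting_algebraI[OF AH assms])
  have "hopf_lifting ?H p n lam mu (?c GenA) (?c GenB) (?c GenG)"
    by (intro hopf_lifting.intro LH.lifting_algebra_axioms hopf_lifting_axioms.intro)
      (simp_all add: hom tensor_extend \<Delta> \<epsilon> LH.comult_a_def LH.comult_b_def LH.comult_g_def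
        L.comult_a_def L.comult_b_def L.comult_g_def)
  then show ?thesis by blast
qed

theorem theorem4p1:
  fixes lam mu :: "'k::field" and p n :: nat
  assumes "CHAR('k) = p" and "p > 2" and "n > 0" and "p dvd n"
  shows "\<exists>(H :: ('k, ('k, gens) free set) hopf) a b g.
    hopf_with_relations p n lam mu H a b g \<and>
    pointed H \<and>
    filtered_hopf_algebra H (coradical_filtration H) \<and>
    graded_hopf_algebra (gr_hopf H (coradical_filtration H))
      (gr_degree H (coradical_filtration H)) \<and>
    (\<exists>(B :: ('k, ('k, gens) free set) hopf) A.
      is_bosonization p n B A \<and>
      graded_hopf_isomorphic
        (gr_hopf H (coradical_filtration H)) (gr_degree H (coradical_filtration H)) B A)"
proof -
  have params: "parameters TYPE('k) p n" using assms by unfold_locales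
  obtain H :: "('k, ('k, gens) free set) hopf" and a b g where H: "hopf_lifting H p n lam mu a b g"
    using hopf_lifting_exists[OF params] by blast
  obtain B :: "('k, ('k, gens) free set) hopf" and a' b' g' where B: "hopf_lifting B p n 0 0 a' b' g'"
    using hopf_lifting_exists[OF params] by blast
  interpret P: lifting_pair H B p n lam mu a b g a' b' g' by (intro lifting_pair.intro H B)
  have F: "coradical_filtration H = P.H.filt" by (rule ext) (rule P.coradical_filtration_eq)
  have "g' \<in> P.B.homog 0" "a' \<in> P.B.homog 1" "b' \<in> P.B.homog 1"
    using P.rel_homog P.rel_gens by blast+
  then have "is_bosonization p n B P.B.homog"
    unfolding is_bosonization_def
    using P.B.hopf_with_relations P.graded P.B.pointed P.B.has_dim_idx by blast
  then show ?thesis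
    unfolding F using F P.H.hopf_with_relations P.H.pointed P.filtered P.graded_gr P.graded_iso by metis
qed

end
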